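(* Let $V^{\mathrm{ir}}_{2,4}=\mathrm{SO}(3)\times\mathrm{SO}(3)/\mathrm{SO}(2)_{\mathrm{ir}}$ be the twisted Stiefel manifold with the metrics $g_{\alpha\beta\gamma}$, $\alpha,\beta,\gamma>0$. (1) $(V^{\mathrm{ir}}_{2,4},g_{\alpha\beta\gamma})$ carries two invariant normal almost contact metric structures, characterized by $$\xi\cong\eta=e_1,\qquad \varphi_\pm=-E_{23}\pm E_{45},\qquad dF_\pm=0 .$$ Both normal almost contact metric structures admit a unique characteristic connection, with the same characteristic torsion $$T^c=\eta\wedge d\eta=\frac{2\sqrt\alpha}{5\beta}\,e_1\wedge e_2\wedge e_3-\frac{\sqrt\alpha}{5\gamma}\,e_1\wedge e_4\wedge e_5 .$$ For a metric $g_{\alpha\beta\gamma}$ defining a nearly integrable $\mathrm{SO}(3)_{\mathrm{ir}}$ structure, this connection coincides with the characteristic connection of the $\mathrm{SO}(3)_{\mathrm{ir}}$ structure. (2) The invariant normal almost contact metric structure $(\xi,\eta,\varphi_+)$ is Sasakian if and only if $\alpha=25\beta^2=100\gamma^2$; it is in addition a nearly integrable $\mathrm{SO}(3)_{\mathrm{ir}}$ structure for $(\alpha,\beta,\gamma)=\left(\frac{25}{36},\frac16,\frac1{12}\right)$.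
   Context: General notation. $E_{ij}$ is the endomorphism sending $e_i$ to $e_j$, $e_j$ to $-e_i$ and all other basis vectors to zero. $\mathrm{SO}(3)_{\mathrm{ir}}\subset\mathrm{SO}(5)$ is the image of the irreducible representation $\varrho(h)X=hXh^{-1}$ of $\mathrm{SO}(3)$ on symmetric trace-free real $3\times3$ matrices, identified with $\mathbb{R}^5$ by $$X=\sum_{i=1}^5x_ie_i=\begin{bmatrix}\frac{x_1}{\sqrt3}-x_5&x_4&x_2\\ x_4&\frac{x_1}{\sqrt3}+x_5&x_3\\ x_2&x_3&-\frac{2x_1}{\sqrt3}\end{bmatrix};$$ its Lie algebra is spanned by $X_1=\sqrt3E_{13}+E_{42}+E_{53}$, $X_2=\sqrt3E_{21}+E_{34}+E_{52}$, $X_3=E_{23}+2E_{45}$. It is the stabilizer of the symmetric trilinear form $\Upsilon$ with $$\Upsilon(X,X,X)=x_1^3+\tfrac32x_1(x_2^2+x_3^2-2x_4^2-2x_5^2)+\tfrac{3\sqrt3}{2}(x_2^2-x_3^2)x_5-3\sqrt3\,x_2x_3x_4.$$ An $\mathrm{SO}(3)_{\mathrm{ir}}$ structure on a Riemannian $5$-manifold $(M,g)$ is a reduction of its orthonormal frame bundle to $\mathrm{SO}(3)_{\mathrm{ir}}$; it determines a totally symmetric $(3,0)$-tensor field $\Upsilon$ on $M$ which, in every adapted frame $(f_1,\dots,f_5)$ and for $X=\sum_{i=1}^5x_if_i$, is given by $\Upsilon(X,X,X)=x_1^3+\tfrac32x_1(x_2^2+x_3^2-2x_4^2-2x_5^2)+\tfrac{3\sqrt3}{2}(x_2^2-x_3^2)x_5-3\sqrt3\,x_2x_3x_4$.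 It is nearly integrable if $(\nabla^g_v\Upsilon)(v,v,v)=0$ for all vector fields $v$, $\nabla^g$ being the Levi-Civita connection. A characteristic connection of a $G$-structure is a metric connection preserving the $G$-structure whose torsion, viewed as $T(X,Y,Z)=g(T(X,Y),Z)$, is totally skew-symmetric. The space. Let $G=\mathrm{SO}(3)\times\mathrm{SO}(3)$ and let $H=\mathrm{SO}(2)_{\mathrm{ir}}$ be the image of $\mathrm{SO}(2)\ni A\mapsto (A,A^2)\in G$, where $\mathrm{SO}(2)\subset\mathrm{SO}(3)$ is $\exp(\mathbb{R}s_3)$. With $s_1=E_{23}$, $s_2=E_{31}$, $s_3=E_{12}$ in $\mathfrak{so}(3)$, put $a_i=(s_i,0)$, $b_i=(0,s_i)$. Then $\mathfrak h=\mathbb{R}\tilde e_0$, $\tilde e_0=a_3+2b_3$. Put $\tilde e_1=b_3-2a_3$, $\tilde e_2=a_1$, $\tilde e_3=a_2$, $\tilde e_4=b_1$, $\tilde e_5=b_2$; $\mathfrak m=\mathrm{span}(\tilde e_1,\dots,\tilde e_5)$ is a reductive complement of $\mathfrak h$. The isotropy representation is $\lambda(A)=\mathrm{diag}(1,A,A^2)$, with $d\lambda(\tilde e_0)=E_{23}+2E_{45}$. The $G$-invariant metric $g_{\alpha\beta\gamma}$ on $V^{\mathrm{ir}}_{2,4}=G/H$ is given on $\mathfrak m$ by $\mathrm{diag}(\alpha,\beta,\beta,\gamma,\gamma)$ in the basis $\tilde e_1,\dots,\tilde e_5$, with orthonormal basis $e_1=\tilde e_1/\sqrt\alpha$, $e_2=\tilde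 e_2/\sqrt\beta$, $e_3=\tilde e_3/\sqrt\beta$, $e_4=\tilde e_4/\sqrt\gamma$, $e_5=\tilde e_5/\sqrt\gamma$, identified with its dual basis. Invariant tensors on $G/H$ are identified with $\lambda(H)$-invariant tensors on $\mathfrak m$. The $\mathrm{SO}(3)_{\mathrm{ir}}$ structure on $(V^{\mathrm{ir}}_{2,4},g_{\alpha\beta\gamma})$ is the $G$-invariant one for which $(e_1,\dots,e_5)$ is an adapted frame at the base point. Contact structures. An almost contact metric structure consists of a vector field $\xi$ with dual $1$-form $\eta$ and a $(1,1)$-tensor field $\varphi$ with $\varphi^2=-\mathrm{Id}+\eta\otimes\xi$ and $g(\varphi X,\varphi Y)=g(X,Y)-\eta(X)\eta(Y)$. Its fundamental form is $F(X,Y)=g(X,\varphi(Y))$ ($F_\pm$ for $\varphi_\pm$). It is normal if $$N_\varphi(X,Y)=[\varphi X,\varphi Y]-\varphi[X,\varphi Y]-\varphi[\varphi X,Y]+\varphi^2[X,Y]+d\eta(X,Y)\xi$$ vanishes, where $d\eta(X,Y)=X\eta(Y)-Y\eta(X)-\eta([X,Y])$. It is Sasakian if it is normal and $2F=d\eta$. *)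

theory Defs
  imports "HOL-Analysis.Analysis"
begin

text \<open>
  Tensor fields on \<open>G/H\<close> are represented by their pull-backs to \<open>G\<close>.  Since
  \<open>T(G/H) = G \<times>\<^sub>H \<mm>\<close>, a vector field is a smooth map \<open>X : G \<rightarrow> \<mm>\<close> with
  \<open>X (p h) = \<lambda>(h)\<^sup>-\<^sup>1 (X p)\<close> for \<open>h \<in> H\<close>, the tangent vector at \<open>p H\<close> being the class of
  \<open>p exp(t (X p))\<close> at \<open>t = 0\<close>; likewise for forms and endomorphism fields.  A field is
  \<open>G\<close>-invariant iff this map is invariant under left translations.  Elements of \<open>\<mm>\<close> are written
  as \<open>real ^ 5\<close>, in coordinates for the basis
  \<open>b\<^sub>3 - 2 a\<^sub>3, a\<^sub>1, a\<^sub>2, b\<^sub>1, b\<^sub>2\<close> of \<open>\<mm>\<close>, where \<open>a\<^sub>i = (s\<^sub>i, 0)\<close>, \<open>b\<^sub>i = (0, s\<^sub>i)\<close>.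
\<close>


subsection \<open>The group, the subgroup and the reductive complement\<close>

type_synonym mat2 = "(real^3^3) \<times> (real^3^3)"

definition mat2_mult :: "mat2 \<Rightarrow> mat2 \<Rightarrow> mat2" where
  "mat2_mult P Q = (fst P ** fst Q, snd P ** snd Q)"

definition mat2_transpose :: "mat2 \<Rightarrow> mat2" where
  "mat2_transpose P = (transpose (fst P), transpose (snd P))"

typedef SO3xSO3 = "{P :: mat2. rotation_matrix (fst P) \<and> rotation_matrix (snd P)}"
  morphisms mat_of Abs_SO3xSO3
proof
  show "(mat 1, mat 1) \<in> {P :: mat2. rotation_matrix (fst P) \<and> rotation_matrix (snd P)}"
    by (simp add: rotation_matrix_def orthogonal_matrix_id)
qed

setup_lifting type_definition_SO3xSO3

lift_definition gmult :: "SO3xSO3 \<Rightarrow> SO3xSO3 \<Rightarrow> SO3xSO3" (infixl "\<odot>" 70) is mat2_mult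
  by (auto simp: mat2_mult_def rotation_matrix_def orthogonal_matrix_mul det_mul)

text \<open>\<open>Eso i j\<close> sends \<open>e\<^sub>i\<close> to \<open>e\<^sub>j\<close> and \<open>e\<^sub>j\<close> to \<open>- e\<^sub>i\<close>; matrices act on column vectors.\<close>

definition Eso :: "3 \<Rightarrow> 3 \<Rightarrow> real^3^3" where
  "Eso i j = (\<chi> r c. (if r = j \<and> c = i then 1 else 0) - (if r = i \<and> c = j then 1 else 0))"

definition s1 :: "real^3^3" where "s1 = Eso 2 3"
definition s2 :: "real^3^3" where "s2 = Eso 3 1"
definition s3 :: "real^3^3" where "s3 = Eso 1 2"

text \<open>\<open>rot3 t\<close> is \<open>exp (t s3)\<close>.\<close>

definition rot3 :: "real \<Rightarrow> real^3^3" where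
  "rot3 t = vector [vector [cos t, - sin t, 0], vector [sin t, cos t, 0], vector [0, 0, 1]]"

lemma rotation_matrix_rot3: "rotation_matrix (rot3 t)"
proof -
  have 1: "cos t * cos t + sin t * sin t = 1"
    by (metis power2_eq_square sin_cos_squared_add2)
  then have 2: "sin t * sin t + cos t * cos t = 1"
    by (simp only: add.commute)
  show ?thesis
    unfolding rotation_matrix_def orthogonal_matrix rot3_def
    by (simp add: vec_eq_iff forall_3 matrix_matrix_mult_def transpose_def mat_def sum_3 det_3 1 2)
qed

lift_definition Hel :: "real \<Rightarrow> SO3xSO3" is "\<lambda>t. (rot3 t, rot3 t ** rot3 t)"
  by (use rotation_matrix_rot3 in \<open>auto simp: rotation_matrix_def orthogonal_matrix_mul det_mul\<close>)

text \<open>\<open>emb x\<close> is the element of \<open>\<mm>\<close> with coordinates \<open>x\<close>; \<open>h0\<close> spans the Lie algebra of \<open>H\<close>, and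
  \<open>m_part\<close> is the projection to \<open>\<mm>\<close> along it.\<close>

definition h0 :: mat2 where "h0 = (s3, 2 *\<^sub>R s3)"

definition emb :: "real^5 \<Rightarrow> mat2" where
  "emb x = x$1 *\<^sub>R ((0, s3) - 2 *\<^sub>R (s3, 0)) + x$2 *\<^sub>R (s1, 0) + x$3 *\<^sub>R (s2, 0)
     + x$4 *\<^sub>R (0, s1) + x$5 *\<^sub>R (0, s2)"

definition m_part :: "mat2 \<Rightarrow> real^5" where
  "m_part v = (THE x. \<exists>r. v = r *\<^sub>R h0 + emb x)"

text \<open>The isotropy representation \<open>\<lambda>\<close> of \<open>Hel t\<close>: the restriction of \<open>Ad\<close> to \<open>\<mm>\<close>.\<close>

definition isot :: "real \<Rightarrow> real^5 \<Rightarrow> real^5" where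
  "isot t x = m_part (mat2_mult (mat2_mult (mat_of (Hel t)) (emb x)) (mat2_transpose (mat_of (Hel t))))"


subsection \<open>Smooth functions and derivatives on the group\<close>

fun cdiff :: "nat \<Rightarrow> ('a::real_normed_vector \<Rightarrow> 'b::real_normed_vector) \<Rightarrow> bool" where
  "cdiff 0 F \<longleftrightarrow> continuous_on UNIV F"
| "cdiff (Suc n) F \<longleftrightarrow>
     (\<forall>x. F differentiable (at x)) \<and> (\<forall>v. cdiff n (\<lambda>x. frechet_derivative F (at x) v))"

text \<open>\<open>SO(3) \<times> SO(3)\<close> is a closed submanifold of the space of pairs of matrices, so the smooth
  functions on it are the restrictions of the smooth functions on that vector space.\<close>

definition smooth :: "(SO3xSO3 \<Rightarrow> 'b::real_normed_vector) \<Rightarrow> bool" where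
  "smooth f \<longleftrightarrow> (\<exists>F :: mat2 \<Rightarrow> 'b. (\<forall>n. cdiff n F) \<and> (\<forall>p. f p = F (mat_of p)))"

text \<open>Derivative of \<open>f\<close> at \<open>p\<close> in the direction of the tangent vector \<open>p v\<close>, for \<open>v\<close> in the Lie
  algebra: the common derivative of \<open>f\<close> along all curves through \<open>p\<close> with this velocity.\<close>

definition dir_deriv :: "(SO3xSO3 \<Rightarrow> 'b::real_normed_vector) \<Rightarrow> SO3xSO3 \<Rightarrow> mat2 \<Rightarrow> 'b" where
  "dir_deriv f p v = (THE d. \<forall>c :: real \<Rightarrow> SO3xSO3.
      c 0 = p \<and> ((\<lambda>t. mat_of (c t)) has_vector_derivative mat2_mult (mat_of p) v) (at 0)
      \<longrightarrow> ((\<lambda>t. f (c t)) has_vector_derivative d) (at 0))"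


subsection \<open>Fields on the homogeneous space\<close>

type_synonym sfield = "SO3xSO3 \<Rightarrow> real"
type_synonym vfield = "SO3xSO3 \<Rightarrow> real^5"
type_synonym form1 = "SO3xSO3 \<Rightarrow> real^5 \<Rightarrow> real"
type_synonym endo = "SO3xSO3 \<Rightarrow> real^5 \<Rightarrow> real^5"

definition scalar_field :: "sfield \<Rightarrow> bool" where
  "scalar_field f \<longleftrightarrow> smooth f \<and> (\<forall>p t. f (p \<odot> Hel t) = f p)"

definition vector_field :: "vfield \<Rightarrow> bool" where
  "vector_field X \<longleftrightarrow> smooth X \<and> (\<forall>p t. X (p \<odot> Hel t) = isot (- t) (X p))"

definition one_form :: "form1 \<Rightarrow> bool" where
  "one_form \<omega> \<longleftrightarrow> (\<forall>p. linear (\<omega> p)) \<and> (\<forall>x. smooth (\<lambda>p. \<omega> p x))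
     \<and> (\<forall>p t x. \<omega> (p \<odot> Hel t) x = \<omega> p (isot t x))"

definition endo_field :: "endo \<Rightarrow> bool" where
  "endo_field \<phi> \<longleftrightarrow> (\<forall>p. linear (\<phi> p)) \<and> (\<forall>x. smooth (\<lambda>p. \<phi> p x))
     \<and> (\<forall>p t x. \<phi> (p \<odot> Hel t) x = isot (- t) (\<phi> p (isot t x)))"

definition left_invariant :: "(SO3xSO3 \<Rightarrow> 'b) \<Rightarrow> bool" where
  "left_invariant T \<longleftrightarrow> (\<forall>q p. T (q \<odot> p) = T p)"

text \<open>The derivative along \<open>X\<close> differentiates in the direction of the horizontal lift of \<open>X\<close>,
  i.e. the lift with values in \<open>\<mm>\<close>.\<close>

definition along :: "vfield \<Rightarrow> (SO3xSO3 \<Rightarrow> 'b::real_normed_vector) \<Rightarrow> SO3xSO3 \<Rightarrow> 'b" where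
  "along X f = (\<lambda>p. dir_deriv f p (emb (X p)))"

definition lie_bracket :: "vfield \<Rightarrow> vfield \<Rightarrow> vfield" where
  "lie_bracket X Y = (THE Z. vector_field Z \<and>
     (\<forall>f :: sfield. scalar_field f \<longrightarrow>
        along Z f = (\<lambda>p. along X (along Y f) p - along Y (along X f) p)))"

definition ev1 :: "form1 \<Rightarrow> vfield \<Rightarrow> sfield" where
  "ev1 \<omega> X = (\<lambda>p. \<omega> p (X p))"

definition act :: "endo \<Rightarrow> vfield \<Rightarrow> vfield" where
  "act \<phi> X = (\<lambda>p. \<phi> p (X p))"

definition ext_deriv1 :: "form1 \<Rightarrow> vfield \<Rightarrow> vfield \<Rightarrow> sfield" where
  "ext_deriv1 \<omega> X Y = (\<lambda>p. along X (ev1 \<omega> Y) p - along Y (ev1 \<omega> X) p - ev1 \<omega> (lie_bracket X Y) p)"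

definition ext_deriv2 :: "(vfield \<Rightarrow> vfield \<Rightarrow> sfield) \<Rightarrow> vfield \<Rightarrow> vfield \<Rightarrow> vfield \<Rightarrow> sfield" where
  "ext_deriv2 F X Y Z = (\<lambda>p.
      along X (F Y Z) p - along Y (F X Z) p + along Z (F X Y) p
      - F (lie_bracket X Y) Z p + F (lie_bracket X Z) Y p - F (lie_bracket Y Z) X p)"

text \<open>Wedge products are normalised by \<open>(e\<^sub>i \<and> e\<^sub>j)(e\<^sub>i, e\<^sub>j) = 1\<close>, in accordance with \<open>ext_deriv1\<close>.\<close>

definition wedge12 :: "form1 \<Rightarrow> (vfield \<Rightarrow> vfield \<Rightarrow> sfield) \<Rightarrow> vfield \<Rightarrow> vfield \<Rightarrow> vfield \<Rightarrow> sfield" where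
  "wedge12 \<eta> \<omega> X Y Z = (\<lambda>p. ev1 \<eta> X p * \<omega> Y Z p + ev1 \<eta> Y p * \<omega> Z X p + ev1 \<eta> Z p * \<omega> X Y p)"

definition wedge111 :: "form1 \<Rightarrow> form1 \<Rightarrow> form1 \<Rightarrow> vfield \<Rightarrow> vfield \<Rightarrow> vfield \<Rightarrow> sfield" where
  "wedge111 u v w X Y Z = (\<lambda>p.
      ev1 u X p * (ev1 v Y p * ev1 w Z p - ev1 v Z p * ev1 w Y p)
    - ev1 u Y p * (ev1 v X p * ev1 w Z p - ev1 v Z p * ev1 w X p)
    + ev1 u Z p * (ev1 v X p * ev1 w Y p - ev1 v Y p * ev1 w X p))"


subsection \<open>The metrics and their orthonormal frames\<close>

definition gmet :: "real \<Rightarrow> real \<Rightarrow> real \<Rightarrow> real^5 \<Rightarrow> real^5 \<Rightarrow> real" where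
  "gmet \<alpha> \<beta> \<gamma> x y = \<alpha> * x$1 * y$1 + \<beta> * (x$2 * y$2 + x$3 * y$3) + \<gamma> * (x$4 * y$4 + x$5 * y$5)"

definition onb :: "real \<Rightarrow> real \<Rightarrow> real \<Rightarrow> 5 \<Rightarrow> real^5" where
  "onb \<alpha> \<beta> \<gamma> i = axis i (1 / sqrt (if i = 1 then \<alpha> else if i = 2 \<or> i = 3 then \<beta> else \<gamma>))"

definition coframe :: "real \<Rightarrow> real \<Rightarrow> real \<Rightarrow> 5 \<Rightarrow> form1" where
  "coframe \<alpha> \<beta> \<gamma> i = (\<lambda>p x. gmet \<alpha> \<beta> \<gamma> (onb \<alpha> \<beta> \<gamma> i) x)"

text \<open>\<open>E\<^sub>i\<^sub>j\<close> on \<open>\<mm>\<close>, relative to the orthonormal basis \<open>onb \<alpha> \<beta> \<gamma>\<close>.\<close>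

definition Em :: "real \<Rightarrow> real \<Rightarrow> real \<Rightarrow> 5 \<Rightarrow> 5 \<Rightarrow> real^5 \<Rightarrow> real^5" where
  "Em \<alpha> \<beta> \<gamma> i j x = gmet \<alpha> \<beta> \<gamma> x (onb \<alpha> \<beta> \<gamma> i) *\<^sub>R onb \<alpha> \<beta> \<gamma> j
                  - gmet \<alpha> \<beta> \<gamma> x (onb \<alpha> \<beta> \<gamma> j) *\<^sub>R onb \<alpha> \<beta> \<gamma> i"


subsection \<open>Connections\<close>

text \<open>Here and below \<open>g\<close> is a \<open>G\<close>-invariant metric, given on \<open>\<mm>\<close>.\<close>

type_synonym metric5 = "real^5 \<Rightarrow> real^5 \<Rightarrow> real"
type_synonym conn = "vfield \<Rightarrow> vfield \<Rightarrow> vfield"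

definition ip :: "metric5 \<Rightarrow> vfield \<Rightarrow> vfield \<Rightarrow> sfield" where
  "ip g X Y = (\<lambda>p. g (X p) (Y p))"

definition connection :: "conn \<Rightarrow> bool" where
  "connection D \<longleftrightarrow>
     (\<forall>X Y. vector_field X \<longrightarrow> vector_field Y \<longrightarrow> vector_field (D X Y)) \<and>
     (\<forall>X X' Y. vector_field X \<longrightarrow> vector_field X' \<longrightarrow> vector_field Y \<longrightarrow>
        D (\<lambda>p. X p + X' p) Y = (\<lambda>p. D X Y p + D X' Y p)) \<and>
     (\<forall>X Y Y'. vector_field X \<longrightarrow> vector_field Y \<longrightarrow> vector_field Y' \<longrightarrow>
        D X (\<lambda>p. Y p + Y' p) = (\<lambda>p. D X Y p + D X Y' p)) \<and>
     (\<forall>f X Y. scalar_field f \<longrightarrow> vector_field X \<longrightarrow> vector_field Y \<longrightarrow>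
        D (\<lambda>p. f p *\<^sub>R X p) Y = (\<lambda>p. f p *\<^sub>R D X Y p)) \<and>
     (\<forall>f X Y. scalar_field f \<longrightarrow> vector_field X \<longrightarrow> vector_field Y \<longrightarrow>
        D X (\<lambda>p. f p *\<^sub>R Y p) = (\<lambda>p. along X f p *\<^sub>R Y p + f p *\<^sub>R D X Y p))"

definition metric_connection :: "metric5 \<Rightarrow> conn \<Rightarrow> bool" where
  "metric_connection g D \<longleftrightarrow> connection D \<and>
     (\<forall>X Y Z. vector_field X \<longrightarrow> vector_field Y \<longrightarrow> vector_field Z \<longrightarrow>
        along X (ip g Y Z) = (\<lambda>p. ip g (D X Y) Z p + ip g Y (D X Z) p))"

definition torsion :: "conn \<Rightarrow> vfield \<Rightarrow> vfield \<Rightarrow> vfield" where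
  "torsion D X Y = (\<lambda>p. D X Y p - D Y X p - lie_bracket X Y p)"

definition torsion3 :: "metric5 \<Rightarrow> conn \<Rightarrow> vfield \<Rightarrow> vfield \<Rightarrow> vfield \<Rightarrow> sfield" where
  "torsion3 g D X Y Z = ip g (torsion D X Y) Z"

definition skew_torsion :: "metric5 \<Rightarrow> conn \<Rightarrow> bool" where
  "skew_torsion g D \<longleftrightarrow> (\<forall>X Y Z. vector_field X \<longrightarrow> vector_field Y \<longrightarrow> vector_field Z \<longrightarrow>
     torsion3 g D Y X Z = (\<lambda>p. - torsion3 g D X Y Z p) \<and>
     torsion3 g D X Z Y = (\<lambda>p. - torsion3 g D X Y Z p))"

definition levi_civita :: "metric5 \<Rightarrow> conn \<Rightarrow> bool" where
  "levi_civita g D \<longleftrightarrow> metric_connection g D \<and>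
     (\<forall>X Y. vector_field X \<longrightarrow> vector_field Y \<longrightarrow> torsion D X Y = (\<lambda>p. 0))"

text \<open>Connections only matter on vector fields, so uniqueness is uniqueness there.\<close>

definition the_unique_connection :: "(conn \<Rightarrow> bool) \<Rightarrow> conn \<Rightarrow> bool" where
  "the_unique_connection P D \<longleftrightarrow> P D \<and>
     (\<forall>D'. P D' \<longrightarrow> (\<forall>X Y. vector_field X \<longrightarrow> vector_field Y \<longrightarrow> D' X Y = D X Y))"


subsection \<open>Almost contact metric structures\<close>

definition almost_contact_metric :: "metric5 \<Rightarrow> vfield \<Rightarrow> form1 \<Rightarrow> endo \<Rightarrow> bool" where
  "almost_contact_metric g \<xi> \<eta> \<phi> \<longleftrightarrow> vector_field \<xi> \<and> one_form \<eta> \<and> endo_field \<phi> \<and>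
     (\<forall>p x. \<eta> p x = g (\<xi> p) x) \<and>
     (\<forall>p x. \<phi> p (\<phi> p x) = - x + \<eta> p x *\<^sub>R \<xi> p) \<and>
     (\<forall>p x y. g (\<phi> p x) (\<phi> p y) = g x y - \<eta> p x * \<eta> p y)"

definition invariant_acm :: "metric5 \<Rightarrow> vfield \<Rightarrow> form1 \<Rightarrow> endo \<Rightarrow> bool" where
  "invariant_acm g \<xi> \<eta> \<phi> \<longleftrightarrow> almost_contact_metric g \<xi> \<eta> \<phi> \<and>
     left_invariant \<xi> \<and> left_invariant \<eta> \<and> left_invariant \<phi>"

definition fundamental_form :: "metric5 \<Rightarrow> endo \<Rightarrow> vfield \<Rightarrow> vfield \<Rightarrow> sfield" where
  "fundamental_form g \<phi> X Y = ip g X (act \<phi> Y)"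

definition nijenhuis :: "vfield \<Rightarrow> form1 \<Rightarrow> endo \<Rightarrow> vfield \<Rightarrow> vfield \<Rightarrow> vfield" where
  "nijenhuis \<xi> \<eta> \<phi> X Y = (\<lambda>p.
      lie_bracket (act \<phi> X) (act \<phi> Y) p
      - act \<phi> (lie_bracket X (act \<phi> Y)) p
      - act \<phi> (lie_bracket (act \<phi> X) Y) p
      + act \<phi> (act \<phi> (lie_bracket X Y)) p
      + ext_deriv1 \<eta> X Y p *\<^sub>R \<xi> p)"

definition normal_acm :: "vfield \<Rightarrow> form1 \<Rightarrow> endo \<Rightarrow> bool" where
  "normal_acm \<xi> \<eta> \<phi> \<longleftrightarrow>
     (\<forall>X Y. vector_field X \<longrightarrow> vector_field Y \<longrightarrow> nijenhuis \<xi> \<eta> \<phi> X Y = (\<lambda>p. 0))"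

definition closed_fundamental_form :: "metric5 \<Rightarrow> endo \<Rightarrow> bool" where
  "closed_fundamental_form g \<phi> \<longleftrightarrow>
     (\<forall>X Y Z. vector_field X \<longrightarrow> vector_field Y \<longrightarrow> vector_field Z \<longrightarrow>
        ext_deriv2 (fundamental_form g \<phi>) X Y Z = (\<lambda>p. 0))"

definition sasakian :: "metric5 \<Rightarrow> vfield \<Rightarrow> form1 \<Rightarrow> endo \<Rightarrow> bool" where
  "sasakian g \<xi> \<eta> \<phi> \<longleftrightarrow> almost_contact_metric g \<xi> \<eta> \<phi> \<and> normal_acm \<xi> \<eta> \<phi> \<and>
     (\<forall>X Y. vector_field X \<longrightarrow> vector_field Y \<longrightarrow>
        (\<lambda>p. 2 * fundamental_form g \<phi> X Y p) = ext_deriv1 \<eta> X Y)"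

text \<open>The structure is given by the tensors \<open>\<xi>\<close>, \<open>\<eta>\<close>, \<open>\<phi>\<close>; it is preserved iff these are parallel.\<close>

definition characteristic_connection_acm :: "metric5 \<Rightarrow> vfield \<Rightarrow> form1 \<Rightarrow> endo \<Rightarrow> conn \<Rightarrow> bool" where
  "characteristic_connection_acm g \<xi> \<eta> \<phi> D \<longleftrightarrow> metric_connection g D \<and> skew_torsion g D \<and>
     (\<forall>X. vector_field X \<longrightarrow> D X \<xi> = (\<lambda>p. 0)) \<and>
     (\<forall>X Y. vector_field X \<longrightarrow> vector_field Y \<longrightarrow> along X (ev1 \<eta> Y) = ev1 \<eta> (D X Y)) \<and>
     (\<forall>X Y. vector_field X \<longrightarrow> vector_field Y \<longrightarrow> D X (act \<phi> Y) = act \<phi> (D X Y))"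


subsection \<open>The invariant \<open>SO(3)\<^sub>i\<^sub>r\<close> structure with adapted frame \<open>onb \<alpha> \<beta> \<gamma>\<close>\<close>

definition Upsilon_cubic :: "real \<Rightarrow> real \<Rightarrow> real \<Rightarrow> real^5 \<Rightarrow> real" where
  "Upsilon_cubic \<alpha> \<beta> \<gamma> v =
     (let x = (\<lambda>i. gmet \<alpha> \<beta> \<gamma> v (onb \<alpha> \<beta> \<gamma> i)) in
        x 1 ^ 3 + 3/2 * x 1 * ((x 2)\<^sup>2 + (x 3)\<^sup>2 - 2 * (x 4)\<^sup>2 - 2 * (x 5)\<^sup>2)
        + 3 * sqrt 3 / 2 * ((x 2)\<^sup>2 - (x 3)\<^sup>2) * x 5 - 3 * sqrt 3 * x 2 * x 3 * x 4)"

text \<open>The symmetric trilinear form with \<open>\<Upsilon>(v, v, v) = Upsilon_cubic v\<close>, by polarisation.\<close>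

definition Upsilon :: "real \<Rightarrow> real \<Rightarrow> real \<Rightarrow> vfield \<Rightarrow> vfield \<Rightarrow> vfield \<Rightarrow> sfield" where
  "Upsilon \<alpha> \<beta> \<gamma> X Y Z = (\<lambda>p. let c = Upsilon_cubic \<alpha> \<beta> \<gamma>; x = X p; y = Y p; z = Z p in
     (c (x + y + z) - c (x + y) - c (x + z) - c (y + z) + c x + c y + c z) / 6)"

definition cov_deriv3 :: "conn \<Rightarrow> (vfield \<Rightarrow> vfield \<Rightarrow> vfield \<Rightarrow> sfield) \<Rightarrow> vfield \<Rightarrow>
    vfield \<Rightarrow> vfield \<Rightarrow> vfield \<Rightarrow> sfield" where
  "cov_deriv3 D T V X Y Z = (\<lambda>p.
     along V (T X Y Z) p - T (D V X) Y Z p - T X (D V Y) Z p - T X Y (D V Z) p)"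

definition nearly_integrable_SO3ir :: "real \<Rightarrow> real \<Rightarrow> real \<Rightarrow> bool" where
  "nearly_integrable_SO3ir \<alpha> \<beta> \<gamma> \<longleftrightarrow> (\<exists>D. levi_civita (gmet \<alpha> \<beta> \<gamma>) D \<and>
     (\<forall>v. vector_field v \<longrightarrow> cov_deriv3 D (Upsilon \<alpha> \<beta> \<gamma>) v v v v = (\<lambda>p. 0)))"

definition so3ir :: "real \<Rightarrow> real \<Rightarrow> real \<Rightarrow> (real^5 \<Rightarrow> real^5) set" where
  "so3ir \<alpha> \<beta> \<gamma> = (let E = Em \<alpha> \<beta> \<gamma>;
       X1 = (\<lambda>x. sqrt 3 *\<^sub>R E 1 3 x + E 4 2 x + E 5 3 x);
       X2 = (\<lambda>x. sqrt 3 *\<^sub>R E 2 1 x + E 3 4 x + E 5 2 x);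
       X3 = (\<lambda>x. E 2 3 x + 2 *\<^sub>R E 4 5 x)
     in {\<lambda>x. a *\<^sub>R X1 x + b *\<^sub>R X2 x + c *\<^sub>R X3 x | a b c. True})"

text \<open>\<open>D\<close> preserves the \<open>SO(3)\<^sub>i\<^sub>r\<close> structure iff its connection form in adapted frames takes values
  in the Lie algebra of \<open>SO(3)\<^sub>i\<^sub>r\<close>.  There need not be a global adapted frame on \<open>G/H\<close>, but there is
  one on \<open>G\<close>, namely the constant sections \<open>onb \<alpha> \<beta> \<gamma>\<close> of the pull-back \<open>G \<times> \<mm>\<close> of \<open>T(G/H)\<close>.  In this
  frame the pulled-back connection is the derivative plus the connection form \<open>A\<close>.  In the vertical
  direction \<open>h0\<close> the connection form is \<open>d\<lambda>(h0) = E\<^sub>2\<^sub>3 + 2 E\<^sub>4\<^sub>5\<close> for every \<open>D\<close>, which lies in the Lie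
  algebra; so only horizontal directions give a condition.\<close>

definition preserves_SO3ir :: "real \<Rightarrow> real \<Rightarrow> real \<Rightarrow> conn \<Rightarrow> bool" where
  "preserves_SO3ir \<alpha> \<beta> \<gamma> D \<longleftrightarrow> (\<forall>X p. vector_field X \<longrightarrow>
     (\<exists>A \<in> so3ir \<alpha> \<beta> \<gamma>. \<forall>Y. vector_field Y \<longrightarrow> D X Y p = along X Y p + A (Y p)))"

definition characteristic_connection_SO3ir :: "real \<Rightarrow> real \<Rightarrow> real \<Rightarrow> conn \<Rightarrow> bool" where
  "characteristic_connection_SO3ir \<alpha> \<beta> \<gamma> D \<longleftrightarrow>
     metric_connection (gmet \<alpha> \<beta> \<gamma>) D \<and> preserves_SO3ir \<alpha> \<beta> \<gamma> D \<and> skew_torsion (gmet \<alpha> \<beta> \<gamma>) D"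


subsection \<open>The two structures\<close>

definition xi0 :: "real \<Rightarrow> real \<Rightarrow> real \<Rightarrow> vfield" where
  "xi0 \<alpha> \<beta> \<gamma> = (\<lambda>p. onb \<alpha> \<beta> \<gamma> 1)"

definition eta0 :: "real \<Rightarrow> real \<Rightarrow> real \<Rightarrow> form1" where
  "eta0 \<alpha> \<beta> \<gamma> = coframe \<alpha> \<beta> \<gamma> 1"

definition phi_plus :: "real \<Rightarrow> real \<Rightarrow> real \<Rightarrow> endo" where
  "phi_plus \<alpha> \<beta> \<gamma> = (\<lambda>p x. - Em \<alpha> \<beta> \<gamma> 2 3 x + Em \<alpha> \<beta> \<gamma> 4 5 x)"

definition phi_minus :: "real \<Rightarrow> real \<Rightarrow> real \<Rightarrow> endo" where
  "phi_minus \<alpha> \<beta> \<gamma> = (\<lambda>p x. - Em \<alpha> \<beta> \<gamma> 2 3 x - Em \<alpha> \<beta> \<gamma> 4 5 x)"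

end

theory Submission
  imports Defs
begin

text \<open>
  In terms of the constant frame of the pull-back of \<open>T(G/H)\<close> to \<open>G\<close>, the bracket of two vector fields is
  \<open>[X, Y] = X(Y) - Y(X) + [X, Y]\<^sub>\<mm>\<close>, where \<open>X(Y)\<close> is the componentwise derivative.  In every
  tensorial expression with constant coefficients the derivatives cancel, so that all conditions become algebraic
  identities on \<open>\<mm>\<close>.  The characteristic connection is \<open>D\<^sub>X Y = X(Y) + \<Lambda>(X) Y\<close>, where only
  \<open>\<Lambda>(e\<^sub>1)\<close>, a combination \<open>k E\<^sub>2\<^sub>3 + l E\<^sub>4\<^sub>5\<close> up to scale, is nonzero.  The metric is nearly integrable iff \<open>l = 2 k\<close>,
  i.e. iff \<open>\<Lambda>(e\<^sub>1)\<close> is a multiple of the element \<open>X\<^sub>3 = E\<^sub>2\<^sub>3 + 2 E\<^sub>4\<^sub>5\<close> of the Lie algebra of \<open>SO(3)\<^sub>i\<^sub>r\<close>.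
  Uniqueness rests on the fact that two metric connections with skew torsion differ by a 3-form.
\<close>

subsection \<open>Smooth functions on normed spaces\<close>

text \<open>Among the constant vectors only the multiples of e_1 descend to vector fields on
  \<open>G/H\<close>, so identities cannot be tested directly on frame fields; moreover directional
  derivatives and brackets are definite descriptions. Three constructions bridge this gap: curves in
  the group with any prescribed horizontal velocity, enough \<open>H\<close>-invariant functions to
  distinguish all horizontal directions, and equivariant fields with any prescribed value at a
  point. The constants \<open>k\<close> and \<open>l\<close> are forced: the torsion component with
  value in e_1 comes from the bracket alone, and skewness makes the components with e_1 as an
  argument agree with it. The Levi-Civita connection form agrees with Lambda on the diagonal, which
  is why near integrability sees only \<open>k\<close> and \<open>l\<close>.\<close>

abbreviation cinf :: "('a::real_normed_vector \<Rightarrow> 'b::real_normed_vector) \<Rightarrow> bool" where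
  "cinf F \<equiv> \<forall>n. cdiff n F"

lemma frechet_derivative_eq: "(F has_derivative F') (at x) \<Longrightarrow> frechet_derivative F (at x) = F'"
  using frechet_derivative_at by metis

text \<open>The product rule in \<open>cdiff_bounded_bilinear\<close> leaves one factor
  undifferentiated, so the order of that factor has to be lowered.\<close>

lemma cdiff_Suc_D: "cdiff (Suc n) F \<Longrightarrow> cdiff n F"
proof (induction n arbitrary: F)
  case 0
  then show ?case
    by (simp add: continuous_at_imp_continuous_on differentiable_imp_continuous_within)
next
  case (Suc n)
  then show ?case by (metis cdiff.simps(2))
qed

lemma cdiff_const: "cdiff n (\<lambda>x. c)"
  by (induction n arbitrary: c) simp_all

lemma cdiff_bounded_linear_comp:
  assumes L: "bounded_linear L" and F: "cdiff n F"
  shows "cdiff n (\<lambda>x. L (F x))"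
  using F
proof (induction n arbitrary: F)
  case 0
  then show ?case using L by (simp add: bounded_linear.continuous_on)
next
  case (Suc n)
  have d: "((\<lambda>x. L (F x)) has_derivative (\<lambda>v. L (frechet_derivative F (at x) v))) (at x)" for x
    using Suc.prems by (intro bounded_linear.has_derivative[OF L]) (simp add: frechet_derivative_works)
  show ?case
    using Suc d by (auto simp: frechet_derivative_eq[OF d] differentiable_def)
qed

lemma cdiff_add:
  assumes "cdiff n F" "cdiff n G"
  shows "cdiff n (\<lambda>x. F x + G x)"
  using assms
proof (induction n arbitrary: F G)
  case 0
  then show ?case by (simp add: continuous_on_add)
next
  case (Suc n)
  have d: "((\<lambda>x. F x + G x) has_derivative
      (\<lambda>v. frechet_derivative F (at x) v + frechet_derivative G (at x) v)) (at x)" for x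
    using Suc.prems by (intro has_derivative_add) (simp_all add: frechet_derivative_works)
  show ?case
    using Suc d by (auto simp: frechet_derivative_eq[OF d] differentiable_def)
qed

lemma cdiff_sum:
  assumes "\<And>i. i \<in> I \<Longrightarrow> cdiff n (F i)"
  shows "cdiff n (\<lambda>x. \<Sum>i\<in>I. F i x)"
  using assms
  by (induction I rule: infinite_finite_induct) (auto intro: cdiff_const cdiff_add)

lemma cdiff_bounded_bilinear:
  assumes B: "bounded_bilinear B" and "cdiff n F" "cdiff n G"
  shows "cdiff n (\<lambda>x. B (F x) (G x))"
  using assms(2-)
proof (induction n arbitrary: F G)
  case 0
  then show ?case using bounded_bilinear.continuous_on[OF B] by simp
next
  case (Suc n)
  have d: "((\<lambda>x. B (F x) (G x)) has_derivative
      (\<lambda>v. B (F x) (frechet_derivative G (at x) v) + B (frechet_derivative F (at x) v) (G x))) (at x)" for x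
    using Suc.prems by (intro bounded_bilinear.FDERIV[OF B]) (simp_all add: frechet_derivative_works)
  have "cdiff n F" "cdiff n G"
    using Suc.prems cdiff_Suc_D by blast+
  then show ?case
    using Suc d by (auto simp: frechet_derivative_eq[OF d] differentiable_def intro!: cdiff_add)
qed

lemma cdiff_bounded_linear: "bounded_linear L \<Longrightarrow> cdiff n L"
proof (induction n)
  case 0
  then show ?case by (simp add: linear_continuous_on)
next
  case (Suc n)
  have "(L has_derivative L) (at x)" for x
    using Suc.prems by (rule bounded_linear_imp_has_derivative)
  then show ?case
    by (auto simp: frechet_derivative_eq[OF \<open>\<And>x. (L has_derivative L) (at x)\<close>] differentiable_def
        intro: cdiff_const)
qed

lemma cinf_differentiable: "cinf F \<Longrightarrow> F differentiable (at x)"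
  by (metis cdiff.simps(2))

lemma cinf_has_derivative: "cinf F \<Longrightarrow> (F has_derivative frechet_derivative F (at x)) (at x)"
  using cinf_differentiable frechet_derivative_works by blast

lemma cinf_frechet: "cinf F \<Longrightarrow> cinf (\<lambda>x. frechet_derivative F (at x) v)"
  by (metis cdiff.simps(2))

text \<open>\<open>cdiff\<close> differentiates in fixed directions only. Expanding in
  \<open>Basis\<close> turns a derivative in a direction that varies with the point into a finite
  sum of products of smooth functions.\<close>

lemma frechet_Basis_sum:
  fixes F :: "'a::euclidean_space \<Rightarrow> 'b::real_normed_vector"
  assumes "F differentiable (at x)"
  shows "frechet_derivative F (at x) h = (\<Sum>b\<in>Basis. (h \<bullet> b) *\<^sub>R frechet_derivative F (at x) b)"
proof -
  have l: "linear (frechet_derivative F (at x))"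
    using assms by (rule linear_frechet_derivative)
  have "frechet_derivative F (at x) h = frechet_derivative F (at x) (\<Sum>b\<in>Basis. (h \<bullet> b) *\<^sub>R b)"
    by (simp add: euclidean_representation)
  also have "\<dots> = (\<Sum>b\<in>Basis. (h \<bullet> b) *\<^sub>R frechet_derivative F (at x) b)"
    by (simp add: linear_sum[OF l] linear_scale[OF l])
  finally show ?thesis .
qed

lemma cinf_frechet_field:
  fixes F :: "'a::euclidean_space \<Rightarrow> 'b::real_normed_vector"
  assumes F: "cinf F" and h: "cinf h"
  shows "cinf (\<lambda>x. frechet_derivative F (at x) (h x))"
proof -
  have "(\<lambda>x. frechet_derivative F (at x) (h x))
      = (\<lambda>x. \<Sum>b\<in>Basis. (h x \<bullet> b) *\<^sub>R frechet_derivative F (at x) b)"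
    using frechet_Basis_sum[OF cinf_differentiable[OF F]] by blast
  moreover have "cdiff n (\<lambda>x. \<Sum>b\<in>Basis. (h x \<bullet> b) *\<^sub>R frechet_derivative F (at x) b)" for n
    using h cinf_frechet[OF F]
    by (intro cdiff_sum cdiff_bounded_bilinear[OF bounded_bilinear_scaleR]
        cdiff_bounded_linear_comp[OF bounded_linear_inner_left]) auto
  ultimately show ?thesis by simp
qed

text \<open>The mean value theorem is applied twice: to the difference of F along two parallel
  segments in direction u, then in direction v to the derivative of F along u.\<close>

lemma second_difference_mvt:
  fixes F :: "'a::real_normed_vector \<Rightarrow> real"
  assumes F: "cinf F" and s: "0 < s"
  obtains a b where "0 < a" "a < s" "0 < b" "b < s"
    "F (P + s *\<^sub>R u + s *\<^sub>R v) - F (P + s *\<^sub>R u) - F (P + s *\<^sub>R v) + F P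
     = s * (s * frechet_derivative (\<lambda>Q. frechet_derivative F (at Q) u) (at (P + a *\<^sub>R u + b *\<^sub>R v)) v)"
proof -
  have line: "((\<lambda>x. G (Q + x *\<^sub>R w)) has_real_derivative frechet_derivative G (at (Q + x *\<^sub>R w)) w) (at x)"
    if G: "cinf G" for G :: "'a \<Rightarrow> real" and Q w x
  proof -
    have "((\<lambda>x. G (Q + x *\<^sub>R w)) has_derivative (\<lambda>h. frechet_derivative G (at (Q + x *\<^sub>R w)) (h *\<^sub>R w))) (at x)"
      by (rule has_derivative_compose[OF _ cinf_has_derivative[OF G]]) (auto intro!: derivative_eq_intros)
    then show ?thesis
      using linear_scale[OF linear_frechet_derivative[OF cinf_differentiable[OF G]]]
      by (simp add: has_field_derivative_def mult_commute_abs)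
  qed
  define g where "g x = F ((P + s *\<^sub>R v) + x *\<^sub>R u) - F (P + x *\<^sub>R u)" for x
  define g' where "g' x = frechet_derivative F (at ((P + s *\<^sub>R v) + x *\<^sub>R u)) u
      - frechet_derivative F (at (P + x *\<^sub>R u)) u" for x
  have "\<And>x. (g has_real_derivative g' x) (at x)"
    unfolding g_def g'_def by (intro derivative_intros line F)
  then obtain a where a: "0 < a" "a < s" "g s - g 0 = (s - 0) * g' a"
    using MVT2[OF s, of g g'] by blast
  let ?G = "\<lambda>Q. frechet_derivative F (at Q) u"
  obtain b where b: "0 < b" "b < s"
    "?G ((P + a *\<^sub>R u) + s *\<^sub>R v) - ?G ((P + a *\<^sub>R u) + 0 *\<^sub>R v)
      = (s - 0) * frechet_derivative ?G (at ((P + a *\<^sub>R u) + b *\<^sub>R v)) v"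
    using MVT2[OF s line[OF cinf_frechet[OF F]], of "P + a *\<^sub>R u" v] by blast
  show thesis
    using that[OF a(1,2) b(1,2)] a(3) b(3) by (simp add: g_def g'_def algebra_simps)
qed

text \<open>Schwarz's theorem. The second difference over a shrinking parallelogram is symmetric in
  u and v and equals a multiple of either mixed derivative at nearby points; continuity gives the
  limit.\<close>

lemma frechet_derivative_symmetric:
  fixes F :: "'a::real_normed_vector \<Rightarrow> real"
  assumes F: "cinf F"
  shows "frechet_derivative (\<lambda>Q. frechet_derivative F (at Q) u) (at P) v
       = frechet_derivative (\<lambda>Q. frechet_derivative F (at Q) v) (at P) u"
proof -
  define s where "s n = 1 / real (Suc n)" for n
  have s0: "0 < s n" for n by (simp add: s_def)
  have slim: "s \<longlonglongrightarrow> 0"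
    unfolding s_def using LIMSEQ_inverse_real_of_nat by (simp add: inverse_eq_divide)
  let ?A = "\<lambda>u v Q. frechet_derivative (\<lambda>Q. frechet_derivative F (at Q) u) (at Q) v"
  have ex: "\<exists>Qs. Qs \<longlonglongrightarrow> P \<and> (\<forall>n. F (P + s n *\<^sub>R u + s n *\<^sub>R v) - F (P + s n *\<^sub>R u) - F (P + s n *\<^sub>R v) + F P
     = s n * (s n * ?A u v (Qs n)))" for u v
  proof -
    have "\<exists>a b. 0 < a \<and> a < s n \<and> 0 < b \<and> b < s n \<and>
      F (P + s n *\<^sub>R u + s n *\<^sub>R v) - F (P + s n *\<^sub>R u) - F (P + s n *\<^sub>R v) + F P
        = s n * (s n * ?A u v (P + a *\<^sub>R u + b *\<^sub>R v))" for n
      using second_difference_mvt[OF F s0, of n P u v] by metis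
    then obtain a b where ab: "\<And>n. 0 < a n" "\<And>n. a n < s n" "\<And>n. 0 < b n" "\<And>n. b n < s n"
      "\<And>n. F (P + s n *\<^sub>R u + s n *\<^sub>R v) - F (P + s n *\<^sub>R u) - F (P + s n *\<^sub>R v) + F P
        = s n * (s n * ?A u v (P + a n *\<^sub>R u + b n *\<^sub>R v))"
      by metis
    have "a \<longlonglongrightarrow> 0" "b \<longlonglongrightarrow> 0"
      using ab by (auto intro!: tendsto_sandwich[OF _ _ tendsto_const slim] always_eventually less_imp_le)
    then have "(\<lambda>n. P + a n *\<^sub>R u + b n *\<^sub>R v) \<longlonglongrightarrow> P + 0 *\<^sub>R u + 0 *\<^sub>R v"
      by (intro tendsto_intros)
    then show ?thesis using ab(5) by (intro exI[of _ "\<lambda>n. P + a n *\<^sub>R u + b n *\<^sub>R v"]) simp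
  qed
  obtain Q1 where Q1: "Q1 \<longlonglongrightarrow> P" "\<And>n. F (P + s n *\<^sub>R u + s n *\<^sub>R v) - F (P + s n *\<^sub>R u) - F (P + s n *\<^sub>R v) + F P
     = s n * (s n * ?A u v (Q1 n))"
    using ex by blast
  obtain Q2 where Q2: "Q2 \<longlonglongrightarrow> P" "\<And>n. F (P + s n *\<^sub>R v + s n *\<^sub>R u) - F (P + s n *\<^sub>R v) - F (P + s n *\<^sub>R u) + F P
     = s n * (s n * ?A v u (Q2 n))"
    using ex by blast
  have "s n * (s n * ?A u v (Q1 n)) = s n * (s n * ?A v u (Q2 n))" for n
    using Q1(2)[of n] Q2(2)[of n] by (simp add: algebra_simps)
  then have eq: "?A u v (Q1 n) = ?A v u (Q2 n)" for n
    using s0[of n] by (metis less_irrefl mult_left_cancel)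
  have cont: "isCont (?A u v) P" for u v
    using cinf_frechet[OF cinf_frechet[OF F]] by (meson cinf_differentiable differentiable_imp_continuous_within)
  have "(\<lambda>n. ?A u v (Q1 n)) \<longlonglongrightarrow> ?A u v P" "(\<lambda>n. ?A v u (Q2 n)) \<longlonglongrightarrow> ?A v u P"
    using isCont_tendsto_compose[OF cont Q1(1)] isCont_tendsto_compose[OF cont Q2(1)] by blast+
  then show ?thesis
    using eq LIMSEQ_unique by simp
qed

subsection \<open>Curves in the group and directional derivatives\<close>

lemma bounded_bilinear_mat2_mult: "bounded_bilinear mat2_mult"
proof -
  have "bilinear mat2_mult"
    unfolding bilinear_def mat2_mult_def
    by (auto intro!: linearI simp: prod_eq_iff vec_eq_iff matrix_matrix_mult_def
        sum.distrib algebra_simps sum_distrib_left)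
  then show ?thesis
    using bilinear_conv_bounded_bilinear by blast
qed

lemmas mat2_bil = bounded_bilinear.add_left[OF bounded_bilinear_mat2_mult]
  bounded_bilinear.add_right[OF bounded_bilinear_mat2_mult]
  bounded_bilinear.diff_left[OF bounded_bilinear_mat2_mult]
  bounded_bilinear.diff_right[OF bounded_bilinear_mat2_mult]
  bounded_bilinear.scaleR_left[OF bounded_bilinear_mat2_mult]
  bounded_bilinear.scaleR_right[OF bounded_bilinear_mat2_mult]

lemma mat2_mult_assoc: "mat2_mult (mat2_mult P Q) R = mat2_mult P (mat2_mult Q R)"
  by (simp add: mat2_mult_def matrix_mul_assoc)

definition mat2_one :: mat2 where "mat2_one = (mat 1, mat 1)"

lemma mat2_mult_one [simp]: "mat2_mult P mat2_one = P" "mat2_mult mat2_one P = P"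
  by (simp_all add: mat2_mult_def mat2_one_def)

lemma mat_of_rot: "rotation_matrix (fst (mat_of p))" "rotation_matrix (snd (mat_of p))"
  using mat_of[of p] by auto

lemma mat_of_transpose_mult [simp]:
  "mat2_mult (mat2_transpose (mat_of p)) (mat_of p) = mat2_one"
  "mat2_mult (mat_of p) (mat2_transpose (mat_of p)) = mat2_one"
  using mat_of_rot[of p]
  by (simp_all add: mat2_mult_def mat2_transpose_def mat2_one_def rotation_matrix_def orthogonal_matrix_def)

lemma mat_of_transpose_cancel [simp]:
  "mat2_mult (mat2_transpose (mat_of p)) (mat2_mult (mat_of p) Q) = Q"
  "mat2_mult (mat_of p) (mat2_mult (mat2_transpose (mat_of p)) Q) = Q"
  by (simp_all add: mat2_mult_assoc[symmetric])

lift_definition gunit :: SO3xSO3 is mat2_one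
  by (simp add: rotation_matrix_def orthogonal_matrix_id mat2_one_def)

lemma gmult_gunit [simp]: "p \<odot> gunit = p" "gunit \<odot> p = p"
  by (transfer; simp)+

lemma mat_of_gmult: "mat_of (p \<odot> q) = mat2_mult (mat_of p) (mat_of q)"
  by (rule gmult.rep_eq)

text \<open>This is exp(t \<open>s1\<close>); \<open>rot2 t\<close> is likewise exp(t
  \<open>s2\<close>).\<close>

definition rot1 :: "real \<Rightarrow> real^3^3" where
  "rot1 t = vector [vector [1, 0, 0], vector [0, cos t, - sin t], vector [0, sin t, cos t]]"

definition rot2 :: "real \<Rightarrow> real^3^3" where
  "rot2 t = vector [vector [cos t, 0, sin t], vector [0, 1, 0], vector [- sin t, 0, cos t]]"

lemma sin_cos_mult_self: "sin t * sin t + cos t * cos t = (1::real)" "cos t * cos t + sin t * sin t = (1::real)"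
  using sin_squared_eq[of t] by (simp_all add: power2_eq_square)

lemma rotation_matrix_rot1: "rotation_matrix (rot1 t)"
  unfolding rotation_matrix_def orthogonal_matrix rot1_def
  by (simp add: vec_eq_iff forall_3 matrix_matrix_mult_def transpose_def mat_def sum_3 det_3 sin_cos_mult_self)

lemma rotation_matrix_rot2: "rotation_matrix (rot2 t)"
  unfolding rotation_matrix_def orthogonal_matrix rot2_def
  by (simp add: vec_eq_iff forall_3 matrix_matrix_mult_def transpose_def mat_def sum_3 det_3 sin_cos_mult_self)

lemmas s_defs = s1_def s2_def s3_def Eso_def

lemma rot_at_0 [simp]: "rot1 0 = mat 1" "rot2 0 = mat 1" "rot3 0 = mat 1"
  by (simp_all add: rot1_def rot2_def rot3_def vec_eq_iff forall_3 mat_def)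

lemma has_vector_derivative_trig:
  fixes A B C :: "'a::real_normed_vector"
  shows "((\<lambda>t. cos (a * t) *\<^sub>R A + sin (a * t) *\<^sub>R B + C) has_vector_derivative a *\<^sub>R B) (at 0)"
  by (auto intro!: derivative_eq_intros simp: has_vector_derivative_def)

lemma has_vector_derivative_rot:
  "((\<lambda>t. rot1 (a * t)) has_vector_derivative a *\<^sub>R s1) (at 0)"
  "((\<lambda>t. rot2 (a * t)) has_vector_derivative a *\<^sub>R s2) (at 0)"
  "((\<lambda>t. rot3 (a * t)) has_vector_derivative a *\<^sub>R s3) (at 0)"
proof -
  \<comment> \<open>Rodrigues' formula; \<open>axis i (axis i 1)\<close> is the projection to the
    rotation axis.\<close>
  have 1: "rot1 t = cos t *\<^sub>R (mat 1 - axis 1 (axis 1 1)) + sin t *\<^sub>R s1 + axis 1 (axis 1 1)"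
    and 2: "rot2 t = cos t *\<^sub>R (mat 1 - axis 2 (axis 2 1)) + sin t *\<^sub>R s2 + axis 2 (axis 2 1)"
    and 3: "rot3 t = cos t *\<^sub>R (mat 1 - axis 3 (axis 3 1)) + sin t *\<^sub>R s3 + axis 3 (axis 3 1)" for t
    by (simp_all add: rot1_def rot2_def rot3_def s_defs vec_eq_iff forall_3 mat_def axis_def)
  show "((\<lambda>t. rot1 (a * t)) has_vector_derivative a *\<^sub>R s1) (at 0)"
    "((\<lambda>t. rot2 (a * t)) has_vector_derivative a *\<^sub>R s2) (at 0)"
    "((\<lambda>t. rot3 (a * t)) has_vector_derivative a *\<^sub>R s3) (at 0)"
    unfolding 1 2 3 by (rule has_vector_derivative_trig)+
qed

lemma bounded_bilinear_matrix_mult: "bounded_bilinear ((**) :: real^3^3 \<Rightarrow> real^3^3 \<Rightarrow> real^3^3)"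
proof -
  have "bilinear ((**) :: real^3^3 \<Rightarrow> real^3^3 \<Rightarrow> real^3^3)"
    unfolding bilinear_def
    by (auto intro!: linearI simp: vec_eq_iff matrix_matrix_mult_def sum.distrib algebra_simps sum_distrib_left)
  then show ?thesis
    using bilinear_conv_bounded_bilinear by blast
qed

text \<open>Only the velocity at 0 matters, so a product of three one-parameter subgroups replaces
  the exponential of a sum.\<close>

definition rot_curve :: "real \<Rightarrow> real \<Rightarrow> real \<Rightarrow> real \<Rightarrow> real^3^3" where
  "rot_curve a b c t = rot1 (a * t) ** (rot2 (b * t) ** rot3 (c * t))"

lemma rotation_matrix_mult: "rotation_matrix (A :: real^3^3) \<Longrightarrow> rotation_matrix B \<Longrightarrow> rotation_matrix (A ** B)"
  by (auto simp: rotation_matrix_def orthogonal_matrix_mul det_mul)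

lemma rotation_matrix_rot_curve: "rotation_matrix (rot_curve a b c t)"
  unfolding rot_curve_def
  by (intro rotation_matrix_mult rotation_matrix_rot1 rotation_matrix_rot2 rotation_matrix_rot3)

lemma has_vector_derivative_rot_curve:
  "(rot_curve a b c has_vector_derivative a *\<^sub>R s1 + b *\<^sub>R s2 + c *\<^sub>R s3) (at 0)"
  unfolding rot_curve_def
  by (rule has_vector_derivative_eq_rhs,
      rule bounded_bilinear.has_vector_derivative[OF bounded_bilinear_matrix_mult has_vector_derivative_rot(1)
        bounded_bilinear.has_vector_derivative[OF bounded_bilinear_matrix_mult has_vector_derivative_rot(2,3)]])
    simp

text \<open>The coefficients of \<open>s3\<close> come from the basis vector b_3 - 2 a_3. Each
  horizontal direction thus occurs as the velocity of a curve, so that the description in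
  \<open>dir_deriv\<close> has at most one solution.\<close>

lift_definition gcurve :: "real^5 \<Rightarrow> real \<Rightarrow> SO3xSO3" is
  "\<lambda>x t. (rot_curve (x$2) (x$3) (- 2 * x$1) t, rot_curve (x$4) (x$5) (x$1) t)"
  by (simp add: rotation_matrix_rot_curve)

lemma gcurve_0 [simp]: "gcurve x 0 = gunit"
  by transfer (simp add: rot_curve_def mat2_one_def)

lemma has_vector_derivative_gcurve: "((\<lambda>t. mat_of (gcurve x t)) has_vector_derivative emb x) (at 0)"
  unfolding gcurve.rep_eq
  by (rule has_vector_derivative_eq_rhs,
      rule has_vector_derivative_Pair[OF has_vector_derivative_rot_curve has_vector_derivative_rot_curve])
    (simp add: emb_def)

lemma has_vector_derivative_gmult:
  assumes "((\<lambda>t. mat_of (c t)) has_vector_derivative v) (at 0)"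
  shows "((\<lambda>t. mat_of (p \<odot> c t)) has_vector_derivative mat2_mult (mat_of p) v) (at 0)"
    "((\<lambda>t. mat_of (c t \<odot> p)) has_vector_derivative mat2_mult v (mat_of p)) (at 0)"
  unfolding mat_of_gmult
  using bounded_linear.has_vector_derivative[OF bounded_bilinear.bounded_linear_right[OF bounded_bilinear_mat2_mult] assms]
    bounded_linear.has_vector_derivative[OF bounded_bilinear.bounded_linear_left[OF bounded_bilinear_mat2_mult] assms]
  by blast+

lemma has_vector_derivative_Hel: "((\<lambda>t. mat_of (Hel t)) has_vector_derivative h0) (at 0)"
proof -
  have r: "(rot3 has_vector_derivative s3) (at 0)"
    using has_vector_derivative_rot(3)[of 1] by simp
  show ?thesis
    unfolding Hel.rep_eq
    by (rule has_vector_derivative_eq_rhs,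
      rule has_vector_derivative_Pair[OF r bounded_bilinear.has_vector_derivative[OF bounded_bilinear_matrix_mult r r]])
    (simp add: h0_def scaleR_2)
qed

lemma Hel_0 [simp]: "Hel 0 = gunit"
  by transfer (simp add: mat2_one_def)

lemma along_curve:
  assumes F: "(F has_derivative F') (at (mat_of (c 0)))" and f: "\<And>p. f p = F (mat_of p)"
    and c: "((\<lambda>t. mat_of (c t)) has_vector_derivative w) (at 0)"
  shows "((\<lambda>t. f (c t)) has_vector_derivative F' w) (at 0)"
proof -
  have "((F \<circ> (\<lambda>t. mat_of (c t))) has_derivative F' \<circ> (\<lambda>h. h *\<^sub>R w)) (at 0)"
    using c F unfolding has_vector_derivative_def by (intro diff_chain_at)
  moreover have "F' (h *\<^sub>R w) = h *\<^sub>R F' w" for h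
    using linear_scale[OF has_derivative_linear[OF F]] .
  ultimately show ?thesis
    by (simp add: has_vector_derivative_def o_def f)
qed

text \<open>The chain rule gives this value along every admissible curve, and a translate of
  \<open>gcurve\<close> is such a curve, so the value is unique. In particular it does not depend on
  the extension F.\<close>

lemma dir_deriv_eq:
  assumes F: "(F has_derivative F') (at (mat_of p))" and f: "\<And>p. f p = F (mat_of p)"
  shows "dir_deriv f p (emb x) = F' (mat2_mult (mat_of p) (emb x))"
  unfolding dir_deriv_def
proof (rule the_equality)
  show "\<forall>c. c 0 = p \<and> ((\<lambda>t. mat_of (c t)) has_vector_derivative mat2_mult (mat_of p) (emb x)) (at 0) \<longrightarrow>
    ((\<lambda>t. f (c t)) has_vector_derivative F' (mat2_mult (mat_of p) (emb x))) (at 0)"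
    using along_curve[where f=f and F=F] F f by blast
next
  fix d
  let ?c = "\<lambda>t. p \<odot> gcurve x t"
  assume "\<forall>c. c 0 = p \<and> ((\<lambda>t. mat_of (c t)) has_vector_derivative mat2_mult (mat_of p) (emb x)) (at 0) \<longrightarrow>
    ((\<lambda>t. f (c t)) has_vector_derivative d) (at 0)"
  then have "((\<lambda>t. f (?c t)) has_vector_derivative d) (at 0)"
    using has_vector_derivative_gmult(1)[OF has_vector_derivative_gcurve] by simp
  moreover have "((\<lambda>t. f (?c t)) has_vector_derivative F' (mat2_mult (mat_of p) (emb x))) (at 0)"
    using F f by (intro along_curve[where f=f and F=F] has_vector_derivative_gmult(1)[OF has_vector_derivative_gcurve]) simp
  ultimately show "d = F' (mat2_mult (mat_of p) (emb x))"
    using vector_derivative_unique_at by blast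
qed

subsection \<open>Smooth functions on the group\<close>

lemma smoothE:
  assumes "smooth f"
  obtains F where "cinf F" "\<And>p. f p = F (mat_of p)"
  using assms unfolding smooth_def by blast

lemma smoothI: "cinf F \<Longrightarrow> (\<And>p. f p = F (mat_of p)) \<Longrightarrow> smooth f"
  unfolding smooth_def by blast

lemma smooth_const: "smooth (\<lambda>p. c)"
  by (rule smoothI[of "\<lambda>P. c"]) (simp_all add: cdiff_const)

lemma smooth_bounded_linear_comp: "bounded_linear L \<Longrightarrow> smooth f \<Longrightarrow> smooth (\<lambda>p. L (f p))"
  by (elim smoothE) (rule smoothI[of "\<lambda>P. L (_ P)"], auto intro: cdiff_bounded_linear_comp)

lemma smooth_add: "smooth f \<Longrightarrow> smooth g \<Longrightarrow> smooth (\<lambda>p. f p + g p)"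
  by (elim smoothE) (rule smoothI[of "\<lambda>P. _ P + _ P"], auto intro: cdiff_add)

lemma smooth_bounded_bilinear:
  "bounded_bilinear B \<Longrightarrow> smooth f \<Longrightarrow> smooth g \<Longrightarrow> smooth (\<lambda>p. B (f p) (g p))"
  by (elim smoothE) (rule smoothI[of "\<lambda>P. B (_ P) (_ P)"], auto intro: cdiff_bounded_bilinear)

lemma smooth_minus: "smooth f \<Longrightarrow> smooth (\<lambda>p. - f p)"
  by (rule smooth_bounded_linear_comp[OF bounded_linear_minus[OF bounded_linear_ident]])

lemma smooth_diff: "smooth f \<Longrightarrow> smooth g \<Longrightarrow> smooth (\<lambda>p. f p - g p)"
  using smooth_add[OF _ smooth_minus] by fastforce

lemmas smooth_scaleR = smooth_bounded_bilinear[OF bounded_bilinear_scaleR]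
lemma smooth_mat_of: "smooth mat_of"
  by (rule smoothI[of "\<lambda>P. P"]) (simp_all add: cdiff_bounded_linear bounded_linear_ident)

section \<open>Calculus of derivatives along horizontal lifts\<close>

lemma linear_emb: "linear emb"
  by (intro linearI) (simp_all add: emb_def algebra_simps)

lemma bounded_linear_emb: "bounded_linear emb"
  using linear_emb linear_conv_bounded_linear by blast

lemma cinf_mat2_emb: "cinf X \<Longrightarrow> cinf (\<lambda>P. mat2_mult P (emb (X P)))"
  using cdiff_bounded_bilinear[OF bounded_bilinear_mat2_mult cdiff_bounded_linear[OF bounded_linear_ident]
    cdiff_bounded_linear_comp[OF bounded_linear_emb]] by blast

lemma along_frechet:
  assumes F: "cinf F" "\<And>p. f p = F (mat_of p)"
  shows "along X f p = frechet_derivative F (at (mat_of p)) (mat2_mult (mat_of p) (emb (X p)))"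
  unfolding along_def by (rule dir_deriv_eq[OF cinf_has_derivative[OF F(1)] F(2)])

lemma smooth_along:
  assumes "smooth X" "smooth f"
  shows "smooth (along X f)"
proof -
  obtain F where F: "cinf F" "\<And>p. f p = F (mat_of p)" using assms(2) by (rule smoothE) blast
  obtain Y where Y: "cinf Y" "\<And>p. X p = Y (mat_of p)" using assms(1) by (rule smoothE) blast
  show ?thesis
    using cinf_frechet_field[OF F(1) cinf_mat2_emb[OF Y(1)]]
    by (rule smoothI) (simp add: along_frechet[OF F] Y(2))
qed

lemma along_has_vector_derivative:
  assumes f: "smooth f" and c: "c 0 = p"
    "((\<lambda>t. mat_of (c t)) has_vector_derivative mat2_mult (mat_of p) (emb (X p))) (at 0)"
  shows "((\<lambda>t. f (c t)) has_vector_derivative along X f p) (at 0)"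
proof -
  obtain F where F: "cinf F" "\<And>p. f p = F (mat_of p)" using f by (rule smoothE) blast
  show ?thesis
    unfolding along_frechet[OF F] using c cinf_has_derivative[OF F(1)] F(2)
    by (intro along_curve[where f=f and F=F]) auto
qed

text \<open>Along this curve \<open>along\<close> is a derivative in one variable, so its rules
  follow from those for curves and the uniqueness of the derivative.\<close>

lemma along_gcurve:
  assumes "smooth f"
  shows "((\<lambda>t. f (p \<odot> gcurve (X p) t)) has_vector_derivative along X f p) (at 0)"
  using assms
  by (rule along_has_vector_derivative)
    (simp_all add: has_vector_derivative_gmult(1)[OF has_vector_derivative_gcurve])

lemma along_linear_comp:
  assumes f: "smooth f" and L: "bounded_linear L"
  shows "along X (\<lambda>p. L (f p)) p = L (along X f p)"
proof -
  let ?c = "\<lambda>t. p \<odot> gcurve (X p) t"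
  have "((\<lambda>t. L (f (?c t))) has_vector_derivative along X (\<lambda>p. L (f p)) p) (at 0)"
    by (rule along_gcurve[OF smooth_bounded_linear_comp[OF L f]])
  moreover have "((\<lambda>t. L (f (?c t))) has_vector_derivative L (along X f p)) (at 0)"
    by (rule bounded_linear.has_vector_derivative[OF L along_gcurve[OF f]])
  ultimately show ?thesis using vector_derivative_unique_at by blast
qed

lemma along_bilinear:
  assumes f: "smooth f" and g: "smooth g" and B: "bounded_bilinear B"
  shows "along X (\<lambda>p. B (f p) (g p)) p = B (f p) (along X g p) + B (along X f p) (g p)"
proof -
  let ?c = "\<lambda>t. p \<odot> gcurve (X p) t"
  have "((\<lambda>t. B (f (?c t)) (g (?c t))) has_vector_derivative along X (\<lambda>p. B (f p) (g p)) p) (at 0)"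
    by (rule along_gcurve[OF smooth_bounded_bilinear[OF B f g]])
  moreover have "((\<lambda>t. B (f (?c t)) (g (?c t))) has_vector_derivative
      B (f p) (along X g p) + B (along X f p) (g p)) (at 0)"
    using bounded_bilinear.has_vector_derivative[OF B along_gcurve[OF f] along_gcurve[OF g]]
    by simp
  ultimately show ?thesis using vector_derivative_unique_at by blast
qed

lemma along_add:
  assumes f: "smooth f" and g: "smooth g"
  shows "along X (\<lambda>p. f p + g p) p = along X f p + along X g p"
proof -
  let ?c = "\<lambda>t. p \<odot> gcurve (X p) t"
  have "((\<lambda>t. f (?c t) + g (?c t)) has_vector_derivative along X (\<lambda>p. f p + g p) p) (at 0)"
    by (rule along_gcurve[OF smooth_add[OF f g]])
  moreover have "((\<lambda>t. f (?c t) + g (?c t)) has_vector_derivative along X f p + along X g p) (at 0)"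
    by (rule has_vector_derivative_add[OF along_gcurve[OF f] along_gcurve[OF g]])
  ultimately show ?thesis using vector_derivative_unique_at by blast
qed

lemma along_const [simp]: "along X (\<lambda>p. c) p = 0"
  by (rule vector_derivative_unique_at[OF along_gcurve[OF smooth_const] has_vector_derivative_const])

text \<open>Changing the field changes the curve, so linearity is taken here from the Frechet
  derivative of an extension.\<close>

lemma along_field_linear:
  assumes "smooth f"
  shows "along (\<lambda>p. X p + Y p) f p = along X f p + along Y f p"
    "along (\<lambda>p. r p *\<^sub>R X p) f p = r p *\<^sub>R along X f p"
proof -
  obtain F where F: "cinf F" "\<And>p. f p = F (mat_of p)" using assms(1) by (rule smoothE) blast
  have l: "linear (frechet_derivative F (at P))" for P
    by (rule linear_frechet_derivative[OF cinf_differentiable[OF F(1)]])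
  show "along (\<lambda>p. X p + Y p) f p = along X f p + along Y f p"
    "along (\<lambda>p. r p *\<^sub>R X p) f p = r p *\<^sub>R along X f p"
    unfolding along_frechet[OF F]
    by (simp_all add: linear_add[OF linear_emb] linear_scale[OF linear_emb] mat2_bil linear_add[OF l] linear_scale[OF l])
qed

subsection \<open>Coordinates\<close>

lemma exhaust_5:
  fixes x :: 5
  shows "x = 1 \<or> x = 2 \<or> x = 3 \<or> x = 4 \<or> x = 5"
proof (induct x)
  case (of_int z)
  then have "z = 0 \<or> z = 1 \<or> z = 2 \<or> z = 3 \<or> z = 4" by fastforce
  then show ?case by auto
qed

lemma forall_5: "(\<forall>i::5. P i) \<longleftrightarrow> P 1 \<and> P 2 \<and> P 3 \<and> P 4 \<and> P 5"
  by (metis exhaust_5)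

definition v5 :: "real \<Rightarrow> real \<Rightarrow> real \<Rightarrow> real \<Rightarrow> real \<Rightarrow> real^5" where
  "v5 a b c d e = (\<chi> i. if i = 1 then a else if i = 2 then b else if i = 3 then c else if i = 4 then d else e)"

lemma v5_nth [simp]: "v5 a b c d e $ 1 = a" "v5 a b c d e $ 2 = b" "v5 a b c d e $ 3 = c"
  "v5 a b c d e $ 4 = d" "v5 a b c d e $ 5 = e"
  by (simp_all add: v5_def)

lemma vec5_eq_iff: "(x :: real^5) = y \<longleftrightarrow> x$1 = y$1 \<and> x$2 = y$2 \<and> x$3 = y$3 \<and> x$4 = y$4 \<and> x$5 = y$5"
  by (simp add: vec_eq_iff forall_5)

lemma emb_eq: "emb x = (x$2 *\<^sub>R s1 + x$3 *\<^sub>R s2 + (- 2 * x$1) *\<^sub>R s3, x$4 *\<^sub>R s1 + x$5 *\<^sub>R s2 + x$1 *\<^sub>R s3)"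
  by (simp add: emb_def)

text \<open>The projection of the Lie algebra to \<open>\<mm>\<close> along \<open>h0\<close>, extended to all pairs of matrices.\<close>

definition mproj :: "mat2 \<Rightarrow> real^5" where
  "mproj v = v5 ((snd v $2$1 - 2 * fst v $2$1) / 5) (fst v $3$2) (fst v $1$3) (snd v $3$2) (snd v $1$3)"

lemma mproj_emb [simp]: "mproj (r *\<^sub>R h0 + emb x) = x" "mproj (emb x) = x"
  by (simp_all add: mproj_def emb_eq h0_def s_defs vec5_eq_iff)

lemma m_part_emb: "m_part (r *\<^sub>R h0 + emb x) = x"
  unfolding m_part_def by (rule the_equality) (auto, metis mproj_emb(1))

lemma linear_mproj: "linear mproj"
  by (intro linearI) (simp_all add: mproj_def vec5_eq_iff field_simps)

lemma skew_eq_mproj: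
  assumes "mat2_transpose v = - v"
  obtains r where "v = r *\<^sub>R h0 + emb (mproj v)"
proof
  have a: "fst v $ i $ j = - fst v $ j $ i" "snd v $ i $ j = - snd v $ j $ i" for i j
    using arg_cong[OF assms, of "\<lambda>u. fst u $ j $ i"] arg_cong[OF assms, of "\<lambda>u. snd u $ j $ i"]
    by (simp_all only: mat2_transpose_def transpose_def fst_conv snd_conv vec_lambda_beta fst_uminus snd_uminus
        vector_uminus_component)
  have d: "fst v $ i $ i = 0" "snd v $ i $ i = 0" for i
    using a[of i i] by simp_all
  note E = d a[of 1 2] a[of 3 1] a[of 2 3]
  \<comment> \<open>Comparing coefficients of \<open>s3\<close>: they are r - 2 x_1 in the first
    factor and 2 r + x_1 in the second.\<close>
  show "v = ((fst v $2$1 + 2 * snd v $2$1) / 5) *\<^sub>R h0 + emb (mproj v)"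
    by (simp add: emb_eq mproj_def h0_def s_defs prod_eq_iff vec_eq_iff forall_3 E) (simp add: field_simps)
qed

subsection \<open>The isotropy representation\<close>

lemma rot3_conj: "rot3 t ** (a *\<^sub>R s1 + b *\<^sub>R s2 + c *\<^sub>R s3) ** transpose (rot3 t) =
    (cos t * a - sin t * b) *\<^sub>R s1 + (sin t * a + cos t * b) *\<^sub>R s2 + c *\<^sub>R s3"
proof -
  have c: "c * (cos t * cos t) + c * (sin t * sin t) = c"
    by (simp only: distrib_left[symmetric] sin_cos_mult_self mult_1_right)
  show ?thesis
    by (simp add: vec_eq_iff forall_3 matrix_matrix_mult_def transpose_def sum_3 rot3_def s_defs algebra_simps c)
qed

lemma rot3_double: "rot3 t ** rot3 t = rot3 (2 * t)"
  by (simp add: vec_eq_iff forall_3 matrix_matrix_mult_def sum_3 rot3_def cos_double sin_double power2_eq_square)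

lemma mat_of_Hel: "mat_of (Hel t) = (rot3 t, rot3 (2 * t))"
  by (simp add: Hel.rep_eq rot3_double)

lemma Hel_conj_emb:
  "mat2_mult (mat2_mult (mat_of (Hel t)) (emb x)) (mat2_transpose (mat_of (Hel t))) =
    emb (v5 (x$1) (cos t * x$2 - sin t * x$3) (sin t * x$2 + cos t * x$3)
      (cos (2*t) * x$4 - sin (2*t) * x$5) (sin (2*t) * x$4 + cos (2*t) * x$5))"
  unfolding mat_of_Hel mat2_mult_def mat2_transpose_def emb_eq fst_conv snd_conv rot3_conj v5_nth ..

lemma Hel_conj_h0: "mat2_mult (mat2_mult (mat_of (Hel t)) h0) (mat2_transpose (mat_of (Hel t))) = h0"
  using rot3_conj[of t 0 0 1] rot3_conj[of "2 * t" 0 0 2]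
  by (simp add: mat_of_Hel mat2_mult_def mat2_transpose_def h0_def)

lemma isot_eq: "isot t x = v5 (x$1) (cos t * x$2 - sin t * x$3) (sin t * x$2 + cos t * x$3)
      (cos (2*t) * x$4 - sin (2*t) * x$5) (sin (2*t) * x$4 + cos (2*t) * x$5)"
  unfolding isot_def Hel_conj_emb using m_part_emb[of 0] by simp

lemma emb_isot: "emb (isot t x) = mat2_mult (mat2_mult (mat_of (Hel t)) (emb x)) (mat2_transpose (mat_of (Hel t)))"
  unfolding Hel_conj_emb isot_eq ..

lemma linear_isot: "linear (isot t)"
  by (intro linearI) (simp_all add: isot_eq vec5_eq_iff algebra_simps)

lemma bounded_linear_isot: "bounded_linear (isot t)"
  using linear_isot linear_conv_bounded_linear by blast

lemma isot_inverse [simp]: "isot t (isot (- t) x) = x" "isot (- t) (isot t x) = x"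
proof -
  have r: "c * (c * a - (- s) * b) - s * ((- s) * a + c * b) = a" "s * (c * a - (- s) * b) + c * ((- s) * a + c * b) = b"
    "c * (c * a - s * b) - (- s) * (s * a + c * b) = a" "(- s) * (c * a - s * b) + c * (s * a + c * b) = b"
    if "c * c + s * s = 1" for a b c s :: real
    using that by algebra+
  show "isot t (isot (- t) x) = x" "isot (- t) (isot t x) = x"
    unfolding isot_eq vec5_eq_iff v5_nth cos_minus sin_minus mult_minus_right[of 2] r[OF sin_cos_mult_self(2)]
    by simp_all
qed

text \<open>Right translation by h sends p v to (p h) Ad(h^-1) v. Hence the equivariance of a vector
  field says that its horizontal lift is invariant under right translation by
  \<open>H\<close>.\<close>

lemma emb_isot_minus:
  "mat2_mult (mat_of (Hel t)) (emb (isot (- t) x)) = mat2_mult (emb x) (mat_of (Hel t))"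
proof -
  have "mat2_mult (emb x) (mat_of (Hel t)) = mat2_mult (emb (isot t (isot (- t) x))) (mat_of (Hel t))"
    by simp
  also have "\<dots> = mat2_mult (mat_of (Hel t)) (emb (isot (- t) x))"
    unfolding emb_isot by (simp add: mat2_mult_assoc)
  finally show ?thesis by simp
qed

subsection \<open>The bracket of vector fields\<close>

text \<open>The \<open>\<mm>\<close>-component of the commutator of two elements of \<open>\<mm>\<close>.\<close>

definition br :: "real^5 \<Rightarrow> real^5 \<Rightarrow> real^5" where
  "br x y = v5 ((x$4 * y$5 - x$5 * y$4) / 5 - 2 * (x$2 * y$3 - x$3 * y$2) / 5)
     (2 * (x$1 * y$3 - x$3 * y$1)) (- 2 * (x$1 * y$2 - x$2 * y$1))
     (- (x$1 * y$5 - x$5 * y$1)) (x$1 * y$4 - x$4 * y$1)"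

lemma emb_commutator: "\<exists>r. mat2_mult (emb x) (emb y) - mat2_mult (emb y) (emb x) = r *\<^sub>R h0 + emb (br x y)"
  \<comment> \<open>With e = b_3 - 2 a_3 one has a_3 = (h0 - 2 e) / 5 and b_3 = (2 h0 + e) / 5. Only
    [a_1, a_2] = a_3 and [b_1, b_2] = b_3 contribute to the component along
    \<open>h0\<close>.\<close>
  by (rule exI[of _ "(x$2 * y$3 - x$3 * y$2) / 5 + 2 * (x$4 * y$5 - x$5 * y$4) / 5"])
    (simp add: mat2_mult_def emb_eq h0_def s_defs br_def prod_eq_iff vec_eq_iff forall_3 matrix_matrix_mult_def sum_3 field_simps)

lemma bilinear_br: "bilinear br"
  unfolding bilinear_def
  by (auto intro!: linearI simp: br_def vec5_eq_iff field_simps)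

lemma bounded_bilinear_br: "bounded_bilinear br"
  using bilinear_br bilinear_conv_bounded_bilinear by blast

lemma br_isot: "br (isot t x) (isot t y) = isot t (br x y)"
proof -
  \<comment> \<open>A 2 x 2 determinant does not change when both of its columns are rotated; this
    serves the planes (2,3) and (4,5).\<close>
  have w: "(c * a - s * b) * (s * a' + c * b') - (s * a + c * b) * (c * a' - s * b') = a * b' - b * a'"
    if "c * c + s * s = 1" for a b a' b' c s :: real
    using that by algebra
  show ?thesis
    unfolding vec5_eq_iff isot_eq br_def v5_nth w[OF sin_cos_mult_self(2)] by (simp add: algebra_simps)
qed

section \<open>Equivariance of derivatives and the formula for the bracket\<close>

lemma vector_fieldD:
  assumes "vector_field X"
  shows "smooth X" "X (p \<odot> Hel t) = isot (- t) (X p)"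
  using assms by (auto simp: vector_field_def)

lemma scalar_fieldD:
  assumes "scalar_field f"
  shows "smooth f" "f (p \<odot> Hel t) = f p"
  using assms by (auto simp: scalar_field_def)

text \<open>Right translation by \<open>Hel t\<close> carries a curve with the horizontal velocity
  of X at p to one with the horizontal velocity of X at the translated point.\<close>

lemma along_equivariant:
  assumes X: "vector_field X" and f: "smooth f" and L: "bounded_linear L"
    and eq: "\<And>p. f (p \<odot> Hel t) = L (f p)"
  shows "along X f (p \<odot> Hel t) = L (along X f p)"
proof -
  let ?c = "\<lambda>s. (p \<odot> gcurve (X p) s) \<odot> Hel t"
  have v: "mat2_mult (mat2_mult (mat_of p) (emb (X p))) (mat_of (Hel t))
      = mat2_mult (mat_of (p \<odot> Hel t)) (emb (X (p \<odot> Hel t)))"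
    by (simp add: vector_fieldD(2)[OF X] mat_of_gmult mat2_mult_assoc emb_isot_minus)
  have "((\<lambda>s. f (?c s)) has_vector_derivative along X f (p \<odot> Hel t)) (at 0)"
    by (rule along_has_vector_derivative[OF f])
      (simp_all add: v[symmetric] has_vector_derivative_gmult has_vector_derivative_gcurve)
  moreover have "((\<lambda>s. f (?c s)) has_vector_derivative L (along X f p)) (at 0)"
    unfolding eq by (rule bounded_linear.has_vector_derivative[OF L along_gcurve[OF f]])
  ultimately show ?thesis using vector_derivative_unique_at by blast
qed

text \<open>Product rule for F'(Q)(h(Q)): one term moves the base point with the direction h(P)
  frozen, the other moves the direction.\<close>

lemma frechet_derivative_field:
  fixes F :: "'a::euclidean_space \<Rightarrow> 'b::real_normed_vector"
  assumes F: "cinf F" and h: "(h has_derivative h') (at P)"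
  shows "((\<lambda>Q. frechet_derivative F (at Q) (h Q)) has_derivative
    (\<lambda>w. frechet_derivative (\<lambda>Q. frechet_derivative F (at Q) (h P)) (at P) w
      + frechet_derivative F (at P) (h' w))) (at P)"
proof -
  note F1 = frechet_Basis_sum[OF cinf_differentiable[OF F]]
  let ?D = "\<lambda>v w. frechet_derivative (\<lambda>Q. frechet_derivative F (at Q) v) (at P) w"
  have dv: "((\<lambda>Q. frechet_derivative F (at Q) b) has_derivative ?D b) (at P)" for b
    by (rule cinf_has_derivative[OF cinf_frechet[OF F]])
  have "((\<lambda>Q. \<Sum>b\<in>Basis. (h P \<bullet> b) *\<^sub>R frechet_derivative F (at Q) b) has_derivative
      (\<lambda>w. \<Sum>b\<in>Basis. (h P \<bullet> b) *\<^sub>R ?D b w)) (at P)"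
    by (intro has_derivative_sum has_derivative_scaleR_right dv)
  then have 1: "?D (h P) w = (\<Sum>b\<in>Basis. (h P \<bullet> b) *\<^sub>R ?D b w)" for w
    by (simp add: F1[of _ "h P", symmetric] frechet_derivative_eq)
  have hb: "((\<lambda>Q. h Q \<bullet> b) has_derivative (\<lambda>w. h' w \<bullet> b)) (at P)" for b
    by (rule has_derivative_inner_left[OF h])
  have "((\<lambda>Q. \<Sum>b\<in>Basis. (h Q \<bullet> b) *\<^sub>R frechet_derivative F (at Q) b) has_derivative
      (\<lambda>w. \<Sum>b\<in>Basis. (h P \<bullet> b) *\<^sub>R ?D b w + (h' w \<bullet> b) *\<^sub>R frechet_derivative F (at P) b)) (at P)"
    by (intro has_derivative_sum has_derivative_scaleR hb dv)
  then show ?thesis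
    by (simp add: 1 F1[of _ "h _", symmetric] F1[of _ "h' _", symmetric] sum.distrib)
qed

text \<open>The mixed second derivatives of \<open>f\<close> cancel by symmetry, which leaves the commutator in the
  Lie algebra; its \<open>\<hh>\<close>-component annihilates \<open>f\<close> because \<open>f\<close> is constant along right \<open>H\<close>-orbits.\<close>

lemma along_commutator:
  assumes f: "scalar_field f" and X: "smooth X" and Y: "smooth Y"
  shows "along X (along Y f) p - along Y (along X f) p
    = along (\<lambda>p. along X Y p - along Y X p + br (X p) (Y p)) f p"
proof -
  obtain F where F: "cinf F" "\<And>p. f p = F (mat_of p)" using scalar_fieldD(1)[OF f] by (rule smoothE) blast
  obtain A where A: "cinf A" "\<And>p. X p = A (mat_of p)" using X by (rule smoothE) blast
  obtain B where B: "cinf B" "\<And>p. Y p = B (mat_of p)" using Y by (rule smoothE) blast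
  let ?P = "mat_of p"
  let ?D = "\<lambda>v w. frechet_derivative (\<lambda>Q. frechet_derivative F (at Q) v) (at ?P) w"
  let ?F' = "frechet_derivative F (at ?P)"
  have l: "linear ?F'"
    by (rule linear_frechet_derivative[OF cinf_differentiable[OF F(1)]])
  \<comment> \<open>The direction Q Y(Q) varies through the factor Q, which gives the matrix
    product, and through Y, which gives the componentwise derivative.\<close>
  have second: "along X (along Y f) p = ?D (mat2_mult ?P (emb (Y p))) (mat2_mult ?P (emb (X p)))
      + ?F' (mat2_mult ?P (mat2_mult (emb (X p)) (emb (Y p)))) + ?F' (mat2_mult ?P (emb (along X Y p)))"
    if A: "cinf A" "\<And>p. X p = A (mat_of p)" and B: "cinf B" "\<And>p. Y p = B (mat_of p)" for X Y A B
  proof -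
    let ?h = "\<lambda>Q. mat2_mult Q (emb (B Q))"
    have h: "(?h has_derivative (\<lambda>w. mat2_mult ?P (emb (frechet_derivative B (at ?P) w)) + mat2_mult w (emb (B ?P)))) (at ?P)"
      by (intro bounded_bilinear.FDERIV[OF bounded_bilinear_mat2_mult] has_derivative_ident
          bounded_linear.has_derivative[OF bounded_linear_emb] cinf_has_derivative[OF B(1)])
    have "along X (along Y f) p = frechet_derivative (\<lambda>Q. frechet_derivative F (at Q) (?h Q)) (at ?P) (mat2_mult ?P (emb (X p)))"
      by (rule along_frechet[OF cinf_frechet_field[OF F(1) cinf_mat2_emb[OF B(1)]]])
        (simp add: along_frechet[OF F] B(2))
    then show ?thesis
      by (simp add: frechet_derivative_eq[OF frechet_derivative_field[OF F(1) h]] linear_add[OF l]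
          along_frechet[OF B] B(2)[symmetric] mat2_mult_assoc)
  qed
  obtain r where r: "mat2_mult (emb (X p)) (emb (Y p)) - mat2_mult (emb (Y p)) (emb (X p))
      = r *\<^sub>R h0 + emb (br (X p) (Y p))"
    using emb_commutator by blast
  have "((\<lambda>t. f (p \<odot> Hel t)) has_vector_derivative ?F' (mat2_mult ?P h0)) (at 0)"
    using cinf_has_derivative[OF F(1)] F(2) has_vector_derivative_gmult(1)[OF has_vector_derivative_Hel]
    by (intro along_curve[where f=f and F=F]) auto
  then have "((\<lambda>t. f p) has_vector_derivative ?F' (mat2_mult ?P h0)) (at 0)"
    by (simp add: scalar_fieldD(2)[OF f])
  then have 0: "?F' (mat2_mult ?P h0) = 0"
    using vector_derivative_unique_at[OF _ has_vector_derivative_const] by blast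
  have "?F' (mat2_mult ?P (mat2_mult (emb (X p)) (emb (Y p)))) - ?F' (mat2_mult ?P (mat2_mult (emb (Y p)) (emb (X p))))
      = ?F' (mat2_mult ?P (r *\<^sub>R h0 + emb (br (X p) (Y p))))"
    by (simp only: linear_diff[OF l, symmetric] mat2_bil(4)[symmetric] r)
  also have "\<dots> = ?F' (mat2_mult ?P (emb (br (X p) (Y p))))"
    by (simp add: mat2_bil linear_add[OF l] linear_scale[OF l] 0)
  finally show ?thesis
    unfolding second[OF A B] second[OF B A]
    by (simp add: along_frechet[OF F] linear_add[OF linear_emb] linear_diff[OF linear_emb] mat2_bil
        linear_add[OF l] linear_diff[OF l] frechet_derivative_symmetric[OF F(1), of "mat2_mult ?P (emb (X p))"])
qed

text \<open>Left translation by the inverse of p, which is its transpose, transports an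
  \<open>H\<close>-invariant function from the unit to p; only its derivative at the unit then has
  to be known.\<close>

lemma scalar_field_translate:
  fixes \<phi> :: "mat2 \<Rightarrow> real"
  assumes c: "cinf \<phi>" and inv: "\<And>Q t. \<phi> (mat2_mult Q (mat_of (Hel t))) = \<phi> Q"
    and d: "(\<phi> has_derivative \<phi>') (at mat2_one)"
  obtains f where "scalar_field f" "\<And>Z. along Z f p = \<phi>' (emb (Z p))"
proof
  let ?T = "mat2_mult (mat2_transpose (mat_of p))"
  let ?f = "\<lambda>q. \<phi> (?T (mat_of q))"
  have bl: "bounded_linear ?T"
    by (rule bounded_bilinear.bounded_linear_right[OF bounded_bilinear_mat2_mult])
  have comp: "cinf (\<lambda>Q. \<psi> (?T Q))" if "cinf \<psi>" for \<psi> :: "mat2 \<Rightarrow> real"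
  proof
    show "cdiff n (\<lambda>Q. \<psi> (?T Q))" for n
      using that
    proof (induction n arbitrary: \<psi>)
      case 0
      then have "continuous_on UNIV \<psi>" by (metis cdiff.simps(1))
      then show ?case
        using linear_continuous_on[OF bl] by (auto intro: continuous_on_compose2)
    next
      case (Suc n)
      have d: "((\<lambda>Q. \<psi> (?T Q)) has_derivative (\<lambda>v. frechet_derivative \<psi> (at (?T Q)) (?T v))) (at Q)" for Q
        by (rule has_derivative_compose[OF bounded_linear_imp_has_derivative[OF bl] cinf_has_derivative[OF Suc.prems]])
      show ?case
        unfolding cdiff.simps frechet_derivative_eq[OF d]
        using Suc.IH[OF cinf_frechet[OF Suc.prems]] d differentiable_def by blast
    qed
  qed
  have "smooth ?f"
    by (rule smoothI[OF comp[OF c]]) simp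
  then show "scalar_field ?f"
    by (simp add: scalar_field_def mat_of_gmult mat2_mult_assoc[symmetric] inv)
  fix Z
  have "((\<lambda>Q. \<phi> (?T Q)) has_derivative (\<lambda>v. \<phi>' (?T v))) (at (mat_of p))"
    by (rule has_derivative_compose[OF bounded_linear_imp_has_derivative[OF bl]]) (simp add: d)
  then show "along Z ?f p = \<phi>' (emb (Z p))"
    unfolding along_def using dir_deriv_eq[OF _ refl, of "\<lambda>Q. \<phi> (?T Q)" _ p "Z p"] by simp
qed

lemma bounded_linear_entry: "bounded_linear (\<lambda>Q::mat2. fst Q $ i $ j)" "bounded_linear (\<lambda>Q::mat2. snd Q $ i $ j)"
  unfolding linear_conv_bounded_linear[symmetric] by (auto intro!: linearI)

text \<open>Since \<open>H\<close> fixes \<open>e\<^sub>3\<close>, the third columns are \<open>H\<close>-invariant.  For the remaining direction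
  the imaginary part of \<open>z\<^sup>2 w\<close> is used, where \<open>z = A\<^sub>1\<^sub>1 + \<i> A\<^sub>1\<^sub>2\<close> and \<open>w = B\<^sub>1\<^sub>1 - \<i> B\<^sub>1\<^sub>2\<close> have weights \<open>1\<close> and \<open>- 2\<close>.\<close>

lemma scalar_fields_separate:
  assumes eq: "\<And>f. scalar_field f \<Longrightarrow> along Z f = along Z' f"
  shows "Z = Z'"
proof
  fix p
  have sep: "\<phi>' (emb (Z p)) = \<phi>' (emb (Z' p))"
    if "cinf \<phi>" "\<And>Q t. \<phi> (mat2_mult Q (mat_of (Hel t))) = \<phi> Q" "(\<phi> has_derivative \<phi>') (at mat2_one)"
    for \<phi> \<phi>' :: "mat2 \<Rightarrow> real"
    using scalar_field_translate[OF that, of p] eq by metis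
  have col3: "mat2_mult Q (mat_of (Hel t)) = (fst Q ** rot3 t, snd Q ** rot3 (2 * t))" for Q t
    by (simp add: mat2_mult_def mat_of_Hel)
  have ent: "(A ** rot3 t) $ i $ 1 = cos t * A $ i $ 1 + sin t * A $ i $ 2"
    "(A ** rot3 t) $ i $ 2 = cos t * A $ i $ 2 - sin t * A $ i $ 1"
    "(A ** rot3 t) $ i $ 3 = A $ i $ 3" for A :: "real^3^3" and t i
    by (simp_all add: rot3_def matrix_matrix_mult_def sum_3)
  have e: "fst (emb (Z p)) $ i $ 3 = fst (emb (Z' p)) $ i $ 3" "snd (emb (Z p)) $ i $ 3 = snd (emb (Z' p)) $ i $ 3" for i
    by (rule sep[OF _ _ bounded_linear_imp_has_derivative[OF bounded_linear_entry(1)]];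
        simp add: cdiff_bounded_linear bounded_linear_entry col3 ent)
      (rule sep[OF _ _ bounded_linear_imp_has_derivative[OF bounded_linear_entry(2)]];
        simp add: cdiff_bounded_linear bounded_linear_entry col3 ent)
  let ?\<phi> = "\<lambda>Q::mat2. 2 * (fst Q $ 1 $ 1 * fst Q $ 1 $ 2) * snd Q $ 1 $ 1
      - (fst Q $ 1 $ 1 * fst Q $ 1 $ 1 - fst Q $ 1 $ 2 * fst Q $ 1 $ 2) * snd Q $ 1 $ 2"
  have "cinf ?\<phi>"
    unfolding diff_conv_add_uminus minus_mult_left
    by (intro allI cdiff_add cdiff_bounded_bilinear[OF bounded_bilinear_mult]
        cdiff_bounded_linear_comp[OF bounded_linear_minus[OF bounded_linear_ident]]
        cdiff_const cdiff_bounded_linear bounded_linear_entry)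
  moreover have "?\<phi> (mat2_mult Q (mat_of (Hel t))) = ?\<phi> Q" for Q t
  proof -
    have s: "sin t * sin t = 1 - cos t * cos t" using sin_cos_mult_self(1)[of t] by simp
    show ?thesis
      unfolding col3 fst_conv snd_conv ent cos_double sin_double power2_eq_square
      using s by algebra
  qed
  \<comment> \<open>On \<open>emb x\<close> this derivative equals 5 x_1, the coordinate that the
    third columns miss.\<close>
  moreover have "(?\<phi> has_derivative (\<lambda>V. 2 * fst V $ 1 $ 2 - snd V $ 1 $ 2)) (at mat2_one)"
    by (auto intro!: derivative_eq_intros bounded_linear_imp_has_derivative bounded_linear_entry
        simp: mat2_one_def mat_def)
  ultimately have "2 * fst (emb (Z p)) $ 1 $ 2 - snd (emb (Z p)) $ 1 $ 2 = 2 * fst (emb (Z' p)) $ 1 $ 2 - snd (emb (Z' p)) $ 1 $ 2"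
    by (rule sep)
  then show "Z p = Z' p"
    using e[of 1] e[of 2] by (simp add: emb_eq s_defs vec5_eq_iff)
qed

lemma vector_field_bracket:
  assumes X: "vector_field X" and Y: "vector_field Y"
  shows "vector_field (\<lambda>p. along X Y p - along Y X p + br (X p) (Y p))"
proof -
  note sX = vector_fieldD(1)[OF X] and sY = vector_fieldD(1)[OF Y]
  note li = linear_isot
  have "along X Y (p \<odot> Hel t) = isot (- t) (along X Y p)" "along Y X (p \<odot> Hel t) = isot (- t) (along Y X p)" for p t
    using along_equivariant[OF X sY bounded_linear_isot vector_fieldD(2)[OF Y]]
      along_equivariant[OF Y sX bounded_linear_isot vector_fieldD(2)[OF X]] by auto
  then show ?thesis
    unfolding vector_field_def
    by (auto intro!: smooth_add smooth_diff smooth_along smooth_bounded_bilinear[OF bounded_bilinear_br] sX sY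
        simp: linear_add[OF li] linear_diff[OF li] br_isot vector_fieldD(2)[OF X] vector_fieldD(2)[OF Y])
qed

text \<open>By \<open>along_commutator\<close> this field has the defining property of the bracket;
  by \<open>scalar_fields_separate\<close> it is the only one.\<close>

lemma lie_bracket_eq:
  assumes X: "vector_field X" and Y: "vector_field Y"
  shows "lie_bracket X Y = (\<lambda>p. along X Y p - along Y X p + br (X p) (Y p))"
  unfolding lie_bracket_def
proof (rule the_equality, intro conjI allI impI)
  show "vector_field (\<lambda>p. along X Y p - along Y X p + br (X p) (Y p))"
    by (rule vector_field_bracket[OF X Y])
next
  fix f :: sfield
  assume "scalar_field f"
  then show "along (\<lambda>p. along X Y p - along Y X p + br (X p) (Y p)) f = (\<lambda>p. along X (along Y f) p - along Y (along X f) p)"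
    using along_commutator[OF _ vector_fieldD(1)[OF X] vector_fieldD(1)[OF Y]] by presburger
next
  fix Z
  assume "vector_field Z \<and> (\<forall>f. scalar_field f \<longrightarrow> along Z f = (\<lambda>p. along X (along Y f) p - along Y (along X f) p))"
  then show "Z = (\<lambda>p. along X Y p - along Y X p + br (X p) (Y p))"
    using along_commutator[OF _ vector_fieldD(1)[OF X] vector_fieldD(1)[OF Y]]
    by (intro scalar_fields_separate) auto
qed

text \<open>The witness is the fundamental field of an element of the Lie algebra.\<close>

lemma vector_field_with_value: obtains X where "vector_field X" "X p = x"
proof
  let ?T = "\<lambda>q. mat2_transpose (mat_of q)"
  let ?w = "mat2_mult (mat_of p) (mat2_mult (emb x) (?T p))"
  let ?U = "\<lambda>q. mat2_mult (?T q) (mat2_mult ?w (mat_of q))"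
  let ?X = "\<lambda>q. mproj (?U q)"
  have blm: "bounded_linear mproj"
    using linear_mproj linear_conv_bounded_linear by blast
  have "linear mat2_transpose"
    by (intro linearI) (simp_all add: mat2_transpose_def transpose_def vec_eq_iff)
  then have blt: "bounded_linear mat2_transpose"
    using linear_conv_bounded_linear by blast
  have tm: "mat2_transpose (mat2_mult P Q) = mat2_mult (mat2_transpose Q) (mat2_transpose P)" for P Q
    by (simp add: mat2_transpose_def mat2_mult_def matrix_transpose_mul)
  have tt: "mat2_transpose (mat2_transpose P) = P" for P
    by (simp add: mat2_transpose_def)
  have te: "mat2_transpose (emb x) = - emb x"
    by (simp add: mat2_transpose_def emb_eq s_defs transpose_def vec_eq_iff forall_3)
  \<comment> \<open>Conjugation by orthogonal matrices keeps the element in the Lie algebra, where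
    \<open>mproj\<close> is the projection along \<open>h0\<close>.\<close>
  have skew: "mat2_transpose (?U q) = - ?U q" for q
    by (simp only: tm tt te mat2_mult_assoc bounded_bilinear.minus_left[OF bounded_bilinear_mat2_mult]
        bounded_bilinear.minus_right[OF bounded_bilinear_mat2_mult])
  show "vector_field ?X"
    unfolding vector_field_def
  proof (intro conjI allI)
    show "smooth ?X"
      by (intro smooth_bounded_linear_comp[OF blm] smooth_bounded_bilinear[OF bounded_bilinear_mat2_mult]
          smooth_const smooth_bounded_linear_comp[OF blt] smooth_mat_of)
    fix q t
    obtain r where r: "?U q = r *\<^sub>R h0 + emb (?X q)"
      using skew_eq_mproj[OF skew] .
    let ?H = "mat_of (Hel t)"
    \<comment> \<open>\<open>H\<close> commutes with \<open>h0\<close>, so the component that is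
      projected away stays a multiple of \<open>h0\<close>, and the projection is
      equivariant.\<close>
    have "mat2_mult ?H h0 = mat2_mult h0 ?H"
      using arg_cong[OF Hel_conj_h0[of t], of "\<lambda>v. mat2_mult v ?H"] by (simp add: mat2_mult_assoc)
    then have "mat2_mult (r *\<^sub>R h0 + emb (?X q)) ?H = mat2_mult ?H (r *\<^sub>R h0 + emb (isot (- t) (?X q)))"
      by (simp add: mat2_bil emb_isot_minus)
    then have "mat2_mult (mat2_transpose ?H) (mat2_mult (?U q) ?H) = r *\<^sub>R h0 + emb (isot (- t) (?X q))"
      using r by simp
    moreover have "?U (q \<odot> Hel t) = mat2_mult (mat2_transpose ?H) (mat2_mult (?U q) ?H)"
      by (simp add: mat_of_gmult tm mat2_mult_assoc)
    ultimately show "?X (q \<odot> Hel t) = isot (- t) (?X q)"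
      by simp
  qed
  show "?X p = x"
    by (simp add: mat2_mult_assoc)
qed

subsection \<open>Constant tensors and connections with constant coefficients\<close>

definition equivariant :: "(real^5 \<Rightarrow> real^5) \<Rightarrow> bool" where
  "equivariant P \<longleftrightarrow> linear P \<and> (\<forall>t x. P (isot t x) = isot t (P x))"

lemma equivariant_bounded_linear: "equivariant P \<Longrightarrow> bounded_linear P"
  by (simp add: equivariant_def linear_conv_bounded_linear)

lemma vector_field_equivariant: "equivariant P \<Longrightarrow> vector_field X \<Longrightarrow> vector_field (\<lambda>p. P (X p))"
  unfolding vector_field_def
  using smooth_bounded_linear_comp[OF equivariant_bounded_linear] by (auto simp: equivariant_def)

lemma vector_field_add: "vector_field X \<Longrightarrow> vector_field Y \<Longrightarrow> vector_field (\<lambda>p. X p + Y p)"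
  unfolding vector_field_def by (auto intro: smooth_add simp: linear_add[OF linear_isot])

lemma vector_field_diff: "vector_field X \<Longrightarrow> vector_field Y \<Longrightarrow> vector_field (\<lambda>p. X p - Y p)"
  unfolding vector_field_def by (auto intro: smooth_diff simp: linear_diff[OF linear_isot])

lemma vector_field_along:
  assumes "vector_field X" "vector_field Y"
  shows "vector_field (along X Y)"
  using assms along_equivariant[OF assms(1) vector_fieldD(1)[OF assms(2)] bounded_linear_isot vector_fieldD(2)[OF assms(2)]]
  by (auto simp: vector_field_def intro: smooth_along)

text \<open>Needed for a nonlinear C, namely the cubic form of Upsilon.\<close>

lemma along_chain:
  assumes f: "smooth f" and C: "(C has_derivative C') (at (f p))"
  shows "along X (\<lambda>p. C (f p)) p = C' (along X f p)"
proof -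
  obtain F where F: "cinf F" "\<And>p. f p = F (mat_of p)" using f by (rule smoothE) blast
  have "((\<lambda>P. C (F P)) has_derivative (\<lambda>v. C' (frechet_derivative F (at (mat_of p)) v))) (at (mat_of p))"
    using C unfolding F(2) by (rule has_derivative_compose[OF cinf_has_derivative[OF F(1)]])
  from dir_deriv_eq[OF this, of "\<lambda>p. C (f p)"] show ?thesis
    by (simp add: along_frechet[OF F]) (simp add: along_def F(2))
qed

lemma ext_deriv1_const:
  assumes \<eta>: "bounded_linear \<eta>" and X: "vector_field X" and Y: "vector_field Y"
  shows "ext_deriv1 (\<lambda>p. \<eta>) X Y = (\<lambda>p. - \<eta> (br (X p) (Y p)))"
  using vector_fieldD(1)[OF X] vector_fieldD(1)[OF Y]
  by (auto simp: ext_deriv1_def ev1_def lie_bracket_eq[OF X Y] along_linear_comp[OF _ \<eta>]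
      linear_add[OF bounded_linear.linear[OF \<eta>]] linear_diff[OF bounded_linear.linear[OF \<eta>]])

lemma ext_deriv2_const:
  assumes B: "bounded_bilinear B" and skew: "\<And>x y. B x y = - B y x"
    and X: "vector_field X" and Y: "vector_field Y" and Z: "vector_field Z"
  shows "ext_deriv2 (\<lambda>X Y p. B (X p) (Y p)) X Y Z
    = (\<lambda>p. - B (br (X p) (Y p)) (Z p) + B (br (X p) (Z p)) (Y p) - B (br (Y p) (Z p)) (X p))"
  \<comment> \<open>The product rule and the brackets produce the same derivative terms with the
    arguments of B in opposite orders; skewness makes them cancel.\<close>
  using vector_fieldD(1)[OF X] vector_fieldD(1)[OF Y] vector_fieldD(1)[OF Z]
    skew[of "Y _" "along X Z _"] skew[of "X _" "along Y Z _"] skew[of "X _" "along Z Y _"]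
  by (auto simp: ext_deriv2_def lie_bracket_eq X Y Z along_bilinear[OF _ _ B]
      bounded_bilinear.add_left[OF B] bounded_bilinear.diff_left[OF B])

lemma nijenhuis_const:
  assumes P: "equivariant P" and \<eta>: "bounded_linear \<eta>" and X: "vector_field X" and Y: "vector_field Y"
  shows "nijenhuis \<xi> (\<lambda>p. \<eta>) (\<lambda>p. P) X Y = (\<lambda>p.
      br (P (X p)) (P (Y p)) - P (br (X p) (P (Y p))) - P (br (P (X p)) (Y p)) + P (P (br (X p) (Y p)))
      - \<eta> (br (X p) (Y p)) *\<^sub>R \<xi> p)"
proof -
  have l: "linear P" using P by (simp add: equivariant_def)
  note PX = vector_field_equivariant[OF P X] and PY = vector_field_equivariant[OF P Y]
  show ?thesis
    using vector_fieldD(1)[OF X] vector_fieldD(1)[OF Y]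
    by (auto simp: nijenhuis_def act_def lie_bracket_eq[OF PX PY] lie_bracket_eq[OF PX Y] lie_bracket_eq[OF X PY]
        lie_bracket_eq[OF X Y] ext_deriv1_const[OF \<eta> X Y] along_linear_comp[OF _ equivariant_bounded_linear[OF P]]
        linear_add[OF l] linear_diff[OF l])
qed

text \<open>Nomizu's description of the invariant connections on a reductive homogeneous space, for
  equivariant L. L = 0 is the canonical connection, whose torsion is the negative of
  \<open>br\<close>.\<close>

definition cconn :: "(real^5 \<Rightarrow> real^5 \<Rightarrow> real^5) \<Rightarrow> conn" where
  "cconn L X Y = (\<lambda>p. along X Y p + L (X p) (Y p))"

definition equivariant2 :: "(real^5 \<Rightarrow> real^5 \<Rightarrow> real^5) \<Rightarrow> bool" where
  "equivariant2 L \<longleftrightarrow> bounded_bilinear L \<and> (\<forall>t x y. L (isot t x) (isot t y) = isot t (L x y))"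

lemma vector_field_bilinear:
  "equivariant2 L \<Longrightarrow> vector_field X \<Longrightarrow> vector_field Y \<Longrightarrow> vector_field (\<lambda>p. L (X p) (Y p))"
  unfolding vector_field_def equivariant2_def by (auto intro: smooth_bounded_bilinear)

lemma connection_cconn:
  assumes L: "equivariant2 L"
  shows "connection (cconn L)"
proof -
  have B: "bounded_bilinear L" using L by (simp add: equivariant2_def)
  note bl = bounded_bilinear.add_left[OF B] bounded_bilinear.add_right[OF B]
    bounded_bilinear.scaleR_left[OF B] bounded_bilinear.scaleR_right[OF B]
  show ?thesis
    unfolding connection_def
  proof (intro conjI allI impI)
    show "vector_field (cconn L X Y)" if "vector_field X" "vector_field Y" for X Y
      unfolding cconn_def by (intro vector_field_add vector_field_along vector_field_bilinear[OF L] that)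
  qed (auto simp: cconn_def along_field_linear along_add along_bilinear[OF _ _ bounded_bilinear_scaleR] bl
      vector_fieldD(1) scalar_fieldD(1) algebra_simps)
qed

lemma metric_connection_cconn:
  assumes L: "equivariant2 L" and g: "bounded_bilinear g"
    and skew: "\<And>x y z. g (L x y) z + g y (L x z) = 0"
  shows "metric_connection g (cconn L)"
  unfolding metric_connection_def
proof (intro conjI allI impI connection_cconn[OF L])
  fix X Y Z
  assume "vector_field X" "vector_field Y" "vector_field Z"
  then have s: "smooth Y" "smooth Z" by (simp_all add: vector_fieldD(1))
  have "g (L x y) z = - g y (L x z)" for x y z
    using skew[of x y z] by linarith
  then show "along X (ip g Y Z) = (\<lambda>p. ip g (cconn L X Y) Z p + ip g Y (cconn L X Z) p)"
    by (auto simp: ip_def cconn_def along_bilinear[OF s g] bounded_bilinear.add_left[OF g] bounded_bilinear.add_right[OF g])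
qed

lemma torsion_cconn:
  assumes X: "vector_field X" and Y: "vector_field Y"
  shows "torsion (cconn L) X Y = (\<lambda>p. L (X p) (Y p) - L (Y p) (X p) - br (X p) (Y p))"
  by (auto simp: torsion_def cconn_def lie_bracket_eq[OF X Y])

subsection \<open>Metric connections with skew torsion\<close>

text \<open>The difference a is skew in its last two slots because both connections are metric. Skew
  torsion makes a(X,Y,Z) - a(Y,X,Z) skew in Y and Z too. Together these make a skew in its first and
  third slots, hence totally skew.\<close>

lemma metric_connection_diff_skew:
  assumes D: "metric_connection g D" "metric_connection g D'" and g: "bounded_bilinear g" and sym: "\<And>x y. g x y = g y x"
    and T: "skew_torsion g D" "skew_torsion g D'"
    and X: "vector_field X" and Y: "vector_field Y" and Z: "vector_field Z"
  shows "g (D' X Y p - D X Y p) (Z p) = - g (D' X Z p - D X Z p) (Y p)"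
    and "g (D' X Y p - D X Y p) (Z p) = - g (D' Y X p - D Y X p) (Z p)"
proof -
  define a where "a X Y Z = g (D' X Y p - D X Y p) (Z p)" for X Y Z
  note gs = bounded_bilinear.diff_left[OF g] bounded_bilinear.diff_right[OF g] bounded_bilinear.add_left[OF g]
  have 1: "a X Y Z = - a X Z Y" if "vector_field X" "vector_field Y" "vector_field Z" for X Y Z
  proof -
    have "along X (ip g Y Z) p = ip g (D X Y) Z p + ip g Y (D X Z) p"
      "along X (ip g Y Z) p = ip g (D' X Y) Z p + ip g Y (D' X Z) p"
      using D that unfolding metric_connection_def by metis+
    then show ?thesis
      by (simp add: a_def ip_def gs sym[of "Y p"])
  qed
  have t: "a X Y Z - a Y X Z = torsion3 g D' X Y Z p - torsion3 g D X Y Z p" for X Y Z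
    by (simp add: a_def torsion3_def torsion_def ip_def gs)
  have 2: "a X Y Z - a Y X Z = - (a X Z Y - a Z X Y)" if "vector_field X" "vector_field Y" "vector_field Z" for X Y Z
  proof -
    have "torsion3 g D X Z Y p = - torsion3 g D X Y Z p" "torsion3 g D' X Z Y p = - torsion3 g D' X Y Z p"
      using T that unfolding skew_torsion_def by metis+
    then show ?thesis unfolding t by simp
  qed
  have 3: "a Y X Z = - a Z X Y" if "vector_field X" "vector_field Y" "vector_field Z" for X Y Z
    using 1[OF that] 2[OF that] by simp
  show "g (D' X Y p - D X Y p) (Z p) = - g (D' X Z p - D X Z p) (Y p)"
    "g (D' X Y p - D X Y p) (Z p) = - g (D' Y X p - D Y X p) (Z p)"
    using 1[OF X Y Z] 3[OF X Y Z] 1[OF Z X Y] 1[OF Y X Z] 3[OF Y X Z] 1[OF Z Y X] 3[OF Y Z X] 3[OF X Z Y] 1[OF Y Z X] 1[OF X Z Y]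
    unfolding a_def[symmetric] by linarith+
qed

lemma connection_vector_field:
  "metric_connection g D \<Longrightarrow> vector_field X \<Longrightarrow> vector_field Y \<Longrightarrow> vector_field (D X Y)"
  by (auto simp: metric_connection_def connection_def)

text \<open>The difference of the derivatives is itself a vector field, so it may serve as Z, and
  definiteness of the metric applies.\<close>

lemma connection_eqI:
  assumes D: "metric_connection g D" "metric_connection g D'" and pos: "\<And>x. g x x = 0 \<Longrightarrow> x = 0"
    and X: "vector_field X" and Y: "vector_field Y"
    and a: "\<And>Z p. vector_field Z \<Longrightarrow> g (D' X Y p - D X Y p) (Z p) = 0"
  shows "D' X Y = D X Y"
proof
  fix p
  have "vector_field (\<lambda>p. D' X Y p - D X Y p)"
    by (intro vector_field_diff connection_vector_field[OF D(1)] connection_vector_field[OF D(2)] X Y)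
  from a[OF this, of p] show "D' X Y p = D X Y p"
    using pos by fastforce
qed

lemma levi_civita_skew_torsion:
  assumes "levi_civita g D" and g: "bounded_bilinear g"
  shows "skew_torsion g D"
  using assms(1) bounded_bilinear.zero_left[OF g]
  by (auto simp: skew_torsion_def levi_civita_def torsion3_def ip_def)

text \<open>Vanishing torsion makes the difference symmetric in X and Y, whereas it is also skew in
  them.\<close>

lemma levi_civita_unique:
  assumes D: "levi_civita g D" "levi_civita g D'" and g: "bounded_bilinear g" and sym: "\<And>x y. g x y = g y x"
    and pos: "\<And>x. g x x = 0 \<Longrightarrow> x = 0"
    and X: "vector_field X" and Y: "vector_field Y"
  shows "D' X Y = D X Y"
proof (rule connection_eqI[OF _ _ pos X Y])
  show m: "metric_connection g D" "metric_connection g D'" using D by (auto simp: levi_civita_def)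
  fix Z p
  assume Z: "vector_field Z"
  note T = levi_civita_skew_torsion[OF D(1) g] levi_civita_skew_torsion[OF D(2) g]
  have "torsion D X Y p = 0" "torsion D' X Y p = 0"
    using D X Y by (auto simp: levi_civita_def)
  then have "D' X Y p - D X Y p = D' Y X p - D Y X p"
    by (simp add: torsion_def algebra_simps)
  then show "g (D' X Y p - D X Y p) (Z p) = 0"
    using metric_connection_diff_skew(2)[OF m g sym T X Y Z, of p] by simp
qed

subsection \<open>The metrics\<close>

lemma gmet_sym: "gmet \<alpha> \<beta> \<gamma> x y = gmet \<alpha> \<beta> \<gamma> y x"
  by (simp add: gmet_def algebra_simps)

lemma bounded_bilinear_gmet: "bounded_bilinear (gmet \<alpha> \<beta> \<gamma>)"
proof -
  have "bilinear (gmet \<alpha> \<beta> \<gamma>)"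
    unfolding bilinear_def by (auto intro!: linearI simp: gmet_def algebra_simps)
  then show ?thesis using bilinear_conv_bounded_bilinear by blast
qed

text \<open>This is -E_23 + eps E_45, so that one argument covers both signs. No normalisation
  appears because the two basis vectors of each plane have equal length.\<close>

definition phi_eps :: "real \<Rightarrow> real^5 \<Rightarrow> real^5" where
  "phi_eps \<epsilon> x = v5 0 (x$3) (- x$2) (- \<epsilon> * x$5) (\<epsilon> * x$4)"

text \<open>The connection form of the characteristic connection is \<open>Lc\<close> with \<open>k = 2 \<alpha> / (5 \<beta>) - 2\<close> and
  \<open>l = 1 - \<alpha> / (5 \<gamma>)\<close>, and \<open>Lg\<close> is that of the Levi-Civita connection for the same \<open>k\<close>, \<open>l\<close>.\<close>

definition Lc :: "real \<Rightarrow> real \<Rightarrow> real^5 \<Rightarrow> real^5 \<Rightarrow> real^5" where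
  "Lc k l x y = v5 0 (- k * x$1 * y$3) (k * x$1 * y$2) (- l * x$1 * y$5) (l * x$1 * y$4)"

definition Lg :: "real \<Rightarrow> real \<Rightarrow> real^5 \<Rightarrow> real^5 \<Rightarrow> real^5" where
  "Lg k l x y = (1 / 2) *\<^sub>R (Lc k l x y + Lc k l y x + br x y)"

lemma equivariant2_Lc: "equivariant2 (Lc k l)"
proof -
  have "bilinear (Lc k l)"
    unfolding bilinear_def Lc_def by (auto intro!: linearI simp: vec5_eq_iff algebra_simps)
  moreover have "Lc k l (isot t x) (isot t y) = isot t (Lc k l x y)" for t x y
    unfolding Lc_def by (simp add: isot_eq vec5_eq_iff) (simp add: algebra_simps)
  ultimately show ?thesis
    using bilinear_conv_bounded_bilinear by (auto simp: equivariant2_def)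
qed

lemma equivariant2_Lg: "equivariant2 (Lg k l)"
proof -
  let ?L = "Lc k l"
  have B: "bounded_bilinear ?L" and e: "?L (isot t x) (isot t y) = isot t (?L x y)" for t x y
    using equivariant2_Lc by (auto simp: equivariant2_def)
  note bl = bounded_bilinear.add_left[OF B] bounded_bilinear.add_right[OF B]
    bounded_bilinear.scaleR_left[OF B] bounded_bilinear.scaleR_right[OF B]
    bounded_bilinear.add_left[OF bounded_bilinear_br] bounded_bilinear.add_right[OF bounded_bilinear_br]
    bounded_bilinear.scaleR_left[OF bounded_bilinear_br] bounded_bilinear.scaleR_right[OF bounded_bilinear_br]
  have "bilinear (Lg k l)"
    unfolding bilinear_def by (auto intro!: linearI simp: Lg_def bl algebra_simps)
  moreover have "Lg k l (isot t x) (isot t y) = isot t (Lg k l x y)" for t x y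
    by (simp add: Lg_def e br_isot linear_add[OF linear_isot] linear_scale[OF linear_isot])
  ultimately show ?thesis
    using bilinear_conv_bounded_bilinear by (auto simp: equivariant2_def)
qed

lemma equivariant_phi_eps: "equivariant (phi_eps \<epsilon>)"
  unfolding equivariant_def
  by (auto intro!: linearI simp: phi_eps_def isot_eq vec5_eq_iff algebra_simps)

subsection \<open>Invariant vectors and endomorphisms\<close>

lemma isot_special:
  "isot pi x = v5 (x$1) (- x$2) (- x$3) (x$4) (x$5)"
  "isot (pi / 2) x = v5 (x$1) (- x$3) (x$2) (- x$4) (- x$5)"
  "isot (pi / 4) x = v5 (x$1) (sqrt 2 / 2 * x$2 - sqrt 2 / 2 * x$3) (sqrt 2 / 2 * x$2 + sqrt 2 / 2 * x$3) (- x$5) (x$4)"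
  by (simp_all add: isot_eq cos_45 sin_45)

text \<open>Invariance under the rotations by \<open>\<pi>\<close>, \<open>\<pi>/2\<close> and \<open>\<pi>/4\<close> already forces a block form.\<close>

lemma invariant_vector:
  assumes "\<And>t. isot t u = u"
  obtains k where "u = v5 k 0 0 0 0"
proof -
  have "u = v5 (u$1) 0 0 0 0"
    using assms[of pi] assms[of "pi/2"] unfolding isot_special by (simp add: vec5_eq_iff)
  then show thesis by (rule that)
qed

text \<open>Schur's lemma: the line and the two planes have the weights 0, 1 and 2 and are pairwise
  inequivalent. On a plane, the maps commuting with rotations are p + q J with J the rotation by a
  right angle.\<close>

lemma equivariant_endo:
  assumes P: "equivariant P"
  obtains a p q r s where
    "\<And>x. P x = v5 (a * x$1) (p * x$2 - q * x$3) (q * x$2 + p * x$3) (r * x$4 - s * x$5) (s * x$4 + r * x$5)"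
proof -
  have l: "linear P" and c: "P (isot t x) = isot t (P x)" for t x
    using P by (auto simp: equivariant_def)
  define b1 b2 b3 b4 b5 where b: "b1 = v5 1 0 0 0 0" "b2 = v5 0 1 0 0 0" "b3 = v5 0 0 1 0 0" "b4 = v5 0 0 0 1 0" "b5 = v5 0 0 0 0 1"
  have "isot t (P b1) = P b1" for t
    unfolding c[symmetric] by (simp add: isot_eq b)
  then obtain a where P1: "P b1 = v5 a 0 0 0 0"
    by (rule invariant_vector)
  \<comment> \<open>The sign changes force \<open>P b2\<close> into the plane (2,3) and
    \<open>P b4\<close> into the plane (4,5). As \<open>b3\<close> and \<open>b5\<close> are rotated
    copies of \<open>b2\<close> and \<open>b4\<close>, these two values determine both
    blocks.\<close>
  have "isot pi b2 = - b2" "isot (pi / 2) b2 = b3" "isot (pi / 2) b4 = - b4" "isot (pi / 4) b4 = b5"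
    by (simp_all add: isot_special b vec5_eq_iff)
  then have "isot pi (P b2) = - P b2" and P3: "P b3 = isot (pi / 2) (P b2)" and "isot (pi / 2) (P b4) = - P b4"
    and P5: "P b5 = isot (pi / 4) (P b4)"
    unfolding c[symmetric] by (simp_all add: linear_neg[OF l])
  then have "(- P b2) $ 1 = P b2 $ 1" "(- P b2) $ 4 = P b2 $ 4" "(- P b2) $ 5 = P b2 $ 5"
    "(- P b4) $ 1 = P b4 $ 1" "(- P b4) $ 2 = - P b4 $ 3" "(- P b4) $ 3 = P b4 $ 2"
    by (metis isot_special(1,2) v5_nth)+
  then have z: "P b2 $ 1 = 0" "P b2 $ 4 = 0" "P b2 $ 5 = 0" "P b4 $ 1 = 0" "P b4 $ 2 = 0" "P b4 $ 3 = 0"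
    unfolding vector_uminus_component by linarith+
  have "P x = v5 (a * x$1) (P b2 $ 2 * x$2 - P b2 $ 3 * x$3) (P b2 $ 3 * x$2 + P b2 $ 2 * x$3)
      (P b4 $ 4 * x$4 - P b4 $ 5 * x$5) (P b4 $ 5 * x$4 + P b4 $ 4 * x$5)" for x
  proof -
    have "x = x$1 *\<^sub>R b1 + x$2 *\<^sub>R b2 + x$3 *\<^sub>R b3 + x$4 *\<^sub>R b4 + x$5 *\<^sub>R b5"
      by (simp add: b vec5_eq_iff)
    then have "P x = P (x$1 *\<^sub>R b1 + x$2 *\<^sub>R b2 + x$3 *\<^sub>R b3 + x$4 *\<^sub>R b4 + x$5 *\<^sub>R b5)"
      by (rule arg_cong)
    also have "\<dots> = x$1 *\<^sub>R P b1 + x$2 *\<^sub>R P b2 + x$3 *\<^sub>R P b3 + x$4 *\<^sub>R P b4 + x$5 *\<^sub>R P b5"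
      by (simp only: linear_add[OF l] linear_scale[OF l])
    finally show ?thesis
      unfolding P1 P3 P5 isot_special using z by (simp add: vec5_eq_iff)
  qed
  then show thesis by (rule that)
qed

lemma connection_add_left:
  "connection D \<Longrightarrow> vector_field X \<Longrightarrow> vector_field X' \<Longrightarrow> vector_field Y \<Longrightarrow>
    D (\<lambda>p. X p + X' p) Y = (\<lambda>p. D X Y p + D X' Y p)"
  unfolding connection_def by blast

lemma connection_scaleR_left:
  "connection D \<Longrightarrow> scalar_field f \<Longrightarrow> vector_field X \<Longrightarrow> vector_field Y \<Longrightarrow>
    D (\<lambda>p. f p *\<^sub>R X p) Y = (\<lambda>p. f p *\<^sub>R D X Y p)"
  unfolding connection_def by blast

lemma left_invariant_const: "left_invariant T \<Longrightarrow> T p = T gunit"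
  unfolding left_invariant_def by (metis gmult_gunit(1))

subsection \<open>The Lie algebra of the irreducible SO(3) and its cubic invariant\<close>

lemma Em_onb:
  "a \<noteq> b \<Longrightarrow> gmet \<alpha> \<beta> \<gamma> (onb \<alpha> \<beta> \<gamma> a) (onb \<alpha> \<beta> \<gamma> b) = 0"
  by (auto simp: gmet_def onb_def axis_def)

definition so3_elem :: "real \<Rightarrow> real \<Rightarrow> real \<Rightarrow> real \<Rightarrow> real \<Rightarrow> real \<Rightarrow> real^5 \<Rightarrow> real^5" where
  "so3_elem \<alpha> \<beta> \<gamma> a b c x = (let E = Em \<alpha> \<beta> \<gamma> in
     a *\<^sub>R (sqrt 3 *\<^sub>R E 1 3 x + E 4 2 x + E 5 3 x) + b *\<^sub>R (sqrt 3 *\<^sub>R E 2 1 x + E 3 4 x + E 5 2 x)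
       + c *\<^sub>R (E 2 3 x + 2 *\<^sub>R E 4 5 x))"

lemma so3ir_eq: "so3ir \<alpha> \<beta> \<gamma> = {so3_elem \<alpha> \<beta> \<gamma> a b c | a b c. True}"
  unfolding so3ir_def so3_elem_def Let_def by (simp add: fun_eq_iff)

lemma so3_elem_diff:
  "so3_elem \<alpha> \<beta> \<gamma> a b c x - so3_elem \<alpha> \<beta> \<gamma> a' b' c' x = so3_elem \<alpha> \<beta> \<gamma> (a - a') (b - b') (c - c') x"
  by (simp add: so3_elem_def Let_def algebra_simps)

definition cub :: "real \<Rightarrow> real \<Rightarrow> real \<Rightarrow> real \<Rightarrow> real \<Rightarrow> real" where
  "cub a b c d e = a ^ 3 + 3/2 * a * (b\<^sup>2 + c\<^sup>2 - 2 * d\<^sup>2 - 2 * e\<^sup>2)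
     + 3 * sqrt 3 / 2 * (b\<^sup>2 - c\<^sup>2) * e - 3 * sqrt 3 * b * c * d"

text \<open>The differential of \<open>cub\<close> at the unprimed vector v, applied to the primed
  vector w; equivalently 3 Upsilon(v, v, w).\<close>

definition dcub :: "real \<Rightarrow> real \<Rightarrow> real \<Rightarrow> real \<Rightarrow> real \<Rightarrow> real \<Rightarrow> real \<Rightarrow> real \<Rightarrow> real \<Rightarrow> real \<Rightarrow> real" where
  "dcub a b c d e a' b' c' d' e' =
     3 * a\<^sup>2 * a' + 3/2 * (a' * (b\<^sup>2 + c\<^sup>2 - 2 * d\<^sup>2 - 2 * e\<^sup>2))
     + 3 * (a * (b * b' + c * c' - 2 * d * d' - 2 * e * e'))
     + 3/2 * (sqrt 3 * (2 * (b * b' - c * c') * e + (b\<^sup>2 - c\<^sup>2) * e'))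
     - 3 * (sqrt 3 * (b' * c * d + b * c' * d + b * c * d'))"

lemma has_derivative_cub:
  assumes "(f1 has_derivative f1') (at x)" "(f2 has_derivative f2') (at x)" "(f3 has_derivative f3') (at x)"
    "(f4 has_derivative f4') (at x)" "(f5 has_derivative f5') (at x)"
  shows "((\<lambda>x. cub (f1 x) (f2 x) (f3 x) (f4 x) (f5 x)) has_derivative
    (\<lambda>h. dcub (f1 x) (f2 x) (f3 x) (f4 x) (f5 x) (f1' h) (f2' h) (f3' h) (f4' h) (f5' h))) (at x)"
  unfolding cub_def
  by (rule has_derivative_eq_rhs, (rule derivative_intros assms)+)
    (simp add: fun_eq_iff dcub_def power2_eq_square field_simps)

lemma cub_polarisation:
  "(cub (a' + a + a) (b' + b + b) (c' + c + c) (d' + d + d) (e' + e + e) - cub (a' + a) (b' + b) (c' + c) (d' + d) (e' + e)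
    - cub (a' + a) (b' + b) (c' + c) (d' + d) (e' + e) - cub (a + a) (b + b) (c + c) (d + d) (e + e)
    + cub a' b' c' d' e' + cub a b c d e + cub a b c d e) / 6 = dcub a b c d e a' b' c' d' e' / 3"
  unfolding cub_def dcub_def power2_eq_square power3_eq_cube by (simp add: field_simps)

text \<open>Euler's identity for a homogeneous cubic.\<close>

lemma dcub_self: "dcub a b c d e a b c d e / 3 = cub a b c d e"
  unfolding cub_def dcub_def power2_eq_square power3_eq_cube by (simp add: field_simps)

lemma dcub_add: "dcub a b c d e (a' + a'') (b' + b'') (c' + c'') (d' + d'') (e' + e'')
    = dcub a b c d e a' b' c' d' e' + dcub a b c d e a'' b'' c'' d'' e''"
  unfolding dcub_def by (simp add: field_simps)

text \<open>With z = b + i c and w = d + i e, the part of \<open>cub\<close> that involves more than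
  a, |z| and |w| is -(3 sqrt 3 / 2) Im(z^2 conj(w)). Rotating z at speed k t and w at speed l t
  turns z^2 conj(w) at speed (2 k - l) t.\<close>

lemma dcub_Lc: "dcub a b c d e 0 (- k * t * c) (k * t * b) (- l * t * e) (l * t * d)
    = - (3 * sqrt 3 * (2 * k - l) * t * (b * c * e + (b\<^sup>2 - c\<^sup>2) * d / 2))"
  unfolding dcub_def power2_eq_square by (simp add: field_simps)

subsection \<open>The orthonormal frames\<close>

context
  fixes \<alpha> \<beta> \<gamma> :: real
  assumes pos: "\<alpha> > 0" "\<beta> > 0" "\<gamma> > 0"
begin

abbreviation (input) g :: "real^5 \<Rightarrow> real^5 \<Rightarrow> real" where "g \<equiv> gmet \<alpha> \<beta> \<gamma>"
abbreviation (input) k0 :: real where "k0 \<equiv> 2 * \<alpha> / (5 * \<beta>) - 2"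
abbreviation (input) l0 :: real where "l0 \<equiv> 1 - \<alpha> / (5 * \<gamma>)"

lemma gmet_pos: "g x x = 0 \<Longrightarrow> x = 0"
proof -
  assume "g x x = 0"
  then have "\<alpha> * (x$1)\<^sup>2 + (\<beta> * (x$2)\<^sup>2 + \<beta> * (x$3)\<^sup>2) + (\<gamma> * (x$4)\<^sup>2 + \<gamma> * (x$5)\<^sup>2) = 0"
    by (simp add: gmet_def power2_eq_square algebra_simps)
  moreover have "0 \<le> \<alpha> * (x$1)\<^sup>2" "0 \<le> \<beta> * (x$2)\<^sup>2" "0 \<le> \<beta> * (x$3)\<^sup>2" "0 \<le> \<gamma> * (x$4)\<^sup>2" "0 \<le> \<gamma> * (x$5)\<^sup>2"
    using pos by simp_all
  ultimately have "\<alpha> * (x$1)\<^sup>2 = 0" "\<beta> * (x$2)\<^sup>2 = 0" "\<beta> * (x$3)\<^sup>2 = 0" "\<gamma> * (x$4)\<^sup>2 = 0" "\<gamma> * (x$5)\<^sup>2 = 0"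
    by linarith+
  then show "x = 0" using pos by (simp add: vec5_eq_iff)
qed

lemma sqrt_mult_self: "sqrt \<alpha> * sqrt \<alpha> = \<alpha>" "sqrt \<beta> * sqrt \<beta> = \<beta>" "sqrt \<gamma> * sqrt \<gamma> = \<gamma>"
  using pos by simp_all

lemma onb_eq: "onb \<alpha> \<beta> \<gamma> 1 = v5 (1 / sqrt \<alpha>) 0 0 0 0" "onb \<alpha> \<beta> \<gamma> 2 = v5 0 (1 / sqrt \<beta>) 0 0 0"
  "onb \<alpha> \<beta> \<gamma> 3 = v5 0 0 (1 / sqrt \<beta>) 0 0" "onb \<alpha> \<beta> \<gamma> 4 = v5 0 0 0 (1 / sqrt \<gamma>) 0"
  "onb \<alpha> \<beta> \<gamma> 5 = v5 0 0 0 0 (1 / sqrt \<gamma>)"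
  by (simp_all add: onb_def axis_def vec5_eq_iff)

lemma gmet_onb: "g x (onb \<alpha> \<beta> \<gamma> 1) = sqrt \<alpha> * x$1" "g x (onb \<alpha> \<beta> \<gamma> 2) = sqrt \<beta> * x$2"
  "g x (onb \<alpha> \<beta> \<gamma> 3) = sqrt \<beta> * x$3" "g x (onb \<alpha> \<beta> \<gamma> 4) = sqrt \<gamma> * x$4" "g x (onb \<alpha> \<beta> \<gamma> 5) = sqrt \<gamma> * x$5"
  unfolding onb_eq using pos
  by (simp_all add: gmet_def divide_simps)

lemma Em_eq: "Em \<alpha> \<beta> \<gamma> 2 3 x = v5 0 (- x$3) (x$2) 0 0" "Em \<alpha> \<beta> \<gamma> 4 5 x = v5 0 0 0 (- x$5) (x$4)"
  unfolding Em_def gmet_onb unfolding onb_eq using pos by (simp_all add: vec5_eq_iff)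

lemma phi_plus_eq: "phi_plus \<alpha> \<beta> \<gamma> = (\<lambda>p. phi_eps 1)" and phi_minus_eq: "phi_minus \<alpha> \<beta> \<gamma> = (\<lambda>p. phi_eps (- 1))"
  by (auto simp: phi_plus_def phi_minus_def phi_eps_def Em_eq vec5_eq_iff fun_eq_iff)

lemma xi0_eq: "xi0 \<alpha> \<beta> \<gamma> = (\<lambda>p. v5 (1 / sqrt \<alpha>) 0 0 0 0)"
  by (simp add: xi0_def onb_eq)

lemma coframe_eq: "coframe \<alpha> \<beta> \<gamma> 1 = (\<lambda>p x. sqrt \<alpha> * x$1)" "coframe \<alpha> \<beta> \<gamma> 2 = (\<lambda>p x. sqrt \<beta> * x$2)"
  "coframe \<alpha> \<beta> \<gamma> 3 = (\<lambda>p x. sqrt \<beta> * x$3)" "coframe \<alpha> \<beta> \<gamma> 4 = (\<lambda>p x. sqrt \<gamma> * x$4)"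
  "coframe \<alpha> \<beta> \<gamma> 5 = (\<lambda>p x. sqrt \<gamma> * x$5)"
  unfolding coframe_def gmet_sym[of _ _ _ "onb _ _ _ _"] gmet_onb by simp_all

lemma eta0_eq: "eta0 \<alpha> \<beta> \<gamma> = (\<lambda>p x. sqrt \<alpha> * x$1)"
  by (simp add: eta0_def coframe_eq)

lemma bounded_linear_eta0: "bounded_linear (\<lambda>x::real^5. sqrt \<alpha> * x$1)"
  unfolding linear_conv_bounded_linear[symmetric] by (auto intro!: linearI simp: algebra_simps)

subsection \<open>The normal almost contact metric structures\<close>

lemma vector_field_xi0: "vector_field (xi0 \<alpha> \<beta> \<gamma>)"
  by (simp add: vector_field_def xi0_eq smooth_const isot_eq vec5_eq_iff)

lemma invariant_acm_phi_eps:
  assumes \<epsilon>: "\<epsilon> * \<epsilon> = 1"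
  shows "invariant_acm g (xi0 \<alpha> \<beta> \<gamma>) (eta0 \<alpha> \<beta> \<gamma>) (\<lambda>p. phi_eps \<epsilon>)"
proof -
  have "one_form (eta0 \<alpha> \<beta> \<gamma>)"
    unfolding one_form_def eta0_eq using bounded_linear.linear[OF bounded_linear_eta0]
    by (simp add: smooth_const isot_eq)
  moreover have "endo_field (\<lambda>p. phi_eps \<epsilon>)"
    using equivariant_phi_eps[of \<epsilon>] by (simp add: endo_field_def equivariant_def smooth_const)
  moreover have "eta0 \<alpha> \<beta> \<gamma> p x = g (xi0 \<alpha> \<beta> \<gamma> p) x" for p x
    by (simp add: eta0_def coframe_def xi0_def)
  moreover have "phi_eps \<epsilon> (phi_eps \<epsilon> x) = - x + eta0 \<alpha> \<beta> \<gamma> p x *\<^sub>R xi0 \<alpha> \<beta> \<gamma> p" for p x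
    using pos \<epsilon> by (simp add: phi_eps_def eta0_eq xi0_eq vec5_eq_iff mult.assoc[symmetric])
  moreover have "g (phi_eps \<epsilon> x) (phi_eps \<epsilon> y) = g x y - eta0 \<alpha> \<beta> \<gamma> p x * eta0 \<alpha> \<beta> \<gamma> p y" for p x y
  proof -
    have e: "(\<epsilon> * u) * (\<epsilon> * v) = u * v" "(- \<epsilon> * u) * (- \<epsilon> * v) = u * v" for u v using \<epsilon> by algebra+
    have "sqrt \<alpha> * x$1 * (sqrt \<alpha> * y$1) = (sqrt \<alpha> * sqrt \<alpha>) * x$1 * y$1"
      by (simp only: mult_ac)
    also have "\<dots> = \<alpha> * x$1 * y$1" by (simp only: sqrt_mult_self)
    finally show ?thesis
      by (simp only: phi_eps_def eta0_eq gmet_def v5_nth e) (simp add: algebra_simps)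
  qed
  ultimately show ?thesis
    by (simp add: invariant_acm_def almost_contact_metric_def vector_field_xi0)
      (simp add: left_invariant_def xi0_eq eta0_eq)
qed

lemma normal_phi_eps:
  assumes \<epsilon>: "\<epsilon> * \<epsilon> = 1"
  shows "normal_acm (xi0 \<alpha> \<beta> \<gamma>) (eta0 \<alpha> \<beta> \<gamma>) (\<lambda>p. phi_eps \<epsilon>)"
  unfolding normal_acm_def
proof (intro allI impI)
  fix X Y
  assume XY: "vector_field X" "vector_field Y"
  have e: "\<epsilon> * (\<epsilon> * u) = u" for u using \<epsilon> by (simp add: mult.assoc[symmetric])
  have s: "sqrt \<alpha> * u / sqrt \<alpha> = u" for u using pos by simp
  show "nijenhuis (xi0 \<alpha> \<beta> \<gamma>) (eta0 \<alpha> \<beta> \<gamma>) (\<lambda>p. phi_eps \<epsilon>) X Y = (\<lambda>p. 0)"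
    unfolding eta0_eq nijenhuis_const[OF equivariant_phi_eps bounded_linear_eta0 XY] xi0_eq
    by (rule ext) (simp add: phi_eps_def br_def vec5_eq_iff s e algebra_simps)
qed

lemma fundamental_form_phi_eps:
  "fundamental_form g (\<lambda>p. phi_eps \<epsilon>) = (\<lambda>X Y p. g (X p) (phi_eps \<epsilon> (Y p)))"
  by (simp add: fundamental_form_def ip_def act_def fun_eq_iff)

lemma closed_phi_eps: "closed_fundamental_form g (\<lambda>p. phi_eps \<epsilon>)"
  unfolding closed_fundamental_form_def fundamental_form_phi_eps
proof (intro allI impI)
  fix X Y Z
  assume XYZ: "vector_field X" "vector_field Y" "vector_field Z"
  have "bilinear (\<lambda>x y. g x (phi_eps \<epsilon> y))"
    unfolding bilinear_def by (auto intro!: linearI simp: gmet_def phi_eps_def algebra_simps)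
  then have B: "bounded_bilinear (\<lambda>x y. g x (phi_eps \<epsilon> y))"
    using bilinear_conv_bounded_bilinear by blast
  have "g x (phi_eps \<epsilon> y) = - g y (phi_eps \<epsilon> x)" for x y
    by (simp add: gmet_def phi_eps_def algebra_simps)
  from ext_deriv2_const[OF B this XYZ]
  show "ext_deriv2 (\<lambda>X Y p. g (X p) (phi_eps \<epsilon> (Y p))) X Y Z = (\<lambda>p. 0)"
    by (simp add: gmet_def phi_eps_def br_def fun_eq_iff) (simp add: algebra_simps)
qed

text \<open>Invariant tensors are determined by their value at the unit, which leaves linear algebra
  on m. The signs express that the structures are counted up to replacing (xi, eta) and phi by their
  negatives.\<close>

lemma invariant_acm_classification:
  assumes acm: "invariant_acm (gmet \<alpha> \<beta> \<gamma>) \<xi> \<eta> \<phi>"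
  shows "\<exists>\<sigma> \<in> {1, -1}. \<exists>\<tau> \<in> {1, -1}. \<exists>\<psi> \<in> {phi_plus \<alpha> \<beta> \<gamma>, phi_minus \<alpha> \<beta> \<gamma>}.
             \<xi> = (\<lambda>p. \<sigma> *\<^sub>R xi0 \<alpha> \<beta> \<gamma> p)
             \<and> \<eta> = (\<lambda>p x. \<sigma> * eta0 \<alpha> \<beta> \<gamma> p x)
             \<and> \<phi> = (\<lambda>p x. \<tau> *\<^sub>R \<psi> p x)"
proof -
  let ?g = "gmet \<alpha> \<beta> \<gamma>"
  have vf: "vector_field \<xi>" and ef: "endo_field \<phi>" and \<eta>: "\<And>p x. \<eta> p x = ?g (\<xi> p) x"
    and sq: "\<And>p x. \<phi> p (\<phi> p x) = - x + \<eta> p x *\<^sub>R \<xi> p"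
    and iso: "\<And>p x y. ?g (\<phi> p x) (\<phi> p y) = ?g x y - \<eta> p x * \<eta> p y"
    and inv: "left_invariant \<xi>" "left_invariant \<phi>"
    using acm by (auto simp: invariant_acm_def almost_contact_metric_def)
  define u P where "u = \<xi> gunit" and "P = \<phi> gunit"
  have \<xi>u: "\<xi> p = u" and \<phi>P: "\<phi> p = P" for p
    unfolding u_def P_def using left_invariant_const inv by blast+
  have "isot t u = u" for t
    using vector_fieldD(2)[OF vf, of gunit "- t"] by (simp add: \<xi>u)
  then obtain k where k: "u = v5 k 0 0 0 0" by (rule invariant_vector)
  have "equivariant P"
    unfolding equivariant_def
  proof (intro conjI allI)
    show "linear P" using ef by (auto simp: endo_field_def P_def)
    fix t x
    have "P x = isot (- t) (P (isot t x))"
      using ef unfolding endo_field_def \<phi>P by blast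
    then show "P (isot t x) = isot t (P x)" by (metis isot_inverse(1))
  qed
  then obtain a p q r s where P: "\<And>x. P x = v5 (a * x$1) (p * x$2 - q * x$3) (q * x$2 + p * x$3) (r * x$4 - s * x$5) (s * x$4 + r * x$5)"
    using equivariant_endo by blast
  note sq' = sq[of gunit, unfolded \<phi>P \<xi>u \<eta> P k] and iso' = iso[of gunit, unfolded \<phi>P \<xi>u \<eta> P k]
  \<comment> \<open>In the direction e_1 the formula for the square of phi gives a^2 = alpha k^2 -
    1, and compatibility with the metric gives a^2 = 1 - alpha k^2. Hence a = 0.\<close>
  have 1: "a * a = - 1 + \<alpha> * k * k" "\<alpha> * a * a = \<alpha> - \<alpha> * k * (\<alpha> * k)"
    using sq'[of "v5 1 0 0 0 0"] iso'[of "v5 1 0 0 0 0" "v5 1 0 0 0 0"] by (simp_all add: vec5_eq_iff gmet_def)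
  have 2: "p * p - q * q = - 1" "q * p + p * q = 0"
    using sq'[of "v5 0 1 0 0 0"] by (simp_all add: vec5_eq_iff gmet_def)
  have 3: "r * r - s * s = - 1" "s * r + r * s = 0"
    using sq'[of "v5 0 0 0 1 0"] by (simp_all add: vec5_eq_iff gmet_def)
  have "\<alpha> * (a * a) = \<alpha> * (1 - \<alpha> * k * k)"
    using 1(2) by (simp add: algebra_simps)
  then have "a * a = 1 - \<alpha> * k * k" using pos by simp
  then have "a * a = 0" and "\<alpha> * k * k = 1"
    using 1(1) by linarith+
  then have "a = 0" by simp
  have "(sqrt \<alpha> * k) * (sqrt \<alpha> * k) = (sqrt \<alpha> * sqrt \<alpha>) * k * k"
    by (simp only: mult_ac)
  then have "(sqrt \<alpha> * k) * (sqrt \<alpha> * k) = 1"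
    by (simp only: sqrt_mult_self(1) \<open>\<alpha> * k * k = 1\<close>)
  then obtain \<sigma> where \<sigma>: "\<sigma> \<in> {1, -1}" "sqrt \<alpha> * k = \<sigma>"
    using square_eq_1_iff by blast
  then have k\<sigma>: "k = \<sigma> / sqrt \<alpha>" using pos by (auto simp: field_simps)
  \<comment> \<open>On a plane, p + q J squares to -1 only if it is J or -J.\<close>
  have J: "p = 0 \<and> q \<in> {1, -1}" if "p * p - q * q = - 1" "q * p + p * q = 0" for p q :: real
  proof -
    have "q * p = 0" using that(2) by (simp add: mult.commute)
    moreover have "q \<noteq> 0"
    proof
      assume "q = 0"
      then have "p * p = - 1" using that(1) by simp
      then show False using zero_le_square[of p] by linarith
    qed
    ultimately have "p = 0" by simp
    then show ?thesis using that(1) square_eq_1_iff[of q] by auto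
  qed
  have p: "p = 0" "q \<in> {1, -1}" and r: "r = 0" "s \<in> {1, -1}" using J[OF 2] J[OF 3] by auto
  \<comment> \<open>The factor - q normalises the block on the plane (2,3) to -E_23; the relative
    sign of the two blocks is then - q s.\<close>
  have \<phi>eq: "\<phi> = (\<lambda>p x. (- q) *\<^sub>R phi_eps (- q * s) x)"
  proof (intro ext)
    fix b x
    have "q * q = 1" using p(2) by auto
    then show "\<phi> b x = (- q) *\<^sub>R phi_eps (- q * s) x"
      unfolding \<phi>P P by (simp add: phi_eps_def vec5_eq_iff p(1) r(1) \<open>a = 0\<close> mult.assoc[symmetric])
  qed
  have "- q * s = 1 \<or> - q * s = - 1" using p(2) r(2) by auto
  then obtain \<psi> where \<psi>: "\<psi> \<in> {phi_plus \<alpha> \<beta> \<gamma>, phi_minus \<alpha> \<beta> \<gamma>}" "\<psi> = (\<lambda>p. phi_eps (- q * s))"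
    unfolding phi_plus_eq phi_minus_eq by fastforce
  have \<xi>eq: "\<xi> = (\<lambda>p. \<sigma> *\<^sub>R xi0 \<alpha> \<beta> \<gamma> p)"
    by (rule ext) (simp add: \<xi>u k k\<sigma> xi0_eq vec5_eq_iff)
  have \<eta>eq: "\<eta> = (\<lambda>p x. \<sigma> * eta0 \<alpha> \<beta> \<gamma> p x)"
  proof (intro ext)
    fix b x
    have "\<alpha> * k = (sqrt \<alpha> * sqrt \<alpha>) * k" by (simp only: sqrt_mult_self(1))
    also have "\<dots> = sqrt \<alpha> * \<sigma>" by (simp only: mult.assoc \<sigma>(2))
    finally have "\<alpha> * k = sqrt \<alpha> * \<sigma>" .
    then show "\<eta> b x = \<sigma> * eta0 \<alpha> \<beta> \<gamma> b x"
      by (simp add: \<eta> \<xi>u k eta0_eq gmet_def mult.commute)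
  qed
  have q': "- q \<in> {1, -1}" using p(2) by auto
  have "\<phi> = (\<lambda>p x. (- q) *\<^sub>R \<psi> p x)" by (simp only: \<phi>eq \<psi>(2))
  with \<xi>eq \<eta>eq show ?thesis
    by (intro bexI[OF _ \<sigma>(1)] bexI[OF _ q'] bexI[OF _ \<psi>(1)] conjI)
qed

subsection \<open>The characteristic connection of the almost contact metric structures\<close>

lemma metric_connection_Lc: "metric_connection g (cconn (Lc k l))"
  by (rule metric_connection_cconn[OF equivariant2_Lc bounded_bilinear_gmet])
    (simp add: gmet_def Lc_def algebra_simps)

text \<open>The terms with z_1 come from \<open>br\<close> alone and have the coefficients 2 alpha /
  5 and - alpha / 5. Skewness demands the same coefficients in the terms with x_1 and y_1, that is,
  beta k + 2 beta = 2 alpha / 5 and gamma l - gamma = - alpha / 5. These equations are the origin of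
  \<open>k0\<close> and \<open>l0\<close>.\<close>

lemma torsion_Lc:
  "g (Lc k0 l0 x y - Lc k0 l0 y x - br x y) z =
    2 * \<alpha> / 5 * (x$1 * (y$2 * z$3 - y$3 * z$2) - y$1 * (x$2 * z$3 - x$3 * z$2) + z$1 * (x$2 * y$3 - x$3 * y$2))
    - \<alpha> / 5 * (x$1 * (y$4 * z$5 - y$5 * z$4) - y$1 * (x$4 * z$5 - x$5 * z$4) + z$1 * (x$4 * y$5 - x$5 * y$4))"
proof -
  define k l where "k = k0" and "l = l0"
  have kl: "\<beta> * k = 2 * \<alpha> / 5 - 2 * \<beta>" "\<gamma> * l = \<gamma> - \<alpha> / 5"
    using pos by (simp_all add: k_def l_def field_simps)
  have "g (Lc k l x y - Lc k l y x - br x y) z =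
     \<alpha> * (2 * (x$2 * y$3 - x$3 * y$2) / 5 - (x$4 * y$5 - x$5 * y$4) / 5) * z$1
     + (\<beta> * k + 2 * \<beta>) * (- (x$1 * y$3 - x$3 * y$1) * z$2 + (x$1 * y$2 - x$2 * y$1) * z$3)
     + (\<gamma> * l - \<gamma>) * (- (x$1 * y$5 - x$5 * y$1) * z$4 + (x$1 * y$4 - x$4 * y$1) * z$5)"
    by (simp add: gmet_def Lc_def br_def algebra_simps)
  then show ?thesis
    unfolding kl k_def[symmetric] l_def[symmetric] by (simp add: field_simps)
qed

lemma skew_torsion_Lc: "skew_torsion g (cconn (Lc k0 l0))"
  unfolding skew_torsion_def torsion3_def
  by (intro allI impI conjI; simp only: torsion_cconn ip_def torsion_Lc fun_eq_iff; intro allI; simp add: algebra_simps)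

lemma characteristic_connection_acm_Lc:
  "characteristic_connection_acm g (xi0 \<alpha> \<beta> \<gamma>) (eta0 \<alpha> \<beta> \<gamma>) (\<lambda>p. phi_eps \<epsilon>) (cconn (Lc k0 l0))"
  unfolding characteristic_connection_acm_def
proof (intro conjI allI impI metric_connection_Lc skew_torsion_Lc)
  fix X Y
  assume XY: "vector_field X" "vector_field Y"
  have l: "bounded_linear (phi_eps \<epsilon>)"
    using equivariant_bounded_linear[OF equivariant_phi_eps] .
  \<comment> \<open>Both maps are combinations of E_23 and E_45, which commute.\<close>
  have c: "Lc k l x (phi_eps \<epsilon> y) = phi_eps \<epsilon> (Lc k l x y)" for k l x y
    by (simp add: Lc_def phi_eps_def vec5_eq_iff)
  show "cconn (Lc k0 l0) X (act (\<lambda>p. phi_eps \<epsilon>) Y) = act (\<lambda>p. phi_eps \<epsilon>) (cconn (Lc k0 l0) X Y)"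
    using along_linear_comp[OF vector_fieldD(1)[OF XY(2)] l]
    by (simp add: cconn_def act_def fun_eq_iff c linear_add[OF bounded_linear.linear[OF l]])
  show "along X (ev1 (eta0 \<alpha> \<beta> \<gamma>) Y) = ev1 (eta0 \<alpha> \<beta> \<gamma>) (cconn (Lc k0 l0) X Y)"
    using along_linear_comp[OF vector_fieldD(1)[OF XY(2)] bounded_linear_eta0]
    by (simp add: cconn_def ev1_def fun_eq_iff eta0_eq Lc_def)
qed (simp add: cconn_def xi0_eq fun_eq_iff Lc_def vec5_eq_iff)

text \<open>For the difference \<open>a\<close> of two characteristic connections, moving \<open>\<phi>\<close> from one slot of the
  3-form \<open>a\<close> to another changes the sign; going round all three slots gives \<open>a(\<phi> X, Y, Z) = 0\<close>.\<close>

lemma characteristic_connection_acm_unique: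
  assumes D: "characteristic_connection_acm g (xi0 \<alpha> \<beta> \<gamma>) (eta0 \<alpha> \<beta> \<gamma>) (\<lambda>p. phi_eps \<epsilon>) D"
    "characteristic_connection_acm g (xi0 \<alpha> \<beta> \<gamma>) (eta0 \<alpha> \<beta> \<gamma>) (\<lambda>p. phi_eps \<epsilon>) D'"
    and \<epsilon>: "\<epsilon> * \<epsilon> = 1" and X: "vector_field X" and Y: "vector_field Y"
  shows "D' X Y = D X Y"
proof -
  have m: "metric_connection g D" "metric_connection g D'" and T: "skew_torsion g D" "skew_torsion g D'"
    using D by (auto simp: characteristic_connection_acm_def)
  note c1 = metric_connection_diff_skew(1)[OF m bounded_bilinear_gmet gmet_sym T]
  note c2 = metric_connection_diff_skew(2)[OF m bounded_bilinear_gmet gmet_sym T]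
  let ?\<xi> = "xi0 \<alpha> \<beta> \<gamma>"
  let ?\<phi> = "\<lambda>X p. phi_eps \<epsilon> (X p)"
  have \<xi>: "vector_field ?\<xi>" by (rule vector_field_xi0)
  have vp: "vector_field (?\<phi> X)" if "vector_field X" for X
    by (rule vector_field_equivariant[OF equivariant_phi_eps that])
  show ?thesis
  proof (rule connection_eqI[OF m gmet_pos X Y])
    fix Z p
    assume Z: "vector_field Z"
    define a where "a X Y Z = g (D' X Y p - D X Y p) (Z p)" for X Y Z
    have s1: "a X Y Z = - a X Z Y" and s2: "a X Y Z = - a Y X Z"
      if "vector_field X" "vector_field Y" "vector_field Z" for X Y Z
      unfolding a_def using c1[OF that] c2[OF that] by blast+
    have a\<xi>: "a ?\<xi> Y Z = 0" if "vector_field Y" "vector_field Z" for Y Z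
    proof -
      have "D Y ?\<xi> = (\<lambda>p. 0)" "D' Y ?\<xi> = (\<lambda>p. 0)"
        using D that unfolding characteristic_connection_acm_def by blast+
      then have "a Y ?\<xi> Z = 0" by (simp add: a_def gmet_def)
      then show ?thesis using s2[OF \<xi> that] by simp
    qed
    have g\<phi>: "g (phi_eps \<epsilon> x) y = - g x (phi_eps \<epsilon> y)" for x y
      by (simp add: gmet_def phi_eps_def algebra_simps)
    have a\<phi>: "a X (?\<phi> Y) Z = - a X Y (?\<phi> Z)" if "vector_field X" "vector_field Y" "vector_field Z" for X Y Z
    proof -
      have e: "D X (act (\<lambda>p. phi_eps \<epsilon>) Y) = act (\<lambda>p. phi_eps \<epsilon>) (D X Y)"
        "D' X (act (\<lambda>p. phi_eps \<epsilon>) Y) = act (\<lambda>p. phi_eps \<epsilon>) (D' X Y)"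
        using D that unfolding characteristic_connection_acm_def by blast+
      have l: "linear (phi_eps \<epsilon>)" using equivariant_phi_eps by (simp add: equivariant_def)
      show ?thesis
        using e unfolding a_def act_def by (simp add: linear_diff[OF l, symmetric] g\<phi>)
    qed
    have E: "a (?\<phi> X) Y Z = a X (?\<phi> Y) Z" if "vector_field X" "vector_field Y" "vector_field Z" for X Y Z
      using s2[OF vp[OF that(1)] that(2,3)] a\<phi>[OF that(2,1,3)] s2[OF that(1,2) vp[OF that(3)]] a\<phi>[OF that]
      by linarith
    have 0: "a (?\<phi> X) Y Z = 0" if "vector_field X" "vector_field Y" "vector_field Z" for X Y Z
      using s1[OF vp[OF that(1)] that(2,3)] E[OF that(1,3,2)] s1[OF that(1) vp[OF that(3)] that(2)] a\<phi>[OF that] E[OF that]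
      by linarith
    have f: "scalar_field (\<lambda>p. sqrt \<alpha> * X p $ 1)"
      using vector_fieldD[OF X] smooth_bounded_linear_comp[OF bounded_linear_eta0]
      by (simp add: scalar_field_def isot_eq)
    \<comment> \<open>This is the formula for phi^2 solved for X. It extends the vanishing from the
      arguments xi and phi X to every X.\<close>
    have X_eq: "X = (\<lambda>p. (sqrt \<alpha> * X p $ 1) *\<^sub>R ?\<xi> p + ?\<phi> (?\<phi> (\<lambda>p. - X p)) p)"
      using pos \<epsilon> by (auto simp: fun_eq_iff phi_eps_def xi0_eq vec5_eq_iff mult.assoc[symmetric])
    have lin: "equivariant (\<lambda>x. - x)"
      by (auto simp: equivariant_def linear_neg[OF linear_isot] intro!: linearI)
    have vm: "vector_field (\<lambda>p. - X p)"
      by (rule vector_field_equivariant[OF lin X])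
    have f\<xi>: "vector_field (\<lambda>p. (sqrt \<alpha> * X p $ 1) *\<^sub>R ?\<xi> p)"
      using f \<xi> by (auto simp: vector_field_def scalar_field_def linear_scale[OF linear_isot] intro: smooth_scaleR)
    have "D X Y = (\<lambda>p. (sqrt \<alpha> * X p $ 1) *\<^sub>R D ?\<xi> Y p + D (?\<phi> (?\<phi> (\<lambda>p. - X p))) Y p)"
      if "connection D" for D
    proof -
      have "D X Y = D (\<lambda>p. (sqrt \<alpha> * X p $ 1) *\<^sub>R ?\<xi> p + ?\<phi> (?\<phi> (\<lambda>p. - X p)) p) Y"
        using arg_cong[OF X_eq, of "\<lambda>V. D V Y"] .
      also have "\<dots> = (\<lambda>p. D (\<lambda>p. (sqrt \<alpha> * X p $ 1) *\<^sub>R ?\<xi> p) Y p + D (?\<phi> (?\<phi> (\<lambda>p. - X p))) Y p)"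
        by (rule connection_add_left[OF that f\<xi> vp[OF vp[OF vm]] Y])
      also have "D (\<lambda>p. (sqrt \<alpha> * X p $ 1) *\<^sub>R ?\<xi> p) Y = (\<lambda>p. (sqrt \<alpha> * X p $ 1) *\<^sub>R D ?\<xi> Y p)"
        by (rule connection_scaleR_left[OF that f \<xi> Y])
      finally show ?thesis .
    qed
    then have "D X Y p = (sqrt \<alpha> * X p $ 1) *\<^sub>R D ?\<xi> Y p + D (?\<phi> (?\<phi> (\<lambda>p. - X p))) Y p"
      "D' X Y p = (sqrt \<alpha> * X p $ 1) *\<^sub>R D' ?\<xi> Y p + D' (?\<phi> (?\<phi> (\<lambda>p. - X p))) Y p"
      using m unfolding metric_connection_def by presburger+
    then have "a X Y Z = sqrt \<alpha> * X p $ 1 * a ?\<xi> Y Z + a (?\<phi> (?\<phi> (\<lambda>p. - X p))) Y Z"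
      by (simp add: a_def gmet_def algebra_simps)
    then show "g (D' X Y p - D X Y p) (Z p) = 0"
      using 0[OF vp[OF vm] Y Z] a\<xi>[OF Y Z] by (simp add: a_def)
  qed
qed

lemma torsion3_Lc:
  assumes X: "vector_field X" and Y: "vector_field Y" and Z: "vector_field Z"
  shows "torsion3 g (cconn (Lc k0 l0)) X Y Z = wedge12 (eta0 \<alpha> \<beta> \<gamma>) (ext_deriv1 (eta0 \<alpha> \<beta> \<gamma>)) X Y Z"
    and "wedge12 (eta0 \<alpha> \<beta> \<gamma>) (ext_deriv1 (eta0 \<alpha> \<beta> \<gamma>)) X Y Z
       = (let e = coframe \<alpha> \<beta> \<gamma> in (\<lambda>p. 2 * sqrt \<alpha> / (5 * \<beta>) * wedge111 (e 1) (e 2) (e 3) X Y Z p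
            - sqrt \<alpha> / (5 * \<gamma>) * wedge111 (e 1) (e 4) (e 5) X Y Z p))"
proof -
  let ?w23 = "\<lambda>x y z :: real^5. x$1 * (y$2 * z$3 - y$3 * z$2) - y$1 * (x$2 * z$3 - x$3 * z$2) + z$1 * (x$2 * y$3 - x$3 * y$2)"
  let ?w45 = "\<lambda>x y z :: real^5. x$1 * (y$4 * z$5 - y$5 * z$4) - y$1 * (x$4 * z$5 - x$5 * z$4) + z$1 * (x$4 * y$5 - x$5 * y$4)"
  \<comment> \<open>Common coordinate expression of all three 3-forms in the unnormalised basis; the
    square roots of the coframe combine to alpha, beta and gamma.\<close>
  let ?T = "\<lambda>p. 2 * \<alpha> / 5 * ?w23 (X p) (Y p) (Z p) - \<alpha> / 5 * ?w45 (X p) (Y p) (Z p)"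
  have 1: "torsion3 g (cconn (Lc k0 l0)) X Y Z = ?T"
    by (simp only: torsion3_def ip_def torsion_cconn[OF X Y] torsion_Lc)
  have q: "sqrt \<alpha> * u * (sqrt \<alpha> * v) = \<alpha> * (u * v)" for u v
  proof -
    have "sqrt \<alpha> * u * (sqrt \<alpha> * v) = (sqrt \<alpha> * sqrt \<alpha>) * (u * v)" by (simp only: mult_ac)
    then show ?thesis by (simp only: sqrt_mult_self(1))
  qed
  have 2: "wedge12 (eta0 \<alpha> \<beta> \<gamma>) (ext_deriv1 (eta0 \<alpha> \<beta> \<gamma>)) X Y Z = ?T"
    unfolding eta0_eq wedge12_def ext_deriv1_const[OF bounded_linear_eta0 Y Z]
      ext_deriv1_const[OF bounded_linear_eta0 Z X] ext_deriv1_const[OF bounded_linear_eta0 X Y]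
      ev1_def mult_minus_right q
    by (rule ext) (simp add: br_def field_simps)
  have c: "2 * sqrt \<alpha> / (5 * \<beta>) * (sqrt \<alpha> * sqrt \<beta> * sqrt \<beta>) = 2 * \<alpha> / 5" "sqrt \<alpha> / (5 * \<gamma>) * (sqrt \<alpha> * sqrt \<gamma> * sqrt \<gamma>) = \<alpha> / 5"
  proof -
    have "sqrt \<alpha> * (sqrt \<alpha> * sqrt \<beta> * sqrt \<beta>) = (sqrt \<alpha> * sqrt \<alpha>) * (sqrt \<beta> * sqrt \<beta>)"
      "sqrt \<alpha> * (sqrt \<alpha> * sqrt \<gamma> * sqrt \<gamma>) = (sqrt \<alpha> * sqrt \<alpha>) * (sqrt \<gamma> * sqrt \<gamma>)"
      by (simp_all only: mult_ac)
    then have "sqrt \<alpha> * (sqrt \<alpha> * sqrt \<beta> * sqrt \<beta>) = \<alpha> * \<beta>" "sqrt \<alpha> * (sqrt \<alpha> * sqrt \<gamma> * sqrt \<gamma>) = \<alpha> * \<gamma>"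
      by (simp_all only: sqrt_mult_self)
    then show "2 * sqrt \<alpha> / (5 * \<beta>) * (sqrt \<alpha> * sqrt \<beta> * sqrt \<beta>) = 2 * \<alpha> / 5"
      "sqrt \<alpha> / (5 * \<gamma>) * (sqrt \<alpha> * sqrt \<gamma> * sqrt \<gamma>) = \<alpha> / 5"
      using pos by (simp_all only: times_divide_eq_left mult.assoc[of 2]) simp_all
  qed
  have w: "wedge111 (coframe \<alpha> \<beta> \<gamma> 1) (coframe \<alpha> \<beta> \<gamma> 2) (coframe \<alpha> \<beta> \<gamma> 3) X Y Z p
      = (sqrt \<alpha> * sqrt \<beta> * sqrt \<beta>) * ?w23 (X p) (Y p) (Z p)"
    "wedge111 (coframe \<alpha> \<beta> \<gamma> 1) (coframe \<alpha> \<beta> \<gamma> 4) (coframe \<alpha> \<beta> \<gamma> 5) X Y Z p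
      = (sqrt \<alpha> * sqrt \<gamma> * sqrt \<gamma>) * ?w45 (X p) (Y p) (Z p)" for p
    unfolding wedge111_def ev1_def coframe_eq by algebra+
  show "torsion3 g (cconn (Lc k0 l0)) X Y Z = wedge12 (eta0 \<alpha> \<beta> \<gamma>) (ext_deriv1 (eta0 \<alpha> \<beta> \<gamma>)) X Y Z"
    unfolding 1 2 ..
  show "wedge12 (eta0 \<alpha> \<beta> \<gamma>) (ext_deriv1 (eta0 \<alpha> \<beta> \<gamma>)) X Y Z
       = (let e = coframe \<alpha> \<beta> \<gamma> in (\<lambda>p. 2 * sqrt \<alpha> / (5 * \<beta>) * wedge111 (e 1) (e 2) (e 3) X Y Z p
            - sqrt \<alpha> / (5 * \<gamma>) * wedge111 (e 1) (e 4) (e 5) X Y Z p))"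
    unfolding 2 Let_def w mult.assoc[symmetric] c[unfolded mult.assoc[symmetric]] ..
qed

subsection \<open>The Sasakian condition\<close>

lemma sasakian_iff:
  "sasakian g (xi0 \<alpha> \<beta> \<gamma>) (eta0 \<alpha> \<beta> \<gamma>) (phi_plus \<alpha> \<beta> \<gamma>) \<longleftrightarrow> \<alpha> = 25 * \<beta>\<^sup>2 \<and> 25 * \<beta>\<^sup>2 = 100 * \<gamma>\<^sup>2"
proof -
  have F: "(\<lambda>p. 2 * fundamental_form g (\<lambda>p. phi_eps 1) X Y p) = (\<lambda>p. 2 * g (X p) (phi_eps 1 (Y p)))"
    and d: "vector_field X \<Longrightarrow> vector_field Y \<Longrightarrow> ext_deriv1 (eta0 \<alpha> \<beta> \<gamma>) X Y = (\<lambda>p. - (sqrt \<alpha> * br (X p) (Y p) $ 1))" for X Y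
    unfolding fundamental_form_phi_eps eta0_eq
    using ext_deriv1_const[OF bounded_linear_eta0] by auto
  have "sasakian g (xi0 \<alpha> \<beta> \<gamma>) (eta0 \<alpha> \<beta> \<gamma>) (phi_plus \<alpha> \<beta> \<gamma>) \<longleftrightarrow>
      (\<forall>X Y. vector_field X \<longrightarrow> vector_field Y \<longrightarrow>
        (\<lambda>p. 2 * g (X p) (phi_eps 1 (Y p))) = (\<lambda>p. - (sqrt \<alpha> * br (X p) (Y p) $ 1)))"
    using invariant_acm_phi_eps[of 1] normal_phi_eps[of 1]
    unfolding sasakian_def phi_plus_eq invariant_acm_def F by (auto simp: d)
  also have "\<dots> \<longleftrightarrow> (\<forall>x y. 2 * g x (phi_eps 1 y) = - (sqrt \<alpha> * br x y $ 1))"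
  proof (intro iffI allI)
    fix x y
    assume h: "\<forall>X Y. vector_field X \<longrightarrow> vector_field Y \<longrightarrow>
        (\<lambda>p. 2 * g (X p) (phi_eps 1 (Y p))) = (\<lambda>p. - (sqrt \<alpha> * br (X p) (Y p) $ 1))"
    \<comment> \<open>Fields with prescribed values at the unit reduce the identity between fields
      to one between vectors.\<close>
    obtain X where X: "vector_field X" "X gunit = x" by (rule vector_field_with_value)
    obtain Y where Y: "vector_field Y" "Y gunit = y" by (rule vector_field_with_value)
    show "2 * g x (phi_eps 1 y) = - (sqrt \<alpha> * br x y $ 1)"
      using fun_cong[OF h[rule_format, OF X(1) Y(1)], of gunit] by (simp only: X(2) Y(2))
  qed auto
  also have "\<dots> \<longleftrightarrow> sqrt \<alpha> = 5 * \<beta> \<and> sqrt \<alpha> = 10 * \<gamma>"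
  proof
    assume h: "\<forall>x y. 2 * g x (phi_eps 1 y) = - (sqrt \<alpha> * br x y $ 1)"
    show "sqrt \<alpha> = 5 * \<beta> \<and> sqrt \<alpha> = 10 * \<gamma>"
      \<comment> \<open>F and d eta live on the planes (2,3) and (4,5). For phi_+ their signs agree
        on both, so only the sizes are compared.\<close>
      using h[rule_format, of "v5 0 1 0 0 0" "v5 0 0 1 0 0"] h[rule_format, of "v5 0 0 0 1 0" "v5 0 0 0 0 1"]
      by (simp add: gmet_def phi_eps_def br_def)
  next
    assume h: "sqrt \<alpha> = 5 * \<beta> \<and> sqrt \<alpha> = 10 * \<gamma>"
    then have s: "sqrt \<alpha> = 10 * \<gamma>" "\<beta> = 2 * \<gamma>" by auto
    show "\<forall>x y. 2 * g x (phi_eps 1 y) = - (sqrt \<alpha> * br x y $ 1)"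
      unfolding s(1) unfolding s(2) by (simp add: gmet_def phi_eps_def br_def field_simps)
  qed
  also have "\<dots> \<longleftrightarrow> \<alpha> = 25 * \<beta>\<^sup>2 \<and> 25 * \<beta>\<^sup>2 = 100 * \<gamma>\<^sup>2"
  proof -
    have "sqrt \<alpha> = 5 * \<beta> \<longleftrightarrow> \<alpha> = (5 * \<beta>)\<^sup>2" "sqrt \<alpha> = 10 * \<gamma> \<longleftrightarrow> \<alpha> = (10 * \<gamma>)\<^sup>2"
      using pos by (metis real_sqrt_pow2 real_sqrt_unique less_imp_le mult_nonneg_nonneg zero_le_numeral)+
    then show ?thesis by (auto simp: power_mult_distrib)
  qed
  finally show ?thesis .
qed

subsection \<open>The characteristic connection of the irreducible SO(3) structure\<close>

lemma gmet_onb_self: "g (onb \<alpha> \<beta> \<gamma> 1) (onb \<alpha> \<beta> \<gamma> 1) = 1" "g (onb \<alpha> \<beta> \<gamma> 2) (onb \<alpha> \<beta> \<gamma> 2) = 1" "g (onb \<alpha> \<beta> \<gamma> 3) (onb \<alpha> \<beta> \<gamma> 3) = 1" "g (onb \<alpha> \<beta> \<gamma> 4) (onb \<alpha> \<beta> \<gamma> 4) = 1" "g (onb \<alpha> \<beta> \<gamma> 5) (onb \<alpha> \<beta> \<gamma> 5) = 1"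
  using pos by (simp_all add: gmet_def onb_eq)

lemma so3_elem_entry:
  "g (so3_elem \<alpha> \<beta> \<gamma> a b c x) y = (let E = (\<lambda>i j. g x (onb \<alpha> \<beta> \<gamma> i) * g (onb \<alpha> \<beta> \<gamma> j) y - g x (onb \<alpha> \<beta> \<gamma> j) * g (onb \<alpha> \<beta> \<gamma> i) y) in
     a * (sqrt 3 * E 1 3 + E 4 2 + E 5 3) + b * (sqrt 3 * E 2 1 + E 3 4 + E 5 2) + c * (E 2 3 + 2 * E 4 5))"
  by (simp add: so3_elem_def Em_def Let_def bounded_bilinear.add_left[OF bounded_bilinear_gmet]
      bounded_bilinear.scaleR_left[OF bounded_bilinear_gmet] bounded_bilinear.diff_left[OF bounded_bilinear_gmet])

lemma preserves_SO3ir_diff: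
  assumes "preserves_SO3ir \<alpha> \<beta> \<gamma> D" "preserves_SO3ir \<alpha> \<beta> \<gamma> D'" "vector_field X"
  obtains a b c where "\<And>Y. vector_field Y \<Longrightarrow> D' X Y p - D X Y p = so3_elem \<alpha> \<beta> \<gamma> a b c (Y p)"
proof -
  obtain A A' where A: "A \<in> so3ir \<alpha> \<beta> \<gamma>" "\<And>Y. vector_field Y \<Longrightarrow> D X Y p = along X Y p + A (Y p)"
    and A': "A' \<in> so3ir \<alpha> \<beta> \<gamma>" "\<And>Y. vector_field Y \<Longrightarrow> D' X Y p = along X Y p + A' (Y p)"
    using assms unfolding preserves_SO3ir_def by metis
  obtain a b c a' b' c' where "A = so3_elem \<alpha> \<beta> \<gamma> a b c" "A' = so3_elem \<alpha> \<beta> \<gamma> a' b' c'"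
    using A(1) A'(1) unfolding so3ir_eq by blast
  then have "D' X Y p - D X Y p = so3_elem \<alpha> \<beta> \<gamma> (a' - a) (b' - b) (c' - c) (Y p)" if "vector_field Y" for Y
    using that A(2) A'(2) by (simp add: so3_elem_diff)
  then show thesis by (rule that)
qed

text \<open>The difference is a 3-form with values in the Lie algebra of the irreducible SO(3); evaluation on
  the frame shows that it vanishes.\<close>

lemma characteristic_connection_SO3ir_unique:
  assumes D: "characteristic_connection_SO3ir \<alpha> \<beta> \<gamma> D" "characteristic_connection_SO3ir \<alpha> \<beta> \<gamma> D'"
    and X: "vector_field X" and Y: "vector_field Y"
  shows "D' X Y = D X Y"
proof -
  have m: "metric_connection g D" "metric_connection g D'" and T: "skew_torsion g D" "skew_torsion g D'"
    and P: "preserves_SO3ir \<alpha> \<beta> \<gamma> D" "preserves_SO3ir \<alpha> \<beta> \<gamma> D'"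
    using D by (auto simp: characteristic_connection_SO3ir_def)
  show ?thesis
  proof (rule connection_eqI[OF m gmet_pos X Y])
    fix Z p
    assume Z: "vector_field Z"
    define t where "t X Y Z = g (D' X Y p - D X Y p) (Z p)" for X Y Z
    have s1: "t X Y Z = - t X Z Y" and s2: "t X Y Z = - t Y X Z"
      if "vector_field X" "vector_field Y" "vector_field Z" for X Y Z
      unfolding t_def using metric_connection_diff_skew[OF m bounded_bilinear_gmet gmet_sym T that] by blast+
    \<comment> \<open>These fields agree with the frame at the single point p, which is all that the
      tensor t sees.\<close>
    have "\<exists>W. vector_field W \<and> W p = onb \<alpha> \<beta> \<gamma> i" for i
      using vector_field_with_value by metis
    then obtain W where W: "\<And>i. vector_field (W i)" "\<And>i. W i p = onb \<alpha> \<beta> \<gamma> i" by metis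
    define E where "E x y i j = g x (onb \<alpha> \<beta> \<gamma> i) * g (onb \<alpha> \<beta> \<gamma> j) y - g x (onb \<alpha> \<beta> \<gamma> j) * g (onb \<alpha> \<beta> \<gamma> i) y" for x y i j
    have "\<exists>a b c. \<forall>Y Z. vector_field Y \<longrightarrow> t X Y Z = a * (sqrt 3 * E (Y p) (Z p) 1 3 + E (Y p) (Z p) 4 2 + E (Y p) (Z p) 5 3)
        + b * (sqrt 3 * E (Y p) (Z p) 2 1 + E (Y p) (Z p) 3 4 + E (Y p) (Z p) 5 2) + c * (E (Y p) (Z p) 2 3 + 2 * E (Y p) (Z p) 4 5)"
      if V: "vector_field X" for X
    proof -
      obtain a b c where "\<And>Y. vector_field Y \<Longrightarrow> D' X Y p - D X Y p = so3_elem \<alpha> \<beta> \<gamma> a b c (Y p)"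
        by (rule preserves_SO3ir_diff[OF P V, of p]) blast
      then show ?thesis
        unfolding t_def E_def by (intro exI[of _ a] exI[of _ b] exI[of _ c]) (simp add: so3_elem_entry Let_def)
    qed
    then obtain a b c where abc: "\<And>X Y Z. vector_field X \<Longrightarrow> vector_field Y \<Longrightarrow>
        t X Y Z = a X * (sqrt 3 * E (Y p) (Z p) 1 3 + E (Y p) (Z p) 4 2 + E (Y p) (Z p) 5 3)
        + b X * (sqrt 3 * E (Y p) (Z p) 2 1 + E (Y p) (Z p) 3 4 + E (Y p) (Z p) 5 2)
        + c X * (E (Y p) (Z p) 2 3 + 2 * E (Y p) (Z p) 4 5)"
      by metis
    \<comment> \<open>Elements of the Lie algebra have zero entries at (1,4) and (1,5), and their
      entry at (4,5) is twice that at (2,3). These relations are what total skewness contradicts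
      unless t vanishes.\<close>
    have n: "t X (W 1) (W 2) = - (sqrt 3 * b X)" "t X (W 1) (W 3) = sqrt 3 * a X" "t X (W 1) (W 4) = 0" "t X (W 1) (W 5) = 0"
      "t X (W 2) (W 3) = c X" "t X (W 4) (W 5) = 2 * c X"
      if "vector_field X" for X
      using abc[OF that W(1)] by (simp_all add: W(2) E_def gmet_onb_self Em_onb)
    have zero: "t (W i) Y Z = 0" if "a (W i) = 0" "b (W i) = 0" "c (W i) = 0" "vector_field Y" for i Y Z
      using abc[OF W(1) that(4)] that(1-3) by simp
    have diag: "t (W i) (W i) (W j) = 0" for i j
      using s2[OF W(1) W(1) W(1), of i i j] by simp
    have "a (W 1) = 0" "b (W 1) = 0"
      using n(1,2)[OF W(1), of 1] diag[of 1 2] diag[of 1 3] by simp_all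
    \<comment> \<open>2 c(e_1) = t(e_1, e_4, e_5) = - t(e_4, e_1, e_5), and the latter is an entry
      at (1,5).\<close>
    moreover have "c (W 1) = 0"
      using n(6)[OF W(1), of 1] n(4)[OF W(1), of 4] s2[OF W(1) W(1) W(1), of 1 4 5] by simp
    ultimately have t1: "t (W 1) Y Z = 0" if "vector_field Y" for Y Z
      using zero that by blast
    \<comment> \<open>By skewness t(X, e_1, e_j) = - t(e_1, X, e_j), which has just been shown to
      vanish.\<close>
    have ab: "a X = 0" "b X = 0" if "vector_field X" for X
      using n(1,2)[OF that] s2[OF that W(1) W(1), of 1 2] s2[OF that W(1) W(1), of 1 3] t1[OF that] by simp_all
    have "c (W 2) = 0"
      using n(5)[OF W(1), of 2] diag[of 2 3] by simp
    then have "t (W 2) Y Z = 0" if "vector_field Y" for Y Z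
      using zero ab W(1) that by blast
    then have "c X = 0"
      using n(5)[OF X] s2[OF X W(1) W(1), of 2 3] X by simp
    then have "t X Y Z = 0"
      using abc[OF X Y] ab[OF X] by simp
    then show "g (D' X Y p - D X Y p) (Z p) = 0"
      by (simp add: t_def)
  qed
qed

text \<open>By the chain rule the derivative of Upsilon(v, v, v) cancels against the componentwise
  part of the connection, leaving -3 Upsilon(Lg(v, v), v, v). On the diagonal \<open>Lg\<close>
  equals \<open>Lc\<close>, because the bracket vanishes there.\<close>

lemma cov_deriv3_Upsilon:
  assumes v: "vector_field v"
  shows "cov_deriv3 (cconn (Lg k l)) (Upsilon \<alpha> \<beta> \<gamma>) v v v v p =
    3 * sqrt 3 * (2 * k - l) * v p $ 1 * (\<beta> * sqrt \<gamma> * (v p $ 2 * v p $ 3 * v p $ 5 + ((v p $ 2)\<^sup>2 - (v p $ 3)\<^sup>2) * v p $ 4 / 2))"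
proof -
  define d where "d x h = dcub (g x (onb \<alpha> \<beta> \<gamma> 1)) (g x (onb \<alpha> \<beta> \<gamma> 2)) (g x (onb \<alpha> \<beta> \<gamma> 3)) (g x (onb \<alpha> \<beta> \<gamma> 4)) (g x (onb \<alpha> \<beta> \<gamma> 5))
    (g h (onb \<alpha> \<beta> \<gamma> 1)) (g h (onb \<alpha> \<beta> \<gamma> 2)) (g h (onb \<alpha> \<beta> \<gamma> 3)) (g h (onb \<alpha> \<beta> \<gamma> 4)) (g h (onb \<alpha> \<beta> \<gamma> 5))" for x h
  note ga = bounded_bilinear.add_left[OF bounded_bilinear_gmet]
  have C: "Upsilon_cubic \<alpha> \<beta> \<gamma> = (\<lambda>x. cub (g x (onb \<alpha> \<beta> \<gamma> 1)) (g x (onb \<alpha> \<beta> \<gamma> 2)) (g x (onb \<alpha> \<beta> \<gamma> 3)) (g x (onb \<alpha> \<beta> \<gamma> 4)) (g x (onb \<alpha> \<beta> \<gamma> 5)))"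
    by (simp add: Upsilon_cubic_def cub_def fun_eq_iff Let_def)
  have lin: "((\<lambda>x. g x y) has_derivative (\<lambda>h. g h y)) (at x)" for x y
    by (rule bounded_linear_imp_has_derivative[OF bounded_bilinear.bounded_linear_left[OF bounded_bilinear_gmet]])
  have deriv: "(Upsilon_cubic \<alpha> \<beta> \<gamma> has_derivative d x) (at x)" for x
    unfolding C d_def by (rule has_derivative_cub[OF lin lin lin lin lin])
  have dU: "Upsilon \<alpha> \<beta> \<gamma> w v v = (\<lambda>p. d (v p) (w p) / 3)" for w v
    by (simp only: Upsilon_def C Let_def d_def ga cub_polarisation)
  have dU': "Upsilon \<alpha> \<beta> \<gamma> v w v = Upsilon \<alpha> \<beta> \<gamma> w v v" "Upsilon \<alpha> \<beta> \<gamma> v v w = Upsilon \<alpha> \<beta> \<gamma> w v v" for w v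
    by (simp_all add: Upsilon_def Let_def fun_eq_iff add.commute add.left_commute)
  note dU'' = trans[OF dU'(1) dU] trans[OF dU'(2) dU]
  have "d x x / 3 = Upsilon_cubic \<alpha> \<beta> \<gamma> x" for x
    by (simp only: d_def dcub_self C)
  then have "along v (Upsilon \<alpha> \<beta> \<gamma> v v v) p = d (v p) (along v v p)"
    using along_chain[OF vector_fieldD(1)[OF v] deriv] by (simp only: dU)
  moreover have "d x (h + h') = d x h + d x h'" for x h h'
    by (simp only: d_def ga dcub_add)
  moreover have "Lg k l x x = Lc k l x x" for x
    by (simp add: Lg_def br_def Lc_def vec5_eq_iff)
  ultimately have "cov_deriv3 (cconn (Lg k l)) (Upsilon \<alpha> \<beta> \<gamma>) v v v v p = - d (v p) (Lc k l (v p) (v p))"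
    by (simp add: cov_deriv3_def dU dU'' cconn_def diff_divide_distrib add_divide_distrib)
  also have "d (v p) (Lc k l (v p) (v p)) = - (3 * sqrt 3 * (2 * k - l) * v p $ 1 *
      (sqrt \<beta> * v p $ 2 * (sqrt \<beta> * v p $ 3) * (sqrt \<gamma> * v p $ 5) + ((sqrt \<beta> * v p $ 2)\<^sup>2 - (sqrt \<beta> * v p $ 3)\<^sup>2) * (sqrt \<gamma> * v p $ 4) / 2))"
  proof -
    have r: "s * (m * t * u) = m * t * (s * u)" for s m t u :: real by (simp only: mult_ac)
    show ?thesis
      unfolding d_def gmet_onb Lc_def v5_nth r mult_zero_right dcub_Lc ..
  qed
  also have "- \<dots> = 3 * sqrt 3 * (2 * k - l) * v p $ 1 * ((sqrt \<beta> * sqrt \<beta>) * sqrt \<gamma> * (v p $ 2 * v p $ 3 * v p $ 5 + ((v p $ 2)\<^sup>2 - (v p $ 3)\<^sup>2) * v p $ 4 / 2))"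
    unfolding power2_eq_square minus_minus by (simp only: mult_ac ring_distribs times_divide_eq_left times_divide_eq_right)
  finally show ?thesis
    by (simp only: sqrt_mult_self)
qed

text \<open>The Levi-Civita connection is the characteristic connection minus half of its torsion;
  total skewness of the torsion keeps the result metric.\<close>

lemma levi_civita_Lg: "levi_civita g (cconn (Lg k0 l0))"
  unfolding levi_civita_def
proof (intro conjI allI impI)
  have T: "g (Lc k0 l0 x y - Lc k0 l0 y x - br x y) z = - g y (Lc k0 l0 x z - Lc k0 l0 z x - br x z)" for x y z
    unfolding gmet_sym[of _ _ _ y] torsion_Lc by (simp add: field_simps)
  have S: "g (Lc k0 l0 x y) z + g y (Lc k0 l0 x z) = 0" for x y z
    by (simp add: gmet_def Lc_def algebra_simps)
  have "Lg k l x y = Lc k l x y - (1/2) *\<^sub>R (Lc k l x y - Lc k l y x - br x y)" for k l x y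
    by (simp add: Lg_def vec5_eq_iff field_simps)
  moreover have "g (u - (1/2) *\<^sub>R w) z = g u z - 1/2 * g w z" "g y (u - (1/2) *\<^sub>R w) = g y u - 1/2 * g y w" for u w y z
    by (simp_all add: bounded_bilinear.diff_left[OF bounded_bilinear_gmet] bounded_bilinear.diff_right[OF bounded_bilinear_gmet]
        bounded_bilinear.scaleR_left[OF bounded_bilinear_gmet] bounded_bilinear.scaleR_right[OF bounded_bilinear_gmet])
  ultimately have "g (Lg k0 l0 x y) z + g y (Lg k0 l0 x z) = 0" for x y z
    using S[of x y z] T[of x y z] by simp
  then show "metric_connection g (cconn (Lg k0 l0))"
    by (rule metric_connection_cconn[OF equivariant2_Lg bounded_bilinear_gmet])
  show "torsion (cconn (Lg k0 l0)) X Y = (\<lambda>p. 0)" if "vector_field X" "vector_field Y" for X Y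
    unfolding torsion_cconn[OF that] by (simp add: Lg_def br_def vec5_eq_iff fun_eq_iff field_simps)
qed

lemma nearly_integrable_iff: "nearly_integrable_SO3ir \<alpha> \<beta> \<gamma> \<longleftrightarrow> l0 = 2 * k0"
proof
  assume "nearly_integrable_SO3ir \<alpha> \<beta> \<gamma>"
  then obtain D where D: "levi_civita g D" "\<And>v. vector_field v \<Longrightarrow> cov_deriv3 D (Upsilon \<alpha> \<beta> \<gamma>) v v v v = (\<lambda>p. 0)"
    unfolding nearly_integrable_SO3ir_def by blast
  \<comment> \<open>At this vector the factor after 2 k - l in \<open>cov_deriv3_Upsilon\<close> is
    beta sqrt(gamma) / 2, hence nonzero.\<close>
  obtain v where v: "vector_field v" "v gunit = v5 1 1 0 1 0"
    using vector_field_with_value by blast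
  have "D v v = cconn (Lg k0 l0) v v"
    by (rule levi_civita_unique[OF levi_civita_Lg D(1) bounded_bilinear_gmet gmet_sym gmet_pos v(1) v(1)])
  then have "cov_deriv3 (cconn (Lg k0 l0)) (Upsilon \<alpha> \<beta> \<gamma>) v v v v gunit = 0"
    using fun_cong[OF D(2)[OF v(1)], of gunit] by (simp add: cov_deriv3_def)
  then show "l0 = 2 * k0"
    unfolding cov_deriv3_Upsilon[OF v(1)] v(2) v5_nth using pos by simp
next
  assume "l0 = 2 * k0"
  then show "nearly_integrable_SO3ir \<alpha> \<beta> \<gamma>"
    unfolding nearly_integrable_SO3ir_def using levi_civita_Lg cov_deriv3_Upsilon[of _ k0 l0] by (auto simp: fun_eq_iff)
qed

lemma characteristic_connection_SO3ir_Lc: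
  assumes "l0 = 2 * k0"
  shows "characteristic_connection_SO3ir \<alpha> \<beta> \<gamma> (cconn (Lc k0 l0))"
proof -
  have "Lc k (2 * k) x y = so3_elem \<alpha> \<beta> \<gamma> 0 0 (k * x $ 1) y" for k x y
    by (simp add: Lc_def so3_elem_def Let_def Em_eq vec5_eq_iff)
  then have "preserves_SO3ir \<alpha> \<beta> \<gamma> (cconn (Lc k0 l0))"
    unfolding preserves_SO3ir_def assms so3ir_eq cconn_def by blast
  then show ?thesis
    by (simp add: characteristic_connection_SO3ir_def metric_connection_Lc skew_torsion_Lc)
qed

end

theorem theorem4p3:
  fixes \<alpha> \<beta> \<gamma> :: real
  assumes "\<alpha> > 0" and "\<beta> > 0" and "\<gamma> > 0"
  shows
    "phi_plus \<alpha> \<beta> \<gamma> \<noteq> phi_minus \<alpha> \<beta> \<gamma>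
     \<and> (\<forall>\<phi> \<in> {phi_plus \<alpha> \<beta> \<gamma>, phi_minus \<alpha> \<beta> \<gamma>}.
          invariant_acm (gmet \<alpha> \<beta> \<gamma>) (xi0 \<alpha> \<beta> \<gamma>) (eta0 \<alpha> \<beta> \<gamma>) \<phi>
          \<and> normal_acm (xi0 \<alpha> \<beta> \<gamma>) (eta0 \<alpha> \<beta> \<gamma>) \<phi>
          \<and> closed_fundamental_form (gmet \<alpha> \<beta> \<gamma>) \<phi>)
     \<and> (\<forall>\<xi> \<eta> \<phi>.
          invariant_acm (gmet \<alpha> \<beta> \<gamma>) \<xi> \<eta> \<phi> \<and> normal_acm \<xi> \<eta> \<phi> \<longrightarrow>
          (\<exists>\<sigma> \<in> {1, -1}. \<exists>\<tau> \<in> {1, -1}. \<exists>\<psi> \<in> {phi_plus \<alpha> \<beta> \<gamma>, phi_minus \<alpha> \<beta> \<gamma>}.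
             \<xi> = (\<lambda>p. \<sigma> *\<^sub>R xi0 \<alpha> \<beta> \<gamma> p)
             \<and> \<eta> = (\<lambda>p x. \<sigma> * eta0 \<alpha> \<beta> \<gamma> p x)
             \<and> \<phi> = (\<lambda>p x. \<tau> *\<^sub>R \<psi> p x)))
     \<and> (\<exists>D.
          (\<forall>\<phi> \<in> {phi_plus \<alpha> \<beta> \<gamma>, phi_minus \<alpha> \<beta> \<gamma>}.
             the_unique_connection
               (characteristic_connection_acm (gmet \<alpha> \<beta> \<gamma>) (xi0 \<alpha> \<beta> \<gamma>) (eta0 \<alpha> \<beta> \<gamma>) \<phi>) D)
          \<and> (\<forall>X Y Z. vector_field X \<longrightarrow> vector_field Y \<longrightarrow> vector_field Z \<longrightarrow>
               torsion3 (gmet \<alpha> \<beta> \<gamma>) D X Y Z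
                 = wedge12 (eta0 \<alpha> \<beta> \<gamma>) (ext_deriv1 (eta0 \<alpha> \<beta> \<gamma>)) X Y Z
               \<and> wedge12 (eta0 \<alpha> \<beta> \<gamma>) (ext_deriv1 (eta0 \<alpha> \<beta> \<gamma>)) X Y Z
                 = (let e = coframe \<alpha> \<beta> \<gamma> in (\<lambda>p.
                      2 * sqrt \<alpha> / (5 * \<beta>) * wedge111 (e 1) (e 2) (e 3) X Y Z p
                      - sqrt \<alpha> / (5 * \<gamma>) * wedge111 (e 1) (e 4) (e 5) X Y Z p)))
          \<and> (nearly_integrable_SO3ir \<alpha> \<beta> \<gamma> \<longrightarrow>
               the_unique_connection (characteristic_connection_SO3ir \<alpha> \<beta> \<gamma>) D))
     \<and> (sasakian (gmet \<alpha> \<beta> \<gamma>) (xi0 \<alpha> \<beta> \<gamma>) (eta0 \<alpha> \<beta> \<gamma>) (phi_plus \<alpha> \<beta> \<gamma>)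
          \<longleftrightarrow> \<alpha> = 25 * \<beta>\<^sup>2 \<and> 25 * \<beta>\<^sup>2 = 100 * \<gamma>\<^sup>2)
     \<and> (let a = 25/36; b = 1/6; c = 1/12 in
          sasakian (gmet a b c) (xi0 a b c) (eta0 a b c) (phi_plus a b c)
          \<and> nearly_integrable_SO3ir a b c)"
proof -
  note pos = assms
  let ?g = "gmet \<alpha> \<beta> \<gamma>" and ?\<xi> = "xi0 \<alpha> \<beta> \<gamma>" and ?\<eta> = "eta0 \<alpha> \<beta> \<gamma>"
  let ?k = "2 * \<alpha> / (5 * \<beta>) - 2" and ?l = "1 - \<alpha> / (5 * \<gamma>)"
  have "phi_eps 1 (v5 0 0 0 1 0) $ 5 \<noteq> phi_eps (- 1) (v5 0 0 0 1 0) $ 5"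
    by (simp add: phi_eps_def)
  then have 1: "phi_plus \<alpha> \<beta> \<gamma> \<noteq> phi_minus \<alpha> \<beta> \<gamma>"
    unfolding phi_plus_eq[OF pos] phi_minus_eq[OF pos] by metis
  have ex: "\<exists>\<epsilon>. \<epsilon> * \<epsilon> = 1 \<and> \<phi> = (\<lambda>p. phi_eps \<epsilon>)" if "\<phi> \<in> {phi_plus \<alpha> \<beta> \<gamma>, phi_minus \<alpha> \<beta> \<gamma>}" for \<phi>
    using that unfolding phi_plus_eq[OF pos] phi_minus_eq[OF pos] by force
  have 2: "\<forall>\<phi> \<in> {phi_plus \<alpha> \<beta> \<gamma>, phi_minus \<alpha> \<beta> \<gamma>}.
      invariant_acm ?g ?\<xi> ?\<eta> \<phi> \<and> normal_acm ?\<xi> ?\<eta> \<phi> \<and> closed_fundamental_form ?g \<phi>"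
    using ex invariant_acm_phi_eps[OF pos] normal_phi_eps[OF pos] closed_phi_eps[OF pos] by metis
  have 3: "\<forall>\<phi> \<in> {phi_plus \<alpha> \<beta> \<gamma>, phi_minus \<alpha> \<beta> \<gamma>}.
      the_unique_connection (characteristic_connection_acm ?g ?\<xi> ?\<eta> \<phi>) (cconn (Lc ?k ?l))"
  proof
    fix \<phi>
    assume "\<phi> \<in> {phi_plus \<alpha> \<beta> \<gamma>, phi_minus \<alpha> \<beta> \<gamma>}"
    then obtain \<epsilon> where \<epsilon>: "\<epsilon> * \<epsilon> = 1" "\<phi> = (\<lambda>p. phi_eps \<epsilon>)" using ex by blast
    show "the_unique_connection (characteristic_connection_acm ?g ?\<xi> ?\<eta> \<phi>) (cconn (Lc ?k ?l))"
      unfolding the_unique_connection_def \<epsilon>(2)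
      using characteristic_connection_acm_Lc[OF pos]
        characteristic_connection_acm_unique[OF pos characteristic_connection_acm_Lc[OF pos] _ \<epsilon>(1)] by blast
  qed
  have 4: "the_unique_connection (characteristic_connection_SO3ir \<alpha> \<beta> \<gamma>) (cconn (Lc ?k ?l))"
    if "nearly_integrable_SO3ir \<alpha> \<beta> \<gamma>"
  proof -
    have c: "characteristic_connection_SO3ir \<alpha> \<beta> \<gamma> (cconn (Lc ?k ?l))"
      using that characteristic_connection_SO3ir_Lc[OF pos] nearly_integrable_iff[OF pos] by blast
    then show ?thesis
      unfolding the_unique_connection_def using characteristic_connection_SO3ir_unique[OF pos c] by blast
  qed
  have pos': "(25/36::real) > 0" "(1/6::real) > 0" "(1/12::real) > 0" by simp_all
  \<comment> \<open>On the Sasakian metrics alpha = 100 gamma^2 and beta = 2 gamma, so k = 20 gamma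
    - 2 and l = 1 - 20 gamma; the condition l = 2 k then singles out gamma = 1/12.\<close>
  have 5: "let a = 25/36; b = 1/6; c = 1/12 in
      sasakian (gmet a b c) (xi0 a b c) (eta0 a b c) (phi_plus a b c) \<and> nearly_integrable_SO3ir a b c"
    unfolding Let_def sasakian_iff[OF pos'] nearly_integrable_iff[OF pos'] by (simp add: power2_eq_square)
  show ?thesis
  proof (intro conjI)
    show "\<exists>D. (\<forall>\<phi> \<in> {phi_plus \<alpha> \<beta> \<gamma>, phi_minus \<alpha> \<beta> \<gamma>}.
             the_unique_connection (characteristic_connection_acm ?g ?\<xi> ?\<eta> \<phi>) D)
          \<and> (\<forall>X Y Z. vector_field X \<longrightarrow> vector_field Y \<longrightarrow> vector_field Z \<longrightarrow>
               torsion3 ?g D X Y Z = wedge12 ?\<eta> (ext_deriv1 ?\<eta>) X Y Z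
               \<and> wedge12 ?\<eta> (ext_deriv1 ?\<eta>) X Y Z
                 = (let e = coframe \<alpha> \<beta> \<gamma> in (\<lambda>p.
                      2 * sqrt \<alpha> / (5 * \<beta>) * wedge111 (e 1) (e 2) (e 3) X Y Z p
                      - sqrt \<alpha> / (5 * \<gamma>) * wedge111 (e 1) (e 4) (e 5) X Y Z p)))
          \<and> (nearly_integrable_SO3ir \<alpha> \<beta> \<gamma> \<longrightarrow>
               the_unique_connection (characteristic_connection_SO3ir \<alpha> \<beta> \<gamma>) D)"
      using 3 4 torsion3_Lc[OF pos] by (intro exI[of _ "cconn (Lc ?k ?l)"] conjI allI impI) blast+
  qed (use 1 2 5 invariant_acm_classification[OF pos] sasakian_iff[OF pos] in \<open>blast+\<close>)
qed

end
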